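(* Let $\sigma$ be an irreducible incommensurable normalized multiscale substitution scheme in $\mathbb{R}^d$, let $\mathcal{T}\in\mathbb{X}_\sigma^F$ and let $\mathcal{P}$ be a patch in $\mathcal{T}$. For any van Hove sequence $(A_q)_{q\ge1}$ in $\mathbb{R}^d$, $$\mathrm{freq}(\mathcal{P},\mathcal{T}):=\lim_{q\to\infty}\frac{L_{\mathcal{P}}(A_q+h)}{\mathrm{vol}(A_q)}=0$$ uniformly in $h\in\mathbb{R}^d$, where $L_{\mathcal{P}}(A):=\#\{g\in\mathbb{R}^d:\ g+\mathcal{P}\subset\mathcal{T},\ g+\mathrm{supp}(\mathcal{P})\subset A\}$.
   Context: Schemes. A tile in $\mathbb{R}^d$ is a bounded Lebesgue measurable set $T$ of positive measure $\mathrm{vol}\,T$ whose boundary has measure zero. A tessellation of $U\subset\mathbb{R}^d$ is a collection of tiles with pairwise disjoint interiors and union $U$; it is called a patch if $U$ is bounded ($U$ is then the support, $\mathrm{supp}$, of the patch; patches here are non-empty) and a tiling if $U=\mathbb{R}^d$. $g+\mathcal{P}\subset\mathcal{T}$ means that every tile of $g+\mathcal{P}$ is a tile of $\mathcal{T}$. A multiscale substitution scheme $\sigma=(\tau_\sigma,\varrho_\sigma)$ consists of a finite list of prototiles $\tau_\sigma=(T_1,\dots,T_n)$ and, for each $i$, a tessellation $\varrho_\sigma(T_i)$ of $T_i$ all of whose tiles are translates of rescaled prototiles $\alpha T_j$, with all $\alpha\in(0,1)$. A translate of $\alpha T_j$, $\alpha>0$, is a tile of type $j$ and scale $\alpha$.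 Standing assumptions: $\sigma$ is normalized, i.e. $\mathrm{vol}\,T_i=1$ for all $i$; distinct prototiles are geometrically different ($T_i$ is not a rescaled copy of $T_j$ for $i\ne j$), so the type of a tile is determined by the tile. Substitution semi-flow. For $t\ge 0$, $F_t(T_i)$ is the patch supported on $e^tT_i$ obtained by starting with $e^tT_i$ and repeatedly substituting (according to the rescaled rule $\varrho_\sigma$) every tile of volume $>1$, until all tiles have volume $\le 1$. $\sigma$ is irreducible if for all $i,j$ there is $t>0$ such that $F_t(T_i)$ contains a tile of type $j$. $\sigma$ is incommensurable if there are $i,j$ and $t_1,t_2>0$ with $t_1\notin\mathbb{Q}t_2$ such that $F_{t_1}(T_i)$ contains a tile of type $i$ and unit volume and $F_{t_2}(T_j)$ contains a tile of type $j$ and unit volume. Tiling space. Position each $T_i$ so that the origin is an interior point. Let $\mathscr{P}_\sigma=\{F_t(T_i): t\ge0,\ i=1,\dots,n\}$. Identify a patch or tiling with the closed set which is the union of the boundaries of its tiles. On closed subsets of $\mathbb{R}^d$ use the metric $D(A_1,A_2)=\inf(\{r>0: A_1\cap B(0,1/r)\subset A_2^{+r},\ A_2\cap B(0,1/r)\subset A_1^{+r}\}\cup\{1\})$, where $A^{+r}=\{x:\mathrm{dist}(x,A)\le r\}$ and $B(x,R)$ is the open Euclidean ball. $\mathbb{X}^F_\sigma$ is the set of all tilings $\mathcal{T}$ of $\mathbb{R}^d$ such that every sub-patch of $\mathcal{T}$ is a limit, with respect to $D$, of translated sub-patches of elements of $\mathscr{P}_\sigma$. A sequence $(A_q)_{q\ge1}$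 of bounded measurable subsets of $\mathbb{R}^d$ (of positive volume) is van Hove if $\lim_{q\to\infty}\mathrm{vol}((\partial A_q)^{+r})/\mathrm{vol}(A_q)=0$ for all $r>0$.
   Formalization: Each substitution rule is assumed to tessellate its prototile by finitely many tiles; with infinite rules the claim fails, e.g. in dimension 1 if a rule contains, for every m, m consecutive equal intervals, since then a periodic tiling lies in the tiling space. *)

theory Defs
  imports "HOL-Analysis.Analysis"
begin

section \<open>Tiles, patches and tilings\<close>

definition is_tile :: "'a::euclidean_space set \<Rightarrow> bool" where
  "is_tile T \<longleftrightarrow> bounded T \<and> T \<in> sets lebesgue \<and> measure lebesgue T > 0
     \<and> frontier T \<in> null_sets lebesgue"

text \<open>Tiles have non-empty interior, so a tessellation cannot use a tile twice and a plain set of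
  tiles represents it.\<close>

definition tessellation :: "'a::euclidean_space set set \<Rightarrow> 'a set \<Rightarrow> bool" where
  "tessellation P U \<longleftrightarrow> (\<forall>T\<in>P. is_tile T)
     \<and> pairwise (\<lambda>S T. interior S \<inter> interior T = {}) P \<and> \<Union>P = U"

definition is_patch :: "'a::euclidean_space set set \<Rightarrow> bool" where
  "is_patch P \<longleftrightarrow> P \<noteq> {} \<and> tessellation P (\<Union>P) \<and> bounded (\<Union>P)"

definition is_tiling :: "'a::euclidean_space set set \<Rightarrow> bool" where
  "is_tiling P \<longleftrightarrow> tessellation P UNIV"

definition subpatch :: "'a::euclidean_space set set \<Rightarrow> 'a set set \<Rightarrow> bool" where
  "subpatch Q P \<longleftrightarrow> is_patch Q \<and> Q \<subseteq> P"

definition translate :: "'a::euclidean_space \<Rightarrow> 'a set \<Rightarrow> 'a set" where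
  "translate v S = (+) v ` S"

definition rescale :: "real \<Rightarrow> 'a::euclidean_space set \<Rightarrow> 'a set" where
  "rescale \<alpha> S = (*\<^sub>R) \<alpha> ` S"

section \<open>Multiscale substitution schemes\<close>

record 'a scheme =
  prototiles :: "'a set list"
  subst_rule :: "'a set \<Rightarrow> 'a set set"

definition num_types :: "'a scheme \<Rightarrow> nat" where
  "num_types \<sigma> = length (prototiles \<sigma>)"

definition proto :: "'a scheme \<Rightarrow> nat \<Rightarrow> 'a set" where
  "proto \<sigma> i = prototiles \<sigma> ! i"

definition tile_of :: "'a::euclidean_space scheme \<Rightarrow> nat \<Rightarrow> real \<Rightarrow> 'a set \<Rightarrow> bool" where
  "tile_of \<sigma> j \<alpha> X \<longleftrightarrow> \<alpha> > 0 \<and> (\<exists>v. X = translate v (rescale \<alpha> (proto \<sigma> j)))"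

definition has_type :: "'a::euclidean_space scheme \<Rightarrow> nat \<Rightarrow> 'a set \<Rightarrow> bool" where
  "has_type \<sigma> j X \<longleftrightarrow> (\<exists>\<alpha>. tile_of \<sigma> j \<alpha> X)"

text \<open>Each prototile is substituted by finitely many tiles; this is what makes the union of the
  boundaries of a generated patch a closed set.\<close>

definition substitution_scheme :: "'a::euclidean_space scheme \<Rightarrow> bool" where
  "substitution_scheme \<sigma> \<longleftrightarrow>
     (\<forall>i<num_types \<sigma>. is_tile (proto \<sigma> i)
        \<and> finite (subst_rule \<sigma> (proto \<sigma> i))
        \<and> tessellation (subst_rule \<sigma> (proto \<sigma> i)) (proto \<sigma> i)
        \<and> (\<forall>X\<in>subst_rule \<sigma> (proto \<sigma> i). \<exists>j<num_types \<sigma>. \<exists>\<alpha>\<in>{0<..<1}. tile_of \<sigma> j \<alpha> X))"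

definition normalized :: "'a::euclidean_space scheme \<Rightarrow> bool" where
  "normalized \<sigma> \<longleftrightarrow> (\<forall>i<num_types \<sigma>. measure lebesgue (proto \<sigma> i) = 1)"

definition geometrically_distinct :: "'a::euclidean_space scheme \<Rightarrow> bool" where
  "geometrically_distinct \<sigma> \<longleftrightarrow>
     (\<forall>i<num_types \<sigma>. \<forall>j<num_types \<sigma>. i \<noteq> j \<longrightarrow> \<not> has_type \<sigma> j (proto \<sigma> i))"

definition origin_positioned :: "'a::euclidean_space scheme \<Rightarrow> bool" where
  "origin_positioned \<sigma> \<longleftrightarrow> (\<forall>i<num_types \<sigma>. 0 \<in> interior (proto \<sigma> i))"

section \<open>The substitution semi-flow\<close>

text \<open>A tile \<open>X = v + \<alpha> T\<^sub>j\<close> is replaced by \<open>v + \<alpha> \<rho>(T\<^sub>j)\<close>.  Under \<^const>\<open>geometrically_distinct\<close>,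
  \<open>X\<close> determines \<open>j\<close>, \<open>\<alpha>\<close> and \<open>v\<close>, so the relational form below picks out a single
  substitution.\<close>

definition subst_tile :: "'a::euclidean_space scheme \<Rightarrow> 'a set \<Rightarrow> 'a set set" where
  "subst_tile \<sigma> X = {translate v (rescale \<alpha> Y) | j \<alpha> v Y.
     j < num_types \<sigma> \<and> \<alpha> > 0 \<and> X = translate v (rescale \<alpha> (proto \<sigma> j))
     \<and> Y \<in> subst_rule \<sigma> (proto \<sigma> j)}"

definition subst_step :: "'a::euclidean_space scheme \<Rightarrow> 'a set set \<Rightarrow> 'a set set" where
  "subst_step \<sigma> P = {X \<in> P. measure lebesgue X \<le> 1}
     \<union> (\<Union>X\<in>{X \<in> P. measure lebesgue X > 1}. subst_tile \<sigma> X)"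

definition flow_iter :: "'a::euclidean_space scheme \<Rightarrow> real \<Rightarrow> nat \<Rightarrow> nat \<Rightarrow> 'a set set" where
  "flow_iter \<sigma> t i k = (subst_step \<sigma> ^^ k) {rescale (exp t) (proto \<sigma> i)}"

definition flow :: "'a::euclidean_space scheme \<Rightarrow> real \<Rightarrow> nat \<Rightarrow> 'a set set" where
  "flow \<sigma> t i = flow_iter \<sigma> t i
     (LEAST k. \<forall>X\<in>flow_iter \<sigma> t i k. measure lebesgue X \<le> 1)"

definition irreducible_scheme :: "'a::euclidean_space scheme \<Rightarrow> bool" where
  "irreducible_scheme \<sigma> \<longleftrightarrow>
     (\<forall>i<num_types \<sigma>. \<forall>j<num_types \<sigma>. \<exists>t>0. \<exists>X\<in>flow \<sigma> t i. has_type \<sigma> j X)"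

definition incommensurable :: "'a::euclidean_space scheme \<Rightarrow> bool" where
  "incommensurable \<sigma> \<longleftrightarrow>
     (\<exists>i<num_types \<sigma>. \<exists>j<num_types \<sigma>. \<exists>t\<^sub>1>0. \<exists>t\<^sub>2>0.
        \<not> (\<exists>r\<in>\<rat>. t\<^sub>1 = r * t\<^sub>2)
        \<and> (\<exists>X\<in>flow \<sigma> t\<^sub>1 i. has_type \<sigma> i X \<and> measure lebesgue X = 1)
        \<and> (\<exists>X\<in>flow \<sigma> t\<^sub>2 j. has_type \<sigma> j X \<and> measure lebesgue X = 1))"

section \<open>The tiling space\<close>

text \<open>The guard gives the empty set the convention \<open>dist(x, \<emptyset>) = \<infinity>\<close>; the library has
  \<open>infdist x {} = 0\<close>.\<close>

definition thicken :: "real \<Rightarrow> 'a::euclidean_space set \<Rightarrow> 'a set" where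
  "thicken r A = {x. A \<noteq> {} \<and> infdist x A \<le> r}"

definition set_metric :: "'a::euclidean_space set \<Rightarrow> 'a set \<Rightarrow> real" where
  "set_metric A\<^sub>1 A\<^sub>2 = Inf ({r. r > 0 \<and> A\<^sub>1 \<inter> ball 0 (1 / r) \<subseteq> thicken r A\<^sub>2
                               \<and> A\<^sub>2 \<inter> ball 0 (1 / r) \<subseteq> thicken r A\<^sub>1} \<union> {1})"

definition boundary_set :: "'a::euclidean_space set set \<Rightarrow> 'a set" where
  "boundary_set P = (\<Union>T\<in>P. frontier T)"

definition generating_patches :: "'a::euclidean_space scheme \<Rightarrow> 'a set set set" where
  "generating_patches \<sigma> = {flow \<sigma> t i | t i. t \<ge> 0 \<and> i < num_types \<sigma>}"

definition limit_of_generated :: "'a::euclidean_space scheme \<Rightarrow> 'a set set \<Rightarrow> bool" where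
  "limit_of_generated \<sigma> Q \<longleftrightarrow>
     (\<exists>S g. (\<forall>k::nat. \<exists>P\<in>generating_patches \<sigma>. subpatch (S k) P)
        \<and> (\<lambda>k. set_metric (boundary_set (translate (g k) ` S k)) (boundary_set Q)) \<longlonglongrightarrow> 0)"

definition tiling_space :: "'a::euclidean_space scheme \<Rightarrow> 'a set set set" where
  "tiling_space \<sigma> = {\<T>. is_tiling \<T> \<and> (\<forall>Q. subpatch Q \<T> \<longrightarrow> limit_of_generated \<sigma> Q)}"

section \<open>Van Hove sequences and patch counts\<close>

text \<open>Sequences are indexed by \<open>q \<ge> 1\<close>; the value at \<open>0\<close> is irrelevant.\<close>

definition van_hove :: "(nat \<Rightarrow> 'a::euclidean_space set) \<Rightarrow> bool" where
  "van_hove A \<longleftrightarrow>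
     (\<forall>q\<ge>1. bounded (A q) \<and> A q \<in> sets lebesgue \<and> measure lebesgue (A q) > 0)
     \<and> (\<forall>r>0. (\<lambda>q. measure lebesgue (thicken r (frontier (A q))) / measure lebesgue (A q))
                 \<longlonglongrightarrow> 0)"

definition occurrences ::
    "'a::euclidean_space set set \<Rightarrow> 'a set set \<Rightarrow> 'a set \<Rightarrow> 'a set" where
  "occurrences P \<T> A = {g. translate g ` P \<subseteq> \<T> \<and> translate g (\<Union>P) \<subseteq> A}"

definition patch_count :: "'a::euclidean_space set set \<Rightarrow> 'a set set \<Rightarrow> 'a set \<Rightarrow> nat" where
  "patch_count P \<T> A = card (occurrences P \<T> A)"

lemma translate_eq_self:
  fixes S :: "'a::euclidean_space set"
  assumes "bounded S" "S \<noteq> {}" "translate v S = S"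
  shows "v = 0"
proof (rule ccontr)
  assume v: "v \<noteq> 0"
  obtain x where x: "x \<in> S" using assms(2) by blast
  have mem: "x + real n *\<^sub>R v \<in> S" for n
  proof (induction n)
    case (Suc n)
    then have "v + (x + real n *\<^sub>R v) \<in> translate v S" by (simp add: translate_def)
    then show ?case using assms(3) by (simp add: algebra_simps)
  qed (simp add: x)
  obtain B where B: "\<And>y. y \<in> S \<Longrightarrow> norm y \<le> B" using assms(1) bounded_iff by blast
  obtain n :: nat where n: "2 * B < real n * norm v"
    using v reals_Archimedean3[of "norm v"] by auto
  have "norm (real n *\<^sub>R v) \<le> norm (x + real n *\<^sub>R v) + norm x"
    by (metis add_diff_cancel_left' norm_triangle_ineq4)
  with B[OF mem[of n]] B[OF x] n show False by simp
qed

text \<open>The cardinality in \<^const>\<open>patch_count\<close> is that of a finite set.\<close>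

lemma finite_occurrences:
  fixes P \<T> :: "'a::euclidean_space set set"
  assumes "is_tiling \<T>" "subpatch P \<T>" "bounded A"
  shows "finite (occurrences P \<T> A)"
proof -
  let ?G = "occurrences P \<T> A"
  obtain X where XP: "X \<in> P" using assms(2) by (auto simp: subpatch_def is_patch_def)
  then have X: "is_tile X" using assms(2) by (auto simp: subpatch_def is_patch_def tessellation_def)
  let ?I = "interior X"
  have bX: "bounded X" and X0: "X \<noteq> {}" using X by (auto simp: is_tile_def)
  have lmI: "?I \<in> lmeasurable" by (simp add: bX bounded_interior lmeasurable_interior)
  have pos: "measure lebesgue ?I > 0"
  proof (rule ccontr)
    assume "\<not> measure lebesgue ?I > 0"
    then have "negligible ?I" using lmI
      by (metis measure_nonneg negligible_iff_measure order_less_le)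
    moreover have "negligible (frontier X)"
      using X by (simp add: is_tile_def negligible_iff_null_sets)
    ultimately have "negligible (?I \<union> frontier X)" by (rule negligible_Un)
    moreover have "X \<subseteq> ?I \<union> frontier X" using closure_subset by (auto simp: frontier_def)
    ultimately have "negligible X" by (rule negligible_subset)
    then show False using X by (simp add: is_tile_def negligible_iff_measure)
  qed
  obtain c where c: "A \<subseteq> cbox (- c) c" using assms(3) bounded_subset_cbox_symmetric by blast
  let ?M = "measure lebesgue (cbox (-c) c)"
  have bound: "card F \<le> nat \<lceil>?M / measure lebesgue ?I\<rceil>" if F: "F \<subseteq> ?G" "finite F" for F
  proof -
    have disj: "disjoint_family_on (\<lambda>g. (+) g ` ?I) F"
    proof (unfold disjoint_family_on_def, intro ballI impI)
      fix g h assume gh: "g \<in> F" "h \<in> F" "g \<noteq> h"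
      have "translate g X \<noteq> translate h X"
      proof
        assume "translate g X = translate h X"
        then have "translate (- h) (translate g X) = translate (- h) (translate h X)" by simp
        then have "translate (g - h) X = X" by (simp add: translate_def image_image add_diff_eq diff_add_eq)
        then have "g - h = 0" by (rule translate_eq_self[OF bX X0])
        then show False using gh by simp
      qed
      moreover have "translate g X \<in> \<T>" "translate h X \<in> \<T>"
        using gh F XP by (auto simp: occurrences_def)
      ultimately have "interior (translate g X) \<inter> interior (translate h X) = {}"
        using assms(1) by (auto simp: is_tiling_def tessellation_def pairwise_def)
      then show "(+) g ` ?I \<inter> (+) h ` ?I = {}"
        by (simp add: translate_def interior_translation)
    qed
    have lm: "(+) g ` ?I \<in> lmeasurable" for g using lmI measurable_translation by blast
    have sub: "(\<Union>g\<in>F. (+) g ` ?I) \<subseteq> cbox (- c) c"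
    proof -
      have "(+) g ` ?I \<subseteq> A" if "g \<in> F" for g
        using that F XP interior_subset[of X] by (fastforce simp: occurrences_def translate_def)
      then show ?thesis using c by blast
    qed
    have "real (card F) * measure lebesgue ?I = (\<Sum>g\<in>F. measure lebesgue ((+) g ` ?I))"
      by (simp add: measure_translation)
    also have "\<dots> = measure lebesgue (\<Union>g\<in>F. (+) g ` ?I)"
      using F(2) lm disj
      by (subst measure_finite_Union) (auto simp: fmeasurable_def less_top simp del: emeasure_completion)
    also have "\<dots> \<le> ?M"
      using lm sub F(2) by (intro measure_mono_fmeasurable) (auto intro: fmeasurableD)
    finally have "real (card F) \<le> ?M / measure lebesgue ?I" using pos by (simp add: field_simps)
    then show ?thesis by linarith
  qed
  show ?thesis
  proof (rule ccontr)
    assume "infinite ?G"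
    then obtain F where "F \<subseteq> ?G" "finite F" "card F = Suc (nat \<lceil>?M / measure lebesgue ?I\<rceil>)"
      by (meson infinite_arbitrarily_large)
    with bound[of F] show False by simp
  qed
qed

end

theory Submission
  imports Defs
begin

text \<open>
  A patch occurs at most as often as any one of its tiles \<open>X\<close>, and all translates of \<open>X\<close> have the same
  volume. So the reason for frequency \<open>0\<close> is that tiles of any single volume are rare, which comes
  from incommensurability. The proof has two parts: a renewal argument for generated
  patches, and a transfer to the tiling, which is related to generated patches only through limits of
  boundary sets.

  Renewal. Prototiles have volume \<open>1\<close>, so the volumes of the tiles in \<open>\<rho>(T\<^sub>i)\<close> sum to \<open>1\<close>. Descend in the
  substitution tree by choosing a subtile with probability equal to its relative volume, and regard this as a
  step whose length is minus the logarithm of that volume. The share of the volume of a large tile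
  that ends up in tiles of volume close to \<open>\<mu>\<close> is then the probability that the total length hits a short
  interval. It tends to \<open>0\<close> as the interval moves to infinity and shrinks
  (\<open>hitting_bound_vanishes\<close>): a limit superior \<open>L > 0\<close> would propagate backwards along both loops of
  irrational length ratio, to quadratically many disjoint intervals in a window of linear length, while the
  expected number of visits to a window is linear in its length. Cutting a generated patch into
  pieces of bounded but large size makes the estimate local (\<open>generated_patch_count\<close>).

  Transfer. Select translates \<open>g + X\<close> in the tiling that are far from each other; this loses only a constant
  factor. They form a sub-patch, so the union of their boundaries is a limit of boundary sets of
  patches \<open>S k\<close> of tiles from generated patches. Near each \<open>g\<close> the patch \<open>S k\<close> must have a tile, and a limit of these
  tiles is a copy \<open>Z\<close> of a prototile with \<open>frontier Z \<subseteq> g + frontier X\<close>. Prototiles are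
  contained in the closure of their interior, so boundaries in \<open>S k\<close> do not cut through its
  tiles, and the interior of \<open>Z\<close> avoids \<open>g + frontier X\<close> (\<open>limit_tile\<close>). Thus the
  interior of \<open>Z\<close> consists of components of the complement of \<open>g + frontier X\<close>, which leaves only finitely
  many possible volumes for \<open>Z\<close>, the same ones for all \<open>g\<close> (\<open>finite_filling_vols\<close>). So
  every selected \<open>g\<close> produces a tile of a generated patch whose volume is close to one of finitely many
  values, and there are few of those. Finally, a van Hove sequence makes the neighbourhood
  of \<open>A q + h\<close> that enters the count comparable to \<open>A q\<close>, uniformly in \<open>h\<close>.
\<close>

section \<open>Hitting probabilities in a renewal process\<close>

text \<open>A Markov chain on \<open>{0..<n}\<close> that leaves the state \<open>i\<close> along an edge \<open>e \<in> E i\<close> with probability \<open>p e\<close>.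
The edge has length \<open>- ln (p e)\<close>, so the length of a walk is minus the logarithm of its
probability, and lengths of walks are tracked through their weights.\<close>

locale renewal_graph =
  fixes n :: nat and E :: "nat \<Rightarrow> 'e set" and p :: "'e \<Rightarrow> real" and tgt :: "'e \<Rightarrow> nat"
  assumes n_pos: "0 < n"
    and finite_edges: "i < n \<Longrightarrow> finite (E i)"
    and p_pos: "i < n \<Longrightarrow> e \<in> E i \<Longrightarrow> 0 < p e"
    and p_less_1: "i < n \<Longrightarrow> e \<in> E i \<Longrightarrow> p e < 1"
    and tgt_less: "i < n \<Longrightarrow> e \<in> E i \<Longrightarrow> tgt e < n"
    and p_sum: "i < n \<Longrightarrow> (\<Sum>e\<in>E i. p e) = 1"
begin

inductive walk :: "nat \<Rightarrow> nat \<Rightarrow> real \<Rightarrow> bool" where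
  walk_refl: "walk i i 1"
| walk_step: "walk i j r \<Longrightarrow> e \<in> E j \<Longrightarrow> walk i (tgt e) (r * p e)"

lemma walk_trans:
  assumes "walk j k r'" "walk i j r"
  shows "walk i k (r * r')"
  using assms
proof (induction rule: walk.induct)
  case (walk_step j k r' e)
  then have "walk i (tgt e) ((r * r') * p e)" by (intro walk.walk_step) auto
  then show ?case by (simp add: mult.assoc)
qed simp

lemma walk_power: "walk i i r \<Longrightarrow> walk i i (r ^ k)"
proof (induction k)
  case (Suc k)
  then show ?case using walk_trans[of i i "r ^ k" i r] by simp
qed (simp add: walk_refl)

lemma walk_weight:
  assumes "walk i j r" "i < n"
  shows "0 < r \<and> r \<le> 1 \<and> j < n"
  using assms
proof (induction rule: walk.induct)
  case (walk_step i j r e)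
  then show ?case using p_pos[of j e] p_less_1[of j e] tgt_less[of j e]
    by (auto intro: mult_le_one)
qed simp

lemma edge_lengths_bounded:
  obtains l D where "0 < l" "\<And>i e. i < n \<Longrightarrow> e \<in> E i \<Longrightarrow> l \<le> - ln (p e)"
    "\<And>i e. i < n \<Longrightarrow> e \<in> E i \<Longrightarrow> - ln (p e) \<le> D"
proof -
  let ?A = "(\<lambda>e. - ln (p e)) ` (\<Union>i<n. E i)"
  have fin: "finite ?A" using finite_edges by auto
  have ne: "?A \<noteq> {}" using n_pos p_sum[of 0] by fastforce
  have mem: "- ln (p e) \<in> ?A" if "i < n" "e \<in> E i" for i e using that by auto
  have pos: "0 < x" if "x \<in> ?A" for x
    using that p_pos p_less_1 by (auto simp: ln_less_zero_iff)
  show ?thesis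
  proof (rule that[of "Min ?A" "Max ?A"])
    show "0 < Min ?A" using pos Min_in[OF fin ne] by blast
    show "Min ?A \<le> - ln (p e)" "- ln (p e) \<le> Max ?A" if "i < n" "e \<in> E i" for i e
      using Min_le[OF fin mem[OF that]] Max_ge[OF fin mem[OF that]] by auto
  qed
qed

text \<open>The model for \<open>v i s\<close> is the probability that the walk started at \<open>i\<close> reaches a total length in
\<open>[s - \<epsilon>, s + \<epsilon>]\<close>; conditioning on the first edge gives the inequality for \<open>s > \<epsilon>\<close>.
Sub-solutions of that equation are all that the argument needs, and they spare the construction of
the process.\<close>

definition hitting_bound :: "real \<Rightarrow> (nat \<Rightarrow> real \<Rightarrow> real) \<Rightarrow> bool" where
  "hitting_bound \<epsilon> v \<longleftrightarrow> (\<forall>i<n. \<forall>s. 0 \<le> v i s \<and> v i s \<le> 1 \<and> (s < - \<epsilon> \<longrightarrow> v i s = 0)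
     \<and> (\<epsilon> < s \<longrightarrow> v i s \<le> (\<Sum>e\<in>E i. p e * v (tgt e) (s + ln (p e)))))"

lemma hitting_bound_mono:
  assumes "hitting_bound \<epsilon> v" "\<epsilon> \<le> \<epsilon>'"
  shows "hitting_bound \<epsilon>' v"
  using assms by (auto simp: hitting_bound_def)

text \<open>The walk advances by at least \<open>l\<close> in each step, so it visits at most \<open>1 + (W + 2 * \<epsilon>) / l\<close> of
the disjoint intervals around the points \<open>s - c\<close>, which lie in a window of length \<open>W + 2 * \<epsilon>\<close>.
For sub-solutions this is an induction on \<open>s\<close> with the explicit bound \<open>B s\<close>, in which
each step lowers the level by at least \<open>l\<close> and meets at most one interval around \<open>0\<close>.\<close>

lemma hitting_bound_window_sum:
  assumes v: "hitting_bound \<epsilon> v" and eps: "0 \<le> \<epsilon>" and W: "0 \<le> W"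
    and l: "0 < l" "\<And>i e. i < n \<Longrightarrow> e \<in> E i \<Longrightarrow> l \<le> - ln (p e)"
    and F: "finite F" "F \<subseteq> {0..W}" "\<And>c c'. c \<in> F \<Longrightarrow> c' \<in> F \<Longrightarrow> c \<noteq> c' \<Longrightarrow> 2 * \<epsilon> < \<bar>c - c'\<bar>"
    and "i < n"
  shows "(\<Sum>c\<in>F. v i (s - c)) \<le> 1 + (W + 2 * \<epsilon>) / l"
proof -
  define B where "B s = (if s < - \<epsilon> then 0 else 1 + min (s + \<epsilon>) (W + 2 * \<epsilon>) / l)" for s
  have Bmono: "B s \<le> B s'" if "s \<le> s'" for s s'
    using that l(1) eps W by (auto simp: B_def divide_right_mono)
  have zero: "v i (s - c) = 0" if "i < n" "c \<in> F" "s < - \<epsilon>" for i s c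
    using v that F(2) by (auto simp: hitting_bound_def)
  have key: "(\<Sum>c\<in>F. v i (s - c)) \<le> B s" if "s < real m * l - \<epsilon>" "i < n" for m i s
    using that
  proof (induction m arbitrary: i s)
    case 0
    then show ?case using zero by (simp add: B_def)
  next
    case (Suc m)
    \<comment> \<open>The levels that are hit already; there is at most one by separation.\<close>
    let ?H = "{c \<in> F. \<bar>s - c\<bar> \<le> \<epsilon>}"
    have "finite ?H" using F(1) by simp
    moreover have "a = b" if "a \<in> ?H" "b \<in> ?H" for a b
      using that F(3)[of a b] by (smt (verit) mem_Collect_eq)
    ultimately have H1: "card ?H \<le> 1"
      by (subst One_nat_def, subst card_le_Suc0_iff_eq) blast+
    have H0: "card ?H = 0" if "s > W + \<epsilon> \<or> s < - \<epsilon>"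
    proof -
      have "c \<notin> ?H" for c using that F(2) by (auto simp: abs_le_iff)
      then have "?H = {}" by blast
      then show ?thesis by (simp only: card.empty)
    qed
    have "v i (s - c) \<le> of_bool (c \<in> ?H) + (\<Sum>e\<in>E i. p e * v (tgt e) (s + ln (p e) - c))"
      if "c \<in> F" for c
    proof -
      have nn: "0 \<le> (\<Sum>e\<in>E i. p e * v (tgt e) (s + ln (p e) - c))"
        using v Suc.prems(2) p_pos tgt_less
        by (intro sum_nonneg mult_nonneg_nonneg) (auto simp: hitting_bound_def less_imp_le)
      have "v i (s - c) \<le> 1" "s - c < - \<epsilon> \<Longrightarrow> v i (s - c) = 0"
         "\<epsilon> < s - c \<Longrightarrow> v i (s - c) \<le> (\<Sum>e\<in>E i. p e * v (tgt e) (s - c + ln (p e)))"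
        using v Suc.prems(2) unfolding hitting_bound_def by blast+
      then show ?thesis using nn that by (cases "\<bar>s - c\<bar> \<le> \<epsilon>") (auto simp: algebra_simps abs_le_iff)
    qed
    then have "(\<Sum>c\<in>F. v i (s - c)) \<le>
        (\<Sum>c\<in>F. of_bool (c \<in> ?H) + (\<Sum>e\<in>E i. p e * v (tgt e) (s + ln (p e) - c)))"
      by (intro sum_mono)
    also have "\<dots> = real (card ?H) + (\<Sum>e\<in>E i. p e * (\<Sum>c\<in>F. v (tgt e) (s + ln (p e) - c)))"
    proof -
      have "(\<Sum>c\<in>F. of_bool (c \<in> ?H)) = real (card ?H)"
        using F(1) by (simp add: of_bool_def sum.If_cases Int_def)
      moreover have "(\<Sum>c\<in>F. \<Sum>e\<in>E i. p e * v (tgt e) (s + ln (p e) - c)) =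
          (\<Sum>e\<in>E i. p e * (\<Sum>c\<in>F. v (tgt e) (s + ln (p e) - c)))"
        by (subst sum.swap) (simp add: sum_distrib_left)
      ultimately show ?thesis by (simp add: sum.distrib)
    qed
    also have "\<dots> \<le> real (card ?H) + (\<Sum>e\<in>E i. p e * B (s - l))"
    proof -
      have "(\<Sum>c\<in>F. v (tgt e) (s + ln (p e) - c)) \<le> B (s - l)" if e: "e \<in> E i" for e
      proof -
        have "ln (p e) \<le> - l" using l(2)[OF Suc.prems(2) e] by simp
        moreover have "s + ln (p e) < real m * l - \<epsilon>"
          using calculation Suc.prems(1) by (simp add: algebra_simps)
        ultimately show ?thesis
          using Suc.IH[of "s + ln (p e)" "tgt e"] tgt_less[OF Suc.prems(2) e] Bmono[of "s + ln (p e)" "s - l"]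
          by linarith
      qed
      then show ?thesis using p_pos[OF Suc.prems(2)]
        by (intro add_left_mono sum_mono mult_left_mono) (auto simp: less_imp_le)
    qed
    also have "\<dots> = real (card ?H) + B (s - l)"
      using p_sum[OF Suc.prems(2)] by (simp flip: sum_distrib_right)
    also have "\<dots> \<le> B s"
    proof (cases "s > W + \<epsilon> \<or> s < - \<epsilon>")
      case True
      then show ?thesis using H0 Bmono[of "s - l" s] l(1) by simp
    next
      case False
      have "(s - l + \<epsilon>) / l = (s + \<epsilon>) / l - 1" using l(1) by (simp add: field_simps)
      moreover have "0 \<le> (s + \<epsilon>) / l" using False l(1) by simp
      moreover have "min (s - l + \<epsilon>) (W + 2 * \<epsilon>) = s - l + \<epsilon>" "min (s + \<epsilon>) (W + 2 * \<epsilon>) = s + \<epsilon>"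
        using False l(1) eps by linarith+
      ultimately show ?thesis using H1 False unfolding B_def by simp
    qed
    finally show ?case .
  qed
  obtain m :: nat where "(s + \<epsilon>) / l < real m" using reals_Archimedean2 by blast
  then have "s < real m * l - \<epsilon>" using l(1) by (simp add: field_simps)
  then have "(\<Sum>c\<in>F. v i (s - c)) \<le> B s" using key assms(9) by blast
  also have "B s \<le> 1 + (W + 2 * \<epsilon>) / l"
    using l(1) eps W by (auto simp: B_def divide_right_mono)
  finally show ?thesis .
qed

text \<open>Iterating the inequality along one walk and estimating all its side branches by the supremum \<open>M\<close>.
Consequently, if \<open>v i s\<close> is almost \<open>M\<close>, then so is \<open>v j\<close> at the end of the walk. The margin
\<open>D\<close> keeps the side branches of the last step above the level \<open>S\<close>.\<close>

lemma hitting_bound_along_walk: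
  assumes v: "hitting_bound \<epsilon> v" and w: "walk i j r" and i: "i < n"
    and D: "\<And>i e. i < n \<Longrightarrow> e \<in> E i \<Longrightarrow> - ln (p e) \<le> D" "0 \<le> D"
    and S: "\<epsilon> < S" and M: "\<And>k s. k < n \<Longrightarrow> S \<le> s \<Longrightarrow> v k s \<le> M"
    and s: "S + D \<le> s + ln r"
  shows "v i s \<le> r * v j (s + ln r) + (1 - r) * M"
  using w i s
proof (induction rule: walk.induct)
  case (walk_step i j r e)
  have j: "0 < r" "r \<le> 1" "j < n" using walk_weight[OF walk_step.hyps(1) walk_step.prems(1)] by auto
  have pe: "0 < p e" "p e < 1" using p_pos p_less_1 j walk_step by auto
  have ln: "ln (r * p e) = ln r + ln (p e)" using j pe by (simp add: ln_mult)
  have le: "S + D \<le> s + ln r" using walk_step.prems(2) ln pe by (simp add: ln_le_zero_iff)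
     (smt (verit) ln_less_zero)
  have "v j (s + ln r) \<le> (\<Sum>e\<in>E j. p e * v (tgt e) (s + ln r + ln (p e)))"
    using v j(3) le S D(2) unfolding hitting_bound_def by auto
  also have "\<dots> = p e * v (tgt e) (s + ln r + ln (p e))
      + (\<Sum>e'\<in>E j - {e}. p e' * v (tgt e') (s + ln r + ln (p e')))"
    using finite_edges[OF j(3)] walk_step.hyps(2) by (subst sum.remove[of _ e]) auto
  also have "\<dots> \<le> p e * v (tgt e) (s + ln r + ln (p e)) + (\<Sum>e'\<in>E j - {e}. p e' * M)"
  proof (intro add_left_mono sum_mono mult_left_mono)
    fix e' assume e': "e' \<in> E j - {e}"
    show "v (tgt e') (s + ln r + ln (p e')) \<le> M"
      using M[of "tgt e'" "s + ln r + ln (p e')"] D(1)[OF j(3), of e'] tgt_less[OF j(3), of e'] e' le by auto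
    show "0 \<le> p e'" using p_pos[OF j(3), of e'] e' by simp
  qed
  also have "(\<Sum>e'\<in>E j - {e}. p e' * M) = (1 - p e) * M"
    using finite_edges[OF j(3)] walk_step.hyps(2) p_sum[OF j(3)]
    by (simp add: sum_diff1 flip: sum_distrib_right)
  finally have "r * v j (s + ln r) \<le> r * (p e * v (tgt e) (s + ln r + ln (p e)) + (1 - p e) * M)"
    using j by (intro mult_left_mono) auto
  with walk_step.IH[OF walk_step.prems(1) le] show ?case
    by (simp add: ln algebra_simps)
qed simp

text \<open>Let \<open>L\<close> be the limit of the suprema of all hitting bounds as \<open>\<epsilon> \<rightarrow> 0\<close> and
\<open>s \<rightarrow> \<infinity>\<close>, and suppose \<open>L > 0\<close>. A nearly maximal value \<open>v i s\<close> propagates along the walks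
that go to \<open>i0\<close>, run through its loop \<open>k\<close> times, go to \<open>j0\<close> and run through its loop \<open>m\<close>
times. The lengths \<open>k * t1 + m * t2\<close> are pairwise different because \<open>t1 / t2\<close> is irrational,
so \<open>k, m \<le> N\<close> gives \<open>(N + 1)\<^sup>2\<close> disjoint intervals, each hit with probability at least about
\<open>L\<close>, inside a window of length proportional to \<open>N\<close>. This contradicts the linear bound on the
number of visits. The statement is uniform in \<open>v\<close>, so that one \<open>\<epsilon>\<close> serves every target volume
later.\<close>

proposition hitting_bound_vanishes:
  assumes irr: "\<And>i j. i < n \<Longrightarrow> j < n \<Longrightarrow> \<exists>r. walk i j r"
    and loops: "i0 < n" "j0 < n" "walk i0 i0 \<rho>1" "walk j0 j0 \<rho>2" "\<rho>1 < 1" "\<rho>2 < 1"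
    and irrat: "ln \<rho>1 / ln \<rho>2 \<notin> \<rat>"
    and eta: "0 < \<eta>"
  shows "\<exists>\<epsilon>>0. \<exists>S. \<forall>v i s. hitting_bound \<epsilon> v \<longrightarrow> i < n \<longrightarrow> S \<le> s \<longrightarrow> v i s \<le> \<eta>"
proof (rule ccontr)
  assume neg: "\<not> ?thesis"
  define V where "V \<epsilon> S = {v i s | v i s. hitting_bound \<epsilon> v \<and> i < n \<and> S \<le> s}" for \<epsilon> S
  define M where "M \<epsilon> S = Sup (V \<epsilon> S)" for \<epsilon> S
  have V1: "x \<le> 1" if "x \<in> V \<epsilon> S" for x \<epsilon> S
    using that by (auto simp: V_def hitting_bound_def)
  have bdd: "bdd_above (V \<epsilon> S)" for \<epsilon> S using V1 by (meson bdd_above.I)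
  have Mgt: "\<eta> < M \<epsilon> S" and Vne: "V \<epsilon> S \<noteq> {}" if pos: "0 < \<epsilon>" for \<epsilon> S
  proof -
    obtain v i s where h: "hitting_bound \<epsilon> v" "i < n" "S \<le> s" "\<not> v i s \<le> \<eta>"
      using neg pos by blast
    then have "v i s \<in> V \<epsilon> S" by (auto simp: V_def)
    then show "\<eta> < M \<epsilon> S" "V \<epsilon> S \<noteq> {}" using h(4) cSup_upper[OF _ bdd, of "v i s"] unfolding M_def
      by force+
  qed
  define L where "L = (INF (\<epsilon>, S)\<in>{0<..} \<times> UNIV. M \<epsilon> S)"
  have bddM: "bdd_below ((\<lambda>(\<epsilon>, S). M \<epsilon> S) ` ({0<..} \<times> UNIV))"
    using Mgt by (intro bdd_belowI2[of _ \<eta>]) (auto intro: less_imp_le)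
  have LM: "L \<le> M \<epsilon> S" if "0 < \<epsilon>" for \<epsilon> S
    unfolding L_def using cINF_lower[OF bddM, of "(\<epsilon>, S)"] that by auto
  have Leta: "\<eta> \<le> L" unfolding L_def using Mgt by (intro cINF_greatest) (auto intro: less_imp_le)
  obtain l D where l: "0 < l" "\<And>i e. i < n \<Longrightarrow> e \<in> E i \<Longrightarrow> l \<le> - ln (p e)"
    and D: "\<And>i e. i < n \<Longrightarrow> e \<in> E i \<Longrightarrow> - ln (p e) \<le> D"
    using edge_lengths_bounded by blast
  have D0: "0 \<le> D"
  proof -
    obtain e where "e \<in> E 0" using p_sum[OF n_pos] by fastforce
    then show ?thesis using l D n_pos by (meson less_imp_le order_trans)
  qed
  define t1 t2 where "t1 = - ln \<rho>1" and "t2 = - ln \<rho>2"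
  have \<rho>: "0 < \<rho>1" "0 < \<rho>2" using walk_weight loops by auto
  have t: "0 < t1" "0 < t2" using \<rho> loops by (auto simp: t1_def t2_def)
  obtain N :: nat where N: "1 + (real N * (t1 + t2) + 2) / l < real (N + 1) ^ 2 * (\<eta> / 2)"
  proof -
    have "eventually (\<lambda>N::nat. 1 + (real N * (t1 + t2) + 2) / l < real (N + 1) ^ 2 * (\<eta> / 2)) sequentially"
    proof -
      obtain N0 :: nat where N0: "(1 + (t1 + t2) / l + 2 / l) / (\<eta> / 2) < real N0" using reals_Archimedean2 by blast
      have "1 + (real N * (t1 + t2) + 2) / l < real (N + 1) ^ 2 * (\<eta> / 2)" if "N \<ge> N0" for N
      proof -
        have "1 + (t1 + t2) / l + 2 / l < real N0 * (\<eta> / 2)" using N0 eta by (simp add: divide_less_eq)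
        also have "\<dots> \<le> real (N + 1) * (\<eta> / 2)" using that eta by (intro mult_right_mono) auto
        finally have "real (N + 1) * (1 + (t1 + t2) / l + 2 / l) < real (N + 1) * (real (N + 1) * (\<eta> / 2))"
          by (intro mult_strict_left_mono) auto
        moreover have "1 + (real N * (t1 + t2) + 2) / l \<le> real (N + 1) * (1 + (t1 + t2) / l + 2 / l)"
        proof -
          have "0 \<le> real N + (t1 + t2) / l + real N * (2 / l)" using t l(1) by auto
          moreover have "real (N + 1) * (1 + (t1 + t2) / l + 2 / l) =
             1 + (real N * (t1 + t2) + 2) / l + (real N + (t1 + t2) / l + real N * (2 / l))"
            by (simp add: algebra_simps add_divide_distrib)
          ultimately show ?thesis by linarith
        qed
        ultimately show ?thesis unfolding power2_eq_square mult.assoc by (rule order.strict_trans1[rotated])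
      qed
      then show ?thesis unfolding eventually_sequentially by blast
    qed
    then show ?thesis using that eventually_happens'[OF sequentially_bot] by blast
  qed
  define W where "W = real N * (t1 + t2)"
  define K where "K = {..N} \<times> {..N}"
  define f where "f = (\<lambda>(k, m). real k * t1 + real m * t2)"
  have inj: "inj_on f K"
  proof (rule inj_onI, clarify)
    fix k m k' m' assume "f (k, m) = f (k', m')"
    then have eq: "(real k - real k') * t1 = (real m' - real m) * t2" by (simp add: f_def algebra_simps)
    show "k = k' \<and> m = m'"
    proof (cases "k = k'")
      case False
      then have "t1 / t2 = (real m' - real m) / (real k - real k')"
        using eq t by (simp add: field_simps)
      moreover have "(real m' - real m) / (real k - real k') \<in> \<rat>" by (intro Rats_divide Rats_diff) auto
      moreover have "t1 / t2 = ln \<rho>1 / ln \<rho>2" by (simp add: t1_def t2_def)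
      ultimately show ?thesis using irrat by simp
    qed (use eq t in auto)
  qed
  define F where "F = f ` K"
  have F: "finite F" "F \<subseteq> {0..W}"
    using t by (auto simp: F_def K_def f_def W_def algebra_simps intro!: add_mono mult_right_mono)
  obtain \<epsilon>1 where e1: "0 < \<epsilon>1" "\<epsilon>1 \<le> 1" "\<And>c c'. c \<in> F \<Longrightarrow> c' \<in> F \<Longrightarrow> c \<noteq> c' \<Longrightarrow> 2 * \<epsilon>1 < \<bar>c - c'\<bar>"
  proof -
    let ?A = "insert 1 ((\<lambda>(c, c'). \<bar>c - c'\<bar> / 4) ` {(c, c') \<in> F \<times> F. c \<noteq> c'})"
    have "finite {(c, c') \<in> F \<times> F. c \<noteq> c'}"
      using F(1) by (intro finite_subset[OF _ finite_cartesian_product[OF F(1) F(1)]]) auto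
    then have fA: "finite ?A" by simp
    have pos: "0 < Min ?A" using fA by (subst Min_gr_iff) auto
    show ?thesis
    proof (rule that[of "Min ?A"])
      show "Min ?A \<le> 1" using fA by (intro Min_le) auto
      show "2 * Min ?A < \<bar>c - c'\<bar>" if "c \<in> F" "c' \<in> F" "c \<noteq> c'" for c c'
      proof -
        have "Min ?A \<le> \<bar>c - c'\<bar> / 4" using fA that by (intro Min_le) force+
        moreover have "0 < \<bar>c - c'\<bar>" using that by simp
        moreover have "2 * x < y" if "x \<le> y / 4" "0 < y" for x y :: real using that by simp
        ultimately show ?thesis by blast
      qed
    qed (rule pos)
  qed
  have "\<forall>i\<in>{..<n}. \<exists>r. walk i i0 r" using irr loops(1) by simp
  then obtain R where "\<forall>i\<in>{..<n}. walk i i0 (R i)" by (rule bchoice[THEN exE])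
  then have R: "walk i i0 (R i)" if "i < n" for i using that by simp
  obtain rb where rb: "walk i0 j0 rb" using irr loops by blast
  have rb': "0 < rb" "rb \<le> 1" using walk_weight rb loops by auto
  define rm where "rm = Min (R ` {..<n}) * \<rho>1 ^ N * rb * \<rho>2 ^ N"
  have minR: "0 < Min (R ` {..<n})" using n_pos walk_weight R by (subst Min_gr_iff) auto
  have rm: "0 < rm" using minR \<rho> rb' by (simp add: rm_def)
  \<comment> \<open>The loss along a walk of weight \<open>r\<close> is at most \<open>2 * \<delta> / r\<close>, here at most \<open>\<eta> / 2\<close>.\<close>
  define \<delta> where "\<delta> = \<eta> * rm / 4"
  have \<delta>: "0 < \<delta>" using eta rm by (simp add: \<delta>_def)
  obtain \<epsilon>2 S2 where e2: "0 < \<epsilon>2" "M \<epsilon>2 S2 < L + \<delta>"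
  proof -
    have "L < L + \<delta>" using \<delta> by simp
    then obtain x where "x \<in> {0<..} \<times> UNIV" "(\<lambda>(\<epsilon>, S). M \<epsilon> S) x < L + \<delta>"
      unfolding L_def by (subst (asm) cINF_less_iff) (use bddM in auto)
    then show ?thesis using that by auto
  qed
  define \<epsilon> where "\<epsilon> = min \<epsilon>1 \<epsilon>2"
  have eps: "0 < \<epsilon>" "\<epsilon> \<le> 1" using e1 e2 by (auto simp: \<epsilon>_def)
  define S where "S = max S2 2"
  have "L - \<delta> < M \<epsilon> (S + D - ln rm)" using LM[OF eps(1)] \<delta> by (smt (verit))
  then obtain v i s where v: "hitting_bound \<epsilon> v" "i < n" "S + D - ln rm \<le> s" "L - \<delta> < v i s"
    unfolding M_def by (subst (asm) less_cSup_iff) (use Vne[OF eps(1)] bdd in \<open>auto simp: V_def\<close>)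
  have up: "v k s' \<le> L + \<delta>" if "k < n" "S \<le> s'" for k s'
  proof -
    have "v k s' \<in> V \<epsilon>2 S2" using that v(1) hitting_bound_mono[of \<epsilon> v \<epsilon>2]
      by (auto simp: V_def \<epsilon>_def S_def)
    then have "v k s' \<le> M \<epsilon>2 S2" unfolding M_def by (intro cSup_upper bdd)
    then show ?thesis using e2 by linarith
  qed
  define a where "a = s + ln (R i) + ln rb"
  have low: "\<eta> / 2 \<le> v j0 (a - f km)" if km: "km \<in> K" for km
  proof -
    obtain k m where km': "km = (k, m)" "k \<le> N" "m \<le> N" using km by (auto simp: K_def)
    define r where "r = R i * \<rho>1 ^ k * rb * \<rho>2 ^ m"
    have w: "walk i j0 r" unfolding r_def
      using walk_trans[OF walk_power[OF loops(4)] walk_trans[OF rb walk_trans[OF walk_power[OF loops(3)] R[OF v(2)]]]] .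
    have Ri: "0 < R i" "Min (R ` {..<n}) \<le> R i" using walk_weight R v(2) by auto
    have pk: "\<rho>1 ^ N \<le> \<rho>1 ^ k" "\<rho>2 ^ N \<le> \<rho>2 ^ m"
      using \<rho> loops km' by (auto intro!: power_decreasing)
    have r: "rm \<le> r" "0 < r" "r \<le> 1"
      using walk_weight[OF w v(2)] Ri pk rb' \<rho> minR unfolding r_def rm_def
      by (auto intro!: mult_mono)
    have lnr: "ln r = ln (R i) + ln rb - f km"
      using Ri rb' \<rho> by (simp add: r_def ln_mult ln_realpow km' f_def t1_def t2_def)
    have "S + D \<le> s + ln r" using v(3) r rm ln_mono[of rm r] by linarith
    from hitting_bound_along_walk[OF v(1) w v(2) D D0 _ up this]
    have "v i s \<le> r * v j0 (s + ln r) + (1 - r) * (L + \<delta>)" using eps by (simp add: S_def)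
    then have "r * (L - v j0 (s + ln r)) < (2 - r) * \<delta>" using v(4) by (simp add: algebra_simps)
    also have "\<dots> \<le> 2 * \<delta>" using r \<delta> by simp
    also have "\<dots> \<le> r * (\<eta> / 2)" using r eta by (simp add: \<delta>_def)
    finally have "L - v j0 (s + ln r) < \<eta> / 2" using r by simp
    then show ?thesis using Leta lnr by (simp add: a_def algebra_simps)
  qed
  have "real (N + 1) ^ 2 * (\<eta> / 2) = (\<Sum>km\<in>K. \<eta> / 2)" by (simp add: K_def power2_eq_square algebra_simps)
  also have "\<dots> \<le> (\<Sum>km\<in>K. v j0 (a - f km))" by (intro sum_mono low)
  also have "\<dots> = (\<Sum>c\<in>F. v j0 (a - c))" unfolding F_def by (simp add: sum.reindex[OF inj])
  also have "\<dots> \<le> 1 + (W + 2 * \<epsilon>) / l"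
  proof (rule hitting_bound_window_sum[OF v(1) _ _ l F])
    show "0 \<le> W" using t by (simp add: W_def)
    show "2 * \<epsilon> < \<bar>c - c'\<bar>" if "c \<in> F" "c' \<in> F" "c \<noteq> c'" for c c'
      using e1(3)[OF that] by (auto simp: \<epsilon>_def)
  qed (use eps loops in auto)
  also have "\<dots> \<le> 1 + (W + 2) / l" using eps l(1) by (simp add: divide_right_mono)
  finally show False using N by (simp add: W_def)
qed

end

section \<open>Similar copies, tessellations and neighbourhoods\<close>

lemma similar_image: "translate v (rescale \<alpha> S) = (\<lambda>x. \<alpha> *\<^sub>R x + v) ` S"
  by (simp add: translate_def rescale_def image_image add.commute)

lemma mem_similar_iff:
  "\<alpha> > 0 \<Longrightarrow> x \<in> translate v (rescale \<alpha> S) \<longleftrightarrow> (1 / \<alpha>) *\<^sub>R (x - v) \<in> S"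
  by (force simp: similar_image image_iff)

lemma similar_compose:
  "translate v (rescale \<alpha> (translate w (rescale \<beta> S))) = translate (v + \<alpha> *\<^sub>R w) (rescale (\<alpha> * \<beta>) S)"
  by (simp add: similar_image image_image algebra_simps)

lemma similar_trivial [simp]: "translate 0 (rescale 1 S) = S"
  by (simp add: similar_image)

lemma similar_mono: "S \<subseteq> T \<Longrightarrow> translate v (rescale \<alpha> S) \<subseteq> translate v (rescale \<alpha> T)"
  by (auto simp: similar_image)

lemma inj_similar: "\<alpha> > 0 \<Longrightarrow> inj (\<lambda>x. \<alpha> *\<^sub>R x + (v::'a::euclidean_space))"
  by (auto intro!: injI)

lemma interior_similar:
  assumes "\<alpha> > 0"
  shows "interior (translate v (rescale \<alpha> S)) = translate v (rescale \<alpha> (interior (S::'a::euclidean_space set)))"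
  unfolding translate_def rescale_def interior_translation
  using assms by (subst interior_injective_linear_image) (auto intro!: injI)

lemma closure_similar:
  assumes "\<alpha> > 0"
  shows "closure (translate v (rescale \<alpha> S)) = translate v (rescale \<alpha> (closure (S::'a::euclidean_space set)))"
  unfolding translate_def rescale_def closure_translation
  using assms by (subst closure_injective_linear_image) (auto intro!: injI)

lemma frontier_similar:
  assumes "\<alpha> > 0"
  shows "frontier (translate v (rescale \<alpha> S)) = translate v (rescale \<alpha> (frontier (S::'a::euclidean_space set)))"
  unfolding frontier_def interior_similar[OF assms] closure_similar[OF assms]
  by (rule set_eqI) (simp add: mem_similar_iff[OF assms])

lemma measure_similar:
  assumes "\<alpha> > 0"
  shows "measure lebesgue (translate v (rescale \<alpha> S)) = \<alpha> ^ DIM('a) * measure lebesgue (S::'a::euclidean_space set)"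
  using assms measure_lebesgue_affine[of \<alpha> v S] by (simp add: similar_image)

lemma is_tile_similar:
  assumes "is_tile S" "\<alpha> > 0"
  shows "is_tile (translate v (rescale \<alpha> (S::'a::euclidean_space set)))"
proof -
  have b: "bounded (translate v (rescale \<alpha> S))"
    using assms by (auto simp: is_tile_def translate_def rescale_def intro!: bounded_translation bounded_scaling)
  have "emeasure lebesgue (translate v (rescale \<alpha> (frontier S))) = 0"
    using assms(1) emeasure_lebesgue_affine[of \<alpha> v "frontier S"]
    by (simp add: similar_image is_tile_def null_sets_def)
  moreover have "frontier (translate v (rescale \<alpha> S)) \<in> sets lebesgue"
    by (intro sets_completionI_sets) simp
  ultimately have f: "negligible (frontier (translate v (rescale \<alpha> S)))"
    by (simp add: negligible_iff_null_sets null_sets_def frontier_similar[OF assms(2)])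
  show ?thesis using assms measure_similar[OF assms(2), of v S] b f measurable_Jordan[OF b f]
    by (auto simp: is_tile_def negligible_iff_null_sets fmeasurableD)
qed

lemma tile_interior_nonempty:
  assumes "is_tile X" shows "interior X \<noteq> {}"
proof
  assume "interior X = {}"
  then have "X \<subseteq> frontier X" using closure_subset by (auto simp: frontier_def)
  moreover have "negligible (frontier X)" using assms by (simp add: is_tile_def negligible_iff_null_sets)
  ultimately have "negligible X" by (rule negligible_subset[rotated])
  then show False using assms by (simp add: is_tile_def negligible_imp_measure0)
qed

lemma tile_lmeasurable: "is_tile X \<Longrightarrow> X \<in> lmeasurable"
  by (simp add: is_tile_def bounded_set_imp_lmeasurable)

lemma tiles_negligible_overlap:
  assumes "is_tile S" "is_tile T" "interior S \<inter> interior T = {}"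
  shows "negligible (S \<inter> T)"
proof (rule negligible_subset)
  show "negligible (frontier S \<union> frontier T)"
    using assms by (intro negligible_Un) (auto simp: is_tile_def negligible_iff_null_sets)
  show "S \<inter> T \<subseteq> frontier S \<union> frontier T"
    using assms(3) closure_subset by (auto simp: frontier_def)
qed

text \<open>Volumes add up because tiles overlap only in their boundaries, which are null sets.\<close>

lemma measure_tessellation_Int:
  assumes "tessellation P U" "finite P" "A \<in> sets lebesgue"
  shows "measure lebesgue (U \<inter> A) = (\<Sum>Y\<in>P. measure lebesgue (Y \<inter> A))"
proof -
  have "measure lebesgue (\<Union>((\<lambda>Y. Y \<inter> A) ` P)) = (\<Sum>Y\<in>P. measure lebesgue (Y \<inter> A))"
  proof (rule measure_negligible_finite_Union_image[OF assms(2)])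
    show "Y \<inter> A \<in> lmeasurable" if "Y \<in> P" for Y
      using that assms by (auto simp: tessellation_def tile_lmeasurable intro: fmeasurable_Int_fmeasurable)
    show "pairwise (\<lambda>x y. negligible (x \<inter> A \<inter> (y \<inter> A))) P"
    proof (rule pairwiseI)
      fix x y assume "x \<in> P" "y \<in> P" "x \<noteq> y"
      then have "negligible (x \<inter> y)"
        using assms(1) by (intro tiles_negligible_overlap) (auto simp: tessellation_def pairwise_def)
      then show "negligible (x \<inter> A \<inter> (y \<inter> A))" by (rule negligible_subset) auto
    qed
  qed
  moreover have "\<Union>((\<lambda>Y. Y \<inter> A) ` P) = U \<inter> A" using assms(1) by (auto simp: tessellation_def)
  ultimately show ?thesis by simp
qed

lemma measure_tessellation:
  assumes "tessellation P U" "finite P"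
  shows "measure lebesgue U = (\<Sum>Y\<in>P. measure lebesgue Y)"
  using measure_tessellation_Int[OF assms, of UNIV] by simp

lemma tessellation_similar:
  assumes "tessellation P (U::'a::euclidean_space set)" "\<alpha> > 0"
  shows "tessellation ((\<lambda>Y. translate v (rescale \<alpha> Y)) ` P) (translate v (rescale \<alpha> U))"
  unfolding tessellation_def
proof (intro conjI)
  show "\<forall>T\<in>(\<lambda>Y. translate v (rescale \<alpha> Y)) ` P. is_tile T"
    using assms by (auto simp: tessellation_def intro: is_tile_similar)
  show "pairwise (\<lambda>S T. interior S \<inter> interior T = {}) ((\<lambda>Y. translate v (rescale \<alpha> Y)) ` P)"
  proof (rule pairwiseI; clarify)
    fix Y Z assume "Y \<in> P" "Z \<in> P" "translate v (rescale \<alpha> Y) \<noteq> translate v (rescale \<alpha> Z)"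
    then have "interior Y \<inter> interior Z = {}"
      using assms(1) unfolding tessellation_def pairwise_def by metis
    then show "interior (translate v (rescale \<alpha> Y)) \<inter> interior (translate v (rescale \<alpha> Z)) = {}"
      unfolding interior_similar[OF assms(2)] by (auto simp: mem_similar_iff[OF assms(2)])
  qed
  show "\<Union>((\<lambda>Y. translate v (rescale \<alpha> Y)) ` P) = translate v (rescale \<alpha> U)"
    using assms(1) by (auto simp: tessellation_def similar_image)
qed

lemma closed_thicken: "closed (thicken r (A :: 'a::euclidean_space set))"
proof (cases "A = {}")
  case False
  have "closed {x. infdist x A \<le> r}" by (intro closed_Collect_le continuous_intros)
  then show ?thesis using False by (simp add: thicken_def)
qed (simp add: thicken_def)

lemma bounded_thicken: "bounded A \<Longrightarrow> bounded (thicken r (A :: 'a::euclidean_space set))"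
proof (cases "A = {}")
  case False
  assume A: "bounded A"
  then obtain B where B: "\<And>a. a \<in> A \<Longrightarrow> norm a \<le> B" by (auto simp: bounded_iff)
  have "norm x \<le> B + r + 1" if x: "x \<in> thicken r A" for x
  proof -
    have "infdist x A < r + 1" using x by (simp add: thicken_def)
    then obtain a where a: "a \<in> A" "dist x a < r + 1"
      using False by (auto simp: infdist_def cINF_less_iff)
    have "norm x \<le> norm a + dist x a" by (simp add: dist_norm norm_triangle_sub)
    then show ?thesis using B[OF a(1)] a(2) by linarith
  qed
  then show ?thesis by (auto simp: bounded_iff)
qed (simp add: thicken_def)

lemma lmeasurable_thicken: "bounded A \<Longrightarrow> thicken r (A :: 'a::euclidean_space set) \<in> lmeasurable"
  by (intro lmeasurable_compact) (simp add: compact_eq_bounded_closed closed_thicken bounded_thicken)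

lemma mem_thickenI: "a \<in> A \<Longrightarrow> dist x a \<le> r \<Longrightarrow> x \<in> thicken r A"
  unfolding thicken_def using infdist_le[of a A x] by auto

lemma mem_thickenE:
  assumes "x \<in> thicken r A" "r < s"
  obtains a where "a \<in> A" "dist x a < s"
proof -
  have "A \<noteq> {}" "infdist x A < s" using assms by (auto simp: thicken_def)
  then show ?thesis using that by (auto simp: infdist_def cINF_less_iff)
qed

text \<open>A segment from a point outside \<open>A\<close> to a point of \<open>A\<close> crosses the frontier. The extra \<open>1\<close> allows for
a distance that is not attained.\<close>

lemma thicken_subset_frontier:
  fixes A :: "'a::euclidean_space set"
  shows "thicken r A \<subseteq> A \<union> thicken (r + 1) (frontier A)"
proof
  fix x assume "x \<in> thicken r A"
  then obtain a where a: "a \<in> A" "dist x a < r + 1" by (rule mem_thickenE[where s = "r + 1"]) auto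
  show "x \<in> A \<union> thicken (r + 1) (frontier A)"
  proof (cases "x \<in> A")
    case False
    have "closed_segment x a \<inter> frontier A \<noteq> {}"
      using a(1) False by (intro connected_Int_frontier) auto
    then obtain f where f: "f \<in> closed_segment x a" "f \<in> frontier A" by blast
    then have "dist x f \<le> dist x a" using dist_in_closed_segment[of f x a] by (simp add: dist_commute)
    then show ?thesis using a(2) f(2) mem_thickenI[of f "frontier A" x "r + 1"] by simp
  qed simp
qed

lemma thicken_translate:
  fixes A :: "'a::euclidean_space set"
  shows "thicken r (translate w A) = translate w (thicken r A)"
proof -
  have inf: "infdist (w + x) (translate w A) = infdist x A" for x :: 'a and w A
    by (simp add: infdist_def translate_def image_image)
  have "x \<in> thicken r (translate w A) \<longleftrightarrow> x - w \<in> thicken r A" for x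
    using inf[of w "x - w" A] by (auto simp: thicken_def translate_def)
  moreover have "x \<in> translate w S \<longleftrightarrow> x - w \<in> S" for x and S :: "'a set"
    by (force simp: translate_def)
  ultimately show ?thesis by blast
qed

lemma card_packing_le:
  fixes A :: "'a::euclidean_space set"
  assumes "finite I" "\<And>i. i \<in> I \<Longrightarrow> f i \<in> lmeasurable" "\<And>i. i \<in> I \<Longrightarrow> f i \<subseteq> A"
    "\<And>i. i \<in> I \<Longrightarrow> \<delta> \<le> measure lebesgue (f i)"
    "\<And>i j. i \<in> I \<Longrightarrow> j \<in> I \<Longrightarrow> i \<noteq> j \<Longrightarrow> f i \<inter> f j = {}" "A \<in> lmeasurable"
  shows "real (card I) * \<delta> \<le> measure lebesgue A"
proof -
  have "real (card I) * \<delta> = (\<Sum>i\<in>I. \<delta>)" by simp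
  also have "\<dots> \<le> (\<Sum>i\<in>I. measure lebesgue (f i))" using assms(4) by (intro sum_mono)
  also have "\<dots> = measure lebesgue (\<Union>(f ` I))"
    using assms by (intro measure_negligible_finite_Union_image[symmetric]) (auto simp: pairwise_def)
  also have "\<dots> \<le> measure lebesgue A"
    using assms by (intro measure_mono_fmeasurable) (auto intro!: sets.finite_Union fmeasurableD)
  finally show ?thesis .
qed

lemma finite_packing:
  fixes A :: "'a::euclidean_space set"
  assumes "A \<in> lmeasurable" "0 < \<delta>" "\<And>K. K \<in> \<K> \<Longrightarrow> K \<in> lmeasurable \<and> K \<subseteq> A \<and> \<delta> \<le> measure lebesgue K"
    "\<And>K L. K \<in> \<K> \<Longrightarrow> L \<in> \<K> \<Longrightarrow> K \<noteq> L \<Longrightarrow> K \<inter> L = {}"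
  shows "finite \<K>"
proof (rule ccontr)
  assume "infinite \<K>"
  obtain N :: nat where N: "measure lebesgue A / \<delta> < real N" using reals_Archimedean2 by blast
  obtain I where I: "I \<subseteq> \<K>" "finite I" "card I = N"
    using infinite_arbitrarily_large[OF \<open>infinite \<K>\<close>] by blast
  have "real (card I) * \<delta> \<le> measure lebesgue A"
    by (rule card_packing_le[of I "\<lambda>K. K"]) (use I assms in blast)+
  then show False using N I assms(2) by (simp add: divide_less_eq)
qed

section \<open>Iterated substitution\<close>

lemma subst_step_Union: "(subst_step \<sigma> ^^ k) P = (\<Union>X\<in>P. (subst_step \<sigma> ^^ k) {X})"
proof (induction k)
  case (Suc k)
  have step: "subst_step \<sigma> Q = (\<Union>X\<in>Q. subst_step \<sigma> {X})" for Q :: "'a set set"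
    unfolding subst_step_def by fastforce
  have "(subst_step \<sigma> ^^ Suc k) P = subst_step \<sigma> (\<Union>X\<in>P. (subst_step \<sigma> ^^ k) {X})" using Suc by simp
  also have "\<dots> = (\<Union>X\<in>P. subst_step \<sigma> ((subst_step \<sigma> ^^ k) {X}))"
    by (subst (1 2) step) blast
  finally show ?case by simp
qed auto

text \<open>The flow subdivides every tile separately, so one tile can be followed through it, and properties of its
descendants can be proved by induction from the root of the substitution tree.\<close>

definition descendants :: "'a::euclidean_space scheme \<Rightarrow> nat \<Rightarrow> 'a set \<Rightarrow> 'a set set" where
  "descendants \<sigma> k X = (subst_step \<sigma> ^^ k) {X}"

lemma descendants_0 [simp]: "descendants \<sigma> 0 X = {X}"
  by (simp add: descendants_def)

lemma descendants_small: "measure lebesgue X \<le> 1 \<Longrightarrow> descendants \<sigma> k X = {X}"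
proof (induction k)
  case (Suc k)
  then show ?case by (auto simp: descendants_def subst_step_def)
qed simp

lemma descendants_Suc:
  assumes "measure lebesgue X > 1"
  shows "descendants \<sigma> (Suc k) X = (\<Union>Y\<in>subst_tile \<sigma> X. descendants \<sigma> k Y)"
proof -
  have "subst_step \<sigma> {X} = subst_tile \<sigma> X" using assms by (auto simp: subst_step_def)
  then show ?thesis unfolding descendants_def funpow_Suc_right o_apply
    using subst_step_Union[of k \<sigma> "subst_tile \<sigma> X"] by simp
qed

lemma descendants_induct [consumes 1, case_names self child]:
  assumes "Y \<in> descendants \<sigma> k X"
    and "\<And>X. R X X"
    and "\<And>X Z. measure lebesgue X > 1 \<Longrightarrow> Z \<in> subst_tile \<sigma> X \<Longrightarrow> R Z Y \<Longrightarrow> R X Y"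
  shows "R X Y"
  using assms(1)
proof (induction k arbitrary: X)
  case 0
  then show ?case using assms(2) by simp
next
  case (Suc k)
  show ?case
  proof (cases "measure lebesgue X \<le> 1")
    case True
    then show ?thesis using Suc.prems assms(2) by (simp add: descendants_small)
  next
    case False
    then show ?thesis using Suc assms(3)[of X] by (auto simp: descendants_Suc)
  qed
qed

locale multiscale_scheme =
  fixes \<sigma> :: "'a::euclidean_space scheme"
  assumes scheme: "substitution_scheme \<sigma>"
    and norm: "normalized \<sigma>"
    and distinct: "geometrically_distinct \<sigma>"
    and origin: "origin_positioned \<sigma>"
    and types: "0 < num_types \<sigma>"
begin

abbreviation "T \<equiv> proto \<sigma>"
abbreviation "n \<equiv> num_types \<sigma>"
abbreviation "E i \<equiv> subst_rule \<sigma> (proto \<sigma> i)"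
abbreviation "vol \<equiv> measure lebesgue :: 'a set \<Rightarrow> real"

lemma prototile: "i < n \<Longrightarrow> is_tile (T i)" "i < n \<Longrightarrow> vol (T i) = 1"
  using scheme norm by (auto simp: substitution_scheme_def normalized_def)

lemma finite_rule: "i < n \<Longrightarrow> finite (E i)"
  and rule_tessellation: "i < n \<Longrightarrow> tessellation (E i) (T i)"
  using scheme by (auto simp: substitution_scheme_def)

lemma type_unique:
  assumes "has_type \<sigma> i X" "has_type \<sigma> j X" "i < n" "j < n"
  shows "i = j"
proof (rule ccontr)
  assume ne: "i \<noteq> j"
  obtain \<alpha> v where X1: "\<alpha> > 0" "X = translate v (rescale \<alpha> (T i))"
    using assms(1) by (auto simp: has_type_def tile_of_def)
  obtain \<beta> w where X2: "\<beta> > 0" "X = translate w (rescale \<beta> (T j))"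
    using assms(2) by (auto simp: has_type_def tile_of_def)
  note X = X1 X2
  have "T i = translate (- ((1 / \<alpha>) *\<^sub>R v)) (rescale (1 / \<alpha>) X)"
    using X(1) by (simp add: X(2) similar_compose)
  also have "\<dots> = translate (- ((1 / \<alpha>) *\<^sub>R v) + (1 / \<alpha>) *\<^sub>R w) (rescale (1 / \<alpha> * \<beta>) (T j))"
    by (simp add: X(4) similar_compose)
  finally have "has_type \<sigma> j (T i)"
    using X by (auto simp: has_type_def tile_of_def intro!: exI[of _ "1 / \<alpha> * \<beta>"])
  then show False using distinct assms ne by (auto simp: geometrically_distinct_def)
qed

definition type_of :: "'a set \<Rightarrow> nat" where
  "type_of X = (THE j. j < n \<and> has_type \<sigma> j X)"

lemma type_of_eq: "j < n \<Longrightarrow> has_type \<sigma> j X \<Longrightarrow> type_of X = j"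
  unfolding type_of_def using type_unique by blast

text \<open>Type, scale and position can be read off a tile: the type by geometric distinctness, the scale from
the volume, and the position because a bounded set has no translational symmetry.\<close>

lemma similar_unique:
  assumes "translate v (rescale \<alpha> (T i)) = translate w (rescale \<beta> (T j))" "\<alpha> > 0" "\<beta> > 0" "i < n" "j < n"
  shows "i = j" "\<alpha> = \<beta>" "v = w"
proof -
  show ij: "i = j" by (rule type_unique) (use assms in \<open>auto simp: has_type_def tile_of_def\<close>)
  have "\<alpha> ^ DIM('a) = \<beta> ^ DIM('a)"
    using measure_similar[OF assms(2), of v "T i"] measure_similar[OF assms(3), of w "T j"] assms prototile by simp
  then show ab: "\<alpha> = \<beta>" using assms power_eq_imp_eq_base[of \<alpha> "DIM('a)" \<beta>] by simp
  have "translate (v - w) (translate w (rescale \<alpha> (T i))) = translate w (rescale \<alpha> (T i))"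
    using assms(1) unfolding ij ab by (simp add: translate_def image_image)
  moreover have "is_tile (translate w (rescale \<alpha> (T i)))" using assms prototile is_tile_similar by blast
  then have "bounded (translate w (rescale \<alpha> (T i)))" "translate w (rescale \<alpha> (T i)) \<noteq> {}"
    by (auto simp: is_tile_def)
  ultimately have "v - w = 0" by (intro translate_eq_self)
  then show "v = w" by simp
qed

definition copy :: "nat \<Rightarrow> real \<Rightarrow> 'a \<Rightarrow> 'a set" where
  "copy i \<alpha> v = translate v (rescale \<alpha> (T i))"

definition is_copy :: "'a set \<Rightarrow> bool" where
  "is_copy X \<longleftrightarrow> (\<exists>i<n. has_type \<sigma> i X)"

lemma is_copy_iff: "is_copy X \<longleftrightarrow> (\<exists>i \<alpha> v. i < n \<and> \<alpha> > 0 \<and> X = copy i \<alpha> v)"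
  by (auto simp: is_copy_def has_type_def tile_of_def copy_def)

lemma has_type_copy: "\<alpha> > 0 \<Longrightarrow> has_type \<sigma> i (copy i \<alpha> v)"
  by (auto simp: has_type_def tile_of_def copy_def)

lemma type_of_copy: "i < n \<Longrightarrow> \<alpha> > 0 \<Longrightarrow> type_of (copy i \<alpha> v) = i"
  by (simp add: type_of_eq has_type_copy)

lemma vol_copy: "i < n \<Longrightarrow> \<alpha> > 0 \<Longrightarrow> vol (copy i \<alpha> v) = \<alpha> ^ DIM('a)"
  by (simp add: copy_def measure_similar prototile)

lemma is_tile_copy: "i < n \<Longrightarrow> \<alpha> > 0 \<Longrightarrow> is_tile (copy i \<alpha> v)"
  by (simp add: copy_def is_tile_similar prototile)

lemma is_copy_copy: "i < n \<Longrightarrow> \<alpha> > 0 \<Longrightarrow> is_copy (copy i \<alpha> v)"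
  unfolding is_copy_iff by blast

lemma is_copyE:
  assumes "is_copy X"
  obtains i \<alpha> v where "i < n" "\<alpha> > 0" "X = copy i \<alpha> v"
  using assms unfolding is_copy_iff by blast

lemma is_copy_is_tile: "is_copy X \<Longrightarrow> is_tile X"
  by (auto elim!: is_copyE simp: is_tile_copy)

lemma type_of_less: "is_copy X \<Longrightarrow> type_of X < n"
  by (auto elim!: is_copyE simp: type_of_copy)

lemma translate_copy:
  assumes "is_copy Y" shows "is_copy (translate g Y)" "vol (translate g Y) = vol Y"
proof -
  obtain i \<alpha> v where c: "i < n" "\<alpha> > 0" "Y = copy i \<alpha> v" using assms by (rule is_copyE)
  have "translate g Y = copy i \<alpha> (g + v)" by (simp add: c copy_def translate_def image_image add.assoc)
  then show "is_copy (translate g Y)" using c by (simp add: is_copy_copy)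
  show "vol (translate g Y) = vol Y" by (simp add: translate_def measure_translation)
qed

lemma rule_edge:
  assumes "i < n" "Y \<in> E i"
  obtains j \<beta> w where "j < n" "0 < \<beta>" "\<beta> < 1" "Y = copy j \<beta> w" "Y \<subseteq> T i"
proof -
  have "\<exists>j<n. \<exists>\<beta>\<in>{0<..<1}. tile_of \<sigma> j \<beta> Y"
    using scheme assms unfolding substitution_scheme_def by blast
  then obtain j \<beta> w where "j < n" "0 < \<beta>" "\<beta> < 1" "Y = copy j \<beta> w"
    unfolding tile_of_def copy_def by auto
  moreover have "Y \<subseteq> T i" using rule_tessellation[OF assms(1)] assms(2) by (auto simp: tessellation_def)
  ultimately show ?thesis by (rule that)
qed

lemma rule_vol:
  assumes "i < n" "Y \<in> E i" shows "0 < vol Y" "vol Y < 1" "is_copy Y"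
proof -
  obtain j \<beta> w where "j < n" "0 < \<beta>" "\<beta> < 1" "Y = copy j \<beta> w" "Y \<subseteq> T i"
    by (rule rule_edge[OF assms])
  then have v: "vol Y = \<beta> ^ DIM('a)" and "is_copy Y" by (simp_all only: vol_copy is_copy_copy)
  moreover have "\<beta> ^ DIM('a) < 1 ^ DIM('a)" using \<open>0 < \<beta>\<close> \<open>\<beta> < 1\<close> by (intro power_strict_mono) auto
  ultimately show "0 < vol Y" "vol Y < 1" "is_copy Y" using \<open>0 < \<beta>\<close> by (auto simp only: v zero_less_power power_one)
qed

lemma rule_vol_sum: "i < n \<Longrightarrow> (\<Sum>Y\<in>E i. vol Y) = 1"
  using measure_tessellation[OF rule_tessellation finite_rule] prototile by simp

lemma subst_tile_copy:
  assumes "i < n" "\<alpha> > 0"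
  shows "subst_tile \<sigma> (copy i \<alpha> v) = (\<lambda>Y. translate v (rescale \<alpha> Y)) ` E i"
proof -
  have "i = j \<and> \<alpha> = \<beta> \<and> v = w" if "copy i \<alpha> v = translate w (rescale \<beta> (T j))" "j < n" "\<beta> > 0" for j \<beta> w
    using similar_unique[of v \<alpha> i w \<beta> j] that assms by (auto simp: copy_def)
  then have "subst_tile \<sigma> (copy i \<alpha> v) \<subseteq> (\<lambda>Y. translate v (rescale \<alpha> Y)) ` E i"
    unfolding subst_tile_def by blast
  moreover have "(\<lambda>Y. translate v (rescale \<alpha> Y)) ` E i \<subseteq> subst_tile \<sigma> (copy i \<alpha> v)"
    using assms unfolding subst_tile_def copy_def by blast
  ultimately show ?thesis by blast
qed

lemma inj_on_rule_similar: "\<alpha> > 0 \<Longrightarrow> inj_on (\<lambda>Y. translate v (rescale \<alpha> Y)) (A :: 'a set set)"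
  using inj_similar[of \<alpha> v] by (auto intro!: inj_onI simp: similar_image inj_image_eq_iff)

lemma child_of_copy:
  assumes "i < n" "\<alpha> > 0" "Y \<in> E i"
  shows "is_copy (translate v (rescale \<alpha> Y))" "type_of (translate v (rescale \<alpha> Y)) = type_of Y"
    "vol (translate v (rescale \<alpha> Y)) = vol (copy i \<alpha> v) * vol Y"
proof -
  obtain j \<beta> w where Y: "j < n" "0 < \<beta>" "\<beta> < 1" "Y = copy j \<beta> w" "Y \<subseteq> T i"
    by (rule rule_edge[OF assms(1,3)])
  have "translate v (rescale \<alpha> Y) = copy j (\<alpha> * \<beta>) (v + \<alpha> *\<^sub>R w)"
    by (simp add: Y copy_def similar_compose)
  then show "is_copy (translate v (rescale \<alpha> Y))" "type_of (translate v (rescale \<alpha> Y)) = type_of Y"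
    "vol (translate v (rescale \<alpha> Y)) = vol (copy i \<alpha> v) * vol Y"
    using Y assms by (simp_all add: is_copy_copy type_of_copy vol_copy power_mult_distrib)
qed

text \<open>The volumes and types in \<open>\<rho>(X)\<close> depend on \<open>X\<close> only through its type and, as a factor, its volume:
the substitution is a walk on a finite graph.\<close>

lemma sum_subst_tile:
  assumes "is_copy X"
  shows "(\<Sum>Z\<in>subst_tile \<sigma> X. f (vol Z) (type_of Z)) = (\<Sum>Y\<in>E (type_of X). f (vol X * vol Y) (type_of Y))"
proof -
  obtain i \<alpha> v where X: "i < n" "\<alpha> > 0" "X = copy i \<alpha> v" using assms(1) by (rule is_copyE)
  have "(\<Sum>Z\<in>subst_tile \<sigma> X. f (vol Z) (type_of Z)) =
      (\<Sum>Y\<in>E i. f (vol (translate v (rescale \<alpha> Y))) (type_of (translate v (rescale \<alpha> Y))))"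
    unfolding X(3) subst_tile_copy[OF X(1,2)] by (simp add: sum.reindex[OF inj_on_rule_similar[OF X(2)]])
  also have "\<dots> = (\<Sum>Y\<in>E i. f (vol X * vol Y) (type_of Y))"
    by (intro sum.cong) (auto simp: child_of_copy[OF X(1,2)] X(3))
  finally show ?thesis using X by (simp add: type_of_copy)
qed

lemma subst_tile_facts:
  assumes "is_copy X"
  shows "finite (subst_tile \<sigma> X)" "tessellation (subst_tile \<sigma> X) X" "Z \<in> subst_tile \<sigma> X \<Longrightarrow> is_copy Z"
proof -
  obtain i \<alpha> v where X: "i < n" "\<alpha> > 0" "X = copy i \<alpha> v" using assms(1) by (rule is_copyE)
  show "finite (subst_tile \<sigma> X)" using X by (simp add: subst_tile_copy finite_rule)
  show "tessellation (subst_tile \<sigma> X) X"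
    using tessellation_similar[OF rule_tessellation[OF X(1)] X(2), of v]
    unfolding X(3) subst_tile_copy[OF X(1,2)] by (simp add: copy_def)
  show "is_copy Z" if "Z \<in> subst_tile \<sigma> X" using that X by (auto simp: subst_tile_copy child_of_copy)
qed

lemma child_vol:
  assumes "is_copy X" "Z \<in> subst_tile \<sigma> X"
  obtains Y where "Y \<in> E (type_of X)" "type_of Z = type_of Y" "vol Z = vol X * vol Y"
proof -
  obtain i \<alpha> v where X: "i < n" "\<alpha> > 0" "X = copy i \<alpha> v" using assms(1) by (rule is_copyE)
  with assms(2) that show ?thesis by (auto simp: subst_tile_copy child_of_copy type_of_copy)
qed

lemma descendants_is_copy: "Y \<in> descendants \<sigma> k X \<Longrightarrow> is_copy X \<Longrightarrow> is_copy Y"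
  by (induction rule: descendants_induct) (auto intro: subst_tile_facts)

lemma descendants_subset: "Y \<in> descendants \<sigma> k X \<Longrightarrow> is_copy X \<Longrightarrow> Y \<subseteq> X"
proof (induction rule: descendants_induct)
  case (child X Z)
  have "is_copy Z" "Z \<subseteq> X"
    using subst_tile_facts[OF child(4)] child(2) by (auto simp only: tessellation_def)
  then show ?case using child(3) by blast
qed simp

lemma finite_descendants: "is_copy X \<Longrightarrow> finite (descendants \<sigma> k X)"
proof (induction k arbitrary: X)
  case (Suc k)
  then show ?case
    by (cases "vol X \<le> 1") (auto simp: descendants_small descendants_Suc intro!: finite_UN_I subst_tile_facts)
qed simp

lemma rule_vol_bounds:
  obtains q Q where "0 < q" "Q < 1" "0 \<le> Q" "\<forall>i<n. \<forall>Y\<in>E i. q \<le> vol Y \<and> vol Y \<le> Q"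
proof -
  let ?A = "vol ` (\<Union>i<n. E i)"
  have fin: "finite ?A" using finite_rule by auto
  have ne: "?A \<noteq> {}" using types rule_vol_sum[of 0] by fastforce
  have mem: "0 < x \<and> x < 1" if "x \<in> ?A" for x using that rule_vol by auto
  show ?thesis
  proof (rule that[of "Min ?A" "Max ?A"])
    show "0 < Min ?A" "Max ?A < 1" using mem Min_in[OF fin ne] Max_in[OF fin ne] by auto
    show "0 \<le> Max ?A" using mem[OF Max_in[OF fin ne]] by simp
    show "\<forall>i<n. \<forall>Y\<in>E i. Min ?A \<le> vol Y \<and> vol Y \<le> Max ?A"
      using fin by (auto intro!: Min_le Max_ge)
  qed
qed

lemma descendants_vol_ge:
  assumes q: "\<And>i Y. i < n \<Longrightarrow> Y \<in> E i \<Longrightarrow> q \<le> vol Y"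
    and "Y \<in> descendants \<sigma> k X" "is_copy X" "q \<le> vol X"
  shows "q \<le> vol Y"
  using assms(2-)
proof (induction rule: descendants_induct)
  case (child X Z)
  obtain W where W: "W \<in> E (type_of X)" "type_of Z = type_of W" "vol Z = vol X * vol W"
    by (rule child_vol[OF child(4,2)])
  then have "q \<le> vol W" "0 < vol W" using q rule_vol type_of_less[OF child(4)] by auto
  then have "q \<le> vol Z" using W(3) child(1) mult_right_mono[of 1 "vol X" "vol W"] by linarith
  then show ?case using child subst_tile_facts by blast
qed

lemma descendants_large_vol:
  assumes Q: "\<And>i Y. i < n \<Longrightarrow> Y \<in> E i \<Longrightarrow> vol Y \<le> Q" and "0 \<le> Q"
  shows "Y \<in> descendants \<sigma> k X \<Longrightarrow> is_copy X \<Longrightarrow> vol Y > 1 \<Longrightarrow> vol Y \<le> Q ^ k * vol X"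
proof (induction k arbitrary: X)
  case (Suc k)
  show ?case
  proof (cases "vol X \<le> 1")
    case True
    then show ?thesis using Suc.prems descendants_small[OF True] by simp
  next
    case False
    then obtain Z where Z: "Z \<in> subst_tile \<sigma> X" "Y \<in> descendants \<sigma> k Z"
      using Suc.prems(1) descendants_Suc[of X] by auto
    obtain W where W: "W \<in> E (type_of X)" "type_of Z = type_of W" "vol Z = vol X * vol W"
      by (rule child_vol[OF Suc.prems(2) Z(1)])
    have "vol Y \<le> Q ^ k * vol Z"
      by (rule Suc.IH[OF Z(2) subst_tile_facts(3)[OF Suc.prems(2) Z(1)] Suc.prems(3)])
    also have "\<dots> \<le> Q ^ k * (vol X * Q)"
      unfolding W(3) using Q W(1) type_of_less[OF Suc.prems(2)] assms(2) by (intro mult_left_mono) auto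
    finally show ?thesis by (simp add: algebra_simps)
  qed
qed simp

lemma initial_copy: "rescale (exp t) (T i) = copy i (exp t) 0"
  by (simp add: copy_def translate_def)

text \<open>The minimum in the definition of the flow is attained, because volumes above \<open>1\<close> decay
  geometrically under substitution.\<close>

lemma flow_descendants:
  assumes "i < n"
  obtains k where "flow \<sigma> t i = descendants \<sigma> k (copy i (exp t) 0)"
    "\<And>Y. Y \<in> flow \<sigma> t i \<Longrightarrow> vol Y \<le> 1"
proof -
  let ?X = "copy i (exp t) 0"
  obtain q Q where Q: "0 < q" "Q < 1" "0 \<le> Q" "\<forall>i<n. \<forall>Y\<in>E i. q \<le> vol Y \<and> vol Y \<le> Q"
    by (rule rule_vol_bounds)
  have X: "is_copy ?X" using assms by (simp add: is_copy_copy)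
  have "(\<lambda>k. Q ^ k * vol ?X) \<longlonglongrightarrow> 0 * vol ?X" using Q by (intro tendsto_intros LIMSEQ_power_zero) auto
  then have "eventually (\<lambda>k. Q ^ k * vol ?X < 1) sequentially" by (simp add: order_tendstoD)
  then obtain k where k: "Q ^ k * vol ?X < 1" using eventually_happens'[OF sequentially_bot] by blast
  have "vol Y \<le> 1" if "Y \<in> flow_iter \<sigma> t i k" for Y
  proof (rule ccontr)
    assume "\<not> vol Y \<le> 1"
    moreover have "Y \<in> descendants \<sigma> k ?X" using that by (simp add: flow_iter_def descendants_def initial_copy)
    ultimately have "vol Y \<le> Q ^ k * vol ?X" using Q(4) by (intro descendants_large_vol Q(3) X) auto
    then show False using k \<open>\<not> vol Y \<le> 1\<close> by linarith
  qed
  then have ex: "\<forall>Y\<in>flow_iter \<sigma> t i k. vol Y \<le> 1" by blast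
  have "\<forall>Y\<in>flow \<sigma> t i. vol Y \<le> 1"
    unfolding flow_def using LeastI[of "\<lambda>k. \<forall>Y\<in>flow_iter \<sigma> t i k. vol Y \<le> 1", OF ex] .
  moreover have "flow \<sigma> t i = descendants \<sigma> (LEAST k. \<forall>X\<in>flow_iter \<sigma> t i k. vol X \<le> 1) ?X"
    by (simp only: flow_def flow_iter_def descendants_def initial_copy)
  ultimately show ?thesis using that by blast
qed

end

section \<open>Tiles of prescribed volume in generated patches\<close>

lemma sum_UNION_le:
  fixes f :: "'b \<Rightarrow> real"
  assumes "finite I" "\<And>i. i \<in> I \<Longrightarrow> finite (A i)" "\<And>x. 0 \<le> f x"
  shows "sum f (\<Union>i\<in>I. A i) \<le> (\<Sum>i\<in>I. sum f (A i))"
  using assms(1,2)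
proof (induction I rule: finite_induct)
  case (insert i I)
  have "sum f (A i \<union> (\<Union>i\<in>I. A i)) + sum f (A i \<inter> (\<Union>i\<in>I. A i)) = sum f (A i) + sum f (\<Union>i\<in>I. A i)"
    using insert by (intro sum.union_inter) auto
  moreover have "0 \<le> sum f (A i \<inter> (\<Union>i\<in>I. A i))" using assms(3) by (intro sum_nonneg)
  moreover have "sum f (\<Union>i\<in>I. A i) \<le> (\<Sum>i\<in>I. sum f (A i))" using insert by auto
  ultimately show ?case using insert.hyps by simp
qed simp

context multiscale_scheme
begin

sublocale renewal: renewal_graph "num_types \<sigma>" "\<lambda>i. subst_rule \<sigma> (proto \<sigma> i)" "measure lebesgue" type_of
  by unfold_locales (auto intro: types finite_rule rule_vol rule_vol_sum type_of_less)

lemma copy_vol_pos: "is_copy X \<Longrightarrow> 0 < vol X"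
  using is_copy_is_tile by (auto simp: is_tile_def)

text \<open>Passing from a tile to a child multiplies the volume by the volume of an edge, so the relative
volumes of descendants are weights of walks.\<close>

lemma descendants_walk:
  assumes "Y \<in> descendants \<sigma> k X" "is_copy X"
  shows "renewal.walk (type_of X) (type_of Y) (vol Y / vol X)"
  using assms
proof (induction rule: descendants_induct)
  case (self X)
  then show ?case using copy_vol_pos[of X] renewal.walk_refl by simp
next
  case (child X Z)
  obtain W where W: "W \<in> E (type_of X)" "type_of Z = type_of W" "vol Z = vol X * vol W"
    by (rule child_vol[OF child(4,2)])
  have Z: "is_copy Z" using subst_tile_facts(3)[OF child(4,2)] .
  have "renewal.walk (type_of X) (type_of Z) (1 * vol W)"
    unfolding W(2) by (rule renewal.walk_step[OF renewal.walk_refl W(1)])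
  then have "renewal.walk (type_of X) (type_of Y) (1 * vol W * (vol Y / vol Z))"
    by (intro renewal.walk_trans[OF child(3)[OF Z]])
  moreover have "1 * vol W * (vol Y / vol Z) = vol Y / vol X"
    using W(3) copy_vol_pos[OF Z] copy_vol_pos[OF child(4)] by (auto simp: field_simps)
  ultimately show ?case by simp
qed

lemma flow_walk:
  assumes "i < n" "j < n" "Y \<in> flow \<sigma> t i" "has_type \<sigma> j Y"
  shows "renewal.walk i j (vol Y / exp (real DIM('a) * t))"
proof -
  obtain k where "flow \<sigma> t i = descendants \<sigma> k (copy i (exp t) 0)"
    using flow_descendants[OF assms(1)] by metis
  then have "renewal.walk (type_of (copy i (exp t) 0)) (type_of Y) (vol Y / vol (copy i (exp t) 0))"
    using assms by (intro descendants_walk) (auto simp: is_copy_copy)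
  then show ?thesis using assms by (simp add: type_of_copy type_of_eq vol_copy exp_of_nat_mult)
qed

text \<open>A tile of type \<open>i\<close> and volume \<open>1\<close> in \<open>F\<^sub>t(T\<^sub>i)\<close> is a loop of length \<open>DIM('a) * t\<close>: lengths
are measured by logarithms of volumes rather than of scales, which does not change the ratio of two loops.\<close>

proposition scheme_hitting_bound_vanishes:
  assumes irr: "irreducible_scheme \<sigma>" and inc: "incommensurable \<sigma>" and "0 < \<eta>"
  shows "\<exists>\<epsilon>>0. \<exists>S. \<forall>v i s. renewal.hitting_bound \<epsilon> v \<longrightarrow> i < n \<longrightarrow> S \<le> s \<longrightarrow> v i s \<le> \<eta>"
proof -
  obtain i j t1 t2 where ij: "i < n" "j < n" "0 < t1" "0 < t2" "\<not> (\<exists>r\<in>\<rat>. t1 = r * t2)"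
    and "\<exists>X\<in>flow \<sigma> t1 i. has_type \<sigma> i X \<and> vol X = 1" "\<exists>X\<in>flow \<sigma> t2 j. has_type \<sigma> j X \<and> vol X = 1"
    using inc unfolding incommensurable_def by blast
  then obtain X1 X2 where X1: "X1 \<in> flow \<sigma> t1 i" "has_type \<sigma> i X1" "vol X1 = 1"
    and X2: "X2 \<in> flow \<sigma> t2 j" "has_type \<sigma> j X2" "vol X2 = 1" by blast
  let ?r = "\<lambda>t. 1 / exp (real DIM('a) * t)"
  show ?thesis
  proof (rule renewal.hitting_bound_vanishes[OF _ ij(1,2) _ _ _ _ _ \<open>0 < \<eta>\<close>])
    show "\<exists>r. renewal.walk a b r" if "a < n" "b < n" for a b
      using irr that flow_walk unfolding irreducible_scheme_def by blast
    show "renewal.walk i i (?r t1)" using flow_walk[OF ij(1,1) X1(1,2)] X1(3) by simp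
    show "renewal.walk j j (?r t2)" using flow_walk[OF ij(2,2) X2(1,2)] X2(3) by simp
    show "?r t1 < 1" "?r t2 < 1" using ij(3,4) by simp_all
    have "ln (?r t1) / ln (?r t2) = t1 / t2" by (simp add: ln_div)
    moreover have "t1 / t2 \<notin> \<rat>" using ij(4,5) by (metis nonzero_divide_eq_eq less_irrefl)
    ultimately show "ln (?r t1) / ln (?r t2) \<notin> \<rat>" by simp
  qed
qed

definition mass :: "('a set \<Rightarrow> real) \<Rightarrow> nat \<Rightarrow> 'a set \<Rightarrow> real" where
  "mass f k X = (\<Sum>Y\<in>descendants \<sigma> k X. f Y)"

lemma mass_small: "vol X \<le> 1 \<Longrightarrow> mass f k X = f X"
  by (simp add: mass_def descendants_small)

lemma mass_0 [simp]: "mass f 0 X = f X"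
  by (simp add: mass_def)

text \<open>Counting a descendant once for each child that it comes from gives the upper bound, without a proof that
this child is unique.\<close>

lemma mass_Suc_le:
  assumes "vol X > 1" "is_copy X" "\<And>Y. 0 \<le> f Y"
  shows "mass f (Suc k) X \<le> (\<Sum>Z\<in>subst_tile \<sigma> X. mass f k Z)"
  unfolding mass_def descendants_Suc[OF assms(1)]
  using assms subst_tile_facts[OF assms(2)] by (intro sum_UNION_le finite_descendants) auto

lemma mass_nonneg: "(\<And>Y. 0 \<le> f Y) \<Longrightarrow> 0 \<le> mass f k X"
  by (simp add: mass_def sum_nonneg)

lemma mass_le_vol:
  assumes f: "\<And>Y. 0 \<le> f Y" "\<And>Y. f Y \<le> vol Y" and "is_copy X"
  shows "mass f k X \<le> vol X"
  using assms(3)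
proof (induction k arbitrary: X)
  case (Suc k)
  show ?case
  proof (cases "vol X \<le> 1")
    case True
    then show ?thesis using f by (simp add: mass_small)
  next
    case False
    then have "mass f (Suc k) X \<le> (\<Sum>Z\<in>subst_tile \<sigma> X. mass f k Z)"
      using Suc f by (intro mass_Suc_le) auto
    also have "\<dots> \<le> (\<Sum>Z\<in>subst_tile \<sigma> X. vol Z)"
      using Suc subst_tile_facts by (intro sum_mono) blast
    also have "\<dots> = vol X" using measure_tessellation subst_tile_facts[OF Suc.prems] by metis
    finally show ?thesis .
  qed
qed (use f in simp)

definition near :: "real \<Rightarrow> real \<Rightarrow> 'a set \<Rightarrow> bool" where
  "near \<mu> \<epsilon> Y \<longleftrightarrow> vol Y \<le> 1 \<and> \<bar>ln (vol Y) - ln \<mu>\<bar> \<le> \<epsilon>"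

definition near_vol :: "real \<Rightarrow> real \<Rightarrow> 'a set \<Rightarrow> real" where
  "near_vol \<mu> \<epsilon> Y = (if near \<mu> \<epsilon> Y then vol Y else 0)"

text \<open>The largest share of the volume of a tile of type \<open>i\<close> that the flow can turn into tiles of volume close
to \<open>\<mu>\<close>. The level \<open>s\<close> is the length of the walks that lead from the tile down to volume \<open>\<mu>\<close>.\<close>

definition near_density :: "real \<Rightarrow> real \<Rightarrow> nat \<Rightarrow> real \<Rightarrow> real" where
  "near_density \<mu> \<epsilon> i s =
     Sup {mass (near_vol \<mu> \<epsilon>) k X / vol X | k X. is_copy X \<and> type_of X = i \<and> ln (vol X) = s + ln \<mu>}"

lemma near_vol_bounds: "0 \<le> near_vol \<mu> \<epsilon> Y" "near_vol \<mu> \<epsilon> Y \<le> vol Y"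
  by (auto simp: near_vol_def)

lemma near_density_upper:
  assumes "is_copy X"
  shows "mass (near_vol \<mu> \<epsilon>) k X \<le> vol X * near_density \<mu> \<epsilon> (type_of X) (ln (vol X) - ln \<mu>)"
proof -
  have "mass (near_vol \<mu> \<epsilon>) k X / vol X \<le> near_density \<mu> \<epsilon> (type_of X) (ln (vol X) - ln \<mu>)"
    unfolding near_density_def
  proof (rule cSup_upper)
    show "bdd_above {mass (near_vol \<mu> \<epsilon>) k Y / vol Y | k Y.
       is_copy Y \<and> type_of Y = type_of X \<and> ln (vol Y) = ln (vol X) - ln \<mu> + ln \<mu>}"
      using copy_vol_pos mass_le_vol[OF near_vol_bounds]
      by (intro bdd_aboveI[of _ 1]) (auto simp: divide_le_eq_1)
  qed (use assms in auto)
  then show ?thesis using copy_vol_pos[OF assms] by (simp add: divide_le_eq mult.commute)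
qed

text \<open>Sorting descendants by the child that they come from is conditioning the walk on its first step. Because
\<open>\<mu> \<le> 1\<close>, a tile at a level below \<open>- \<epsilon>\<close> has volume below \<open>1\<close>; it is not subdivided any more and
contributes nothing.\<close>

lemma near_density_hitting_bound:
  assumes lam: "0 < \<mu>" "\<mu> \<le> 1" and eps: "0 \<le> \<epsilon>"
  shows "renewal.hitting_bound \<epsilon> (near_density \<mu> \<epsilon>)"
  unfolding renewal.hitting_bound_def
proof (intro allI impI)
  fix i s assume i: "i < n"
  let ?f = "near_vol \<mu> \<epsilon>"
  let ?D = "{mass ?f k X / vol X | k X. is_copy X \<and> type_of X = i \<and> ln (vol X) = s + ln \<mu>}"
  have ne: "?D \<noteq> {}"
  proof -
    let ?X = "copy i (exp ((s + ln \<mu>) / DIM('a))) 0"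
    have "is_copy ?X" "type_of ?X = i" using i by (auto simp: is_copy_copy type_of_copy)
    moreover have "ln (vol ?X) = s + ln \<mu>" using i by (simp add: vol_copy ln_realpow)
    ultimately show ?thesis by blast
  qed
  have bounds: "0 \<le> x \<and> x \<le> 1" if "x \<in> ?D" for x
    using that copy_vol_pos mass_le_vol[of ?f] mass_nonneg[of ?f] near_vol_bounds
    by (auto simp: divide_le_eq_1)
  have lower: "0 \<le> near_density \<mu> \<epsilon> j t" if "j < n" for j t
  proof -
    let ?X = "copy j (exp ((t + ln \<mu>) / DIM('a))) 0"
    have X: "is_copy ?X" "type_of ?X = j" using that by (auto simp: is_copy_copy type_of_copy)
    have "ln (vol ?X) - ln \<mu> = t" using that by (simp add: vol_copy ln_realpow)
    then have "0 \<le> vol ?X * near_density \<mu> \<epsilon> j t"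
      using near_density_upper[OF X(1), of \<mu> \<epsilon> 0] X(2) near_vol_bounds(1)[of \<mu> \<epsilon> ?X] by simp
    then show ?thesis using copy_vol_pos[OF X(1)] by (simp add: zero_le_mult_iff)
  qed
  have zero: "?f X = 0" if "ln (vol X) = s + ln \<mu>" "\<epsilon> < \<bar>s\<bar>" for X
    using that by (auto simp: near_vol_def near_def)
  have "near_density \<mu> \<epsilon> i s \<le> 1"
    unfolding near_density_def using bounds by (intro cSup_least ne) auto
  moreover have "near_density \<mu> \<epsilon> i s = 0" if "s < - \<epsilon>"
  proof -
    have "near_density \<mu> \<epsilon> i s \<le> 0"
      unfolding near_density_def
    proof (intro cSup_least ne)
      fix x assume "x \<in> ?D"
      then obtain k X where X: "x = mass ?f k X / vol X" "is_copy X" "ln (vol X) = s + ln \<mu>" by auto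
      have "ln (vol X) \<le> 0" using X(3) that eps lam by (smt (verit) ln_le_zero_iff)
      then have "vol X \<le> 1" using copy_vol_pos[OF X(2)] by simp
      then show "x \<le> 0" using X zero[OF X(3)] that by (simp add: mass_small)
    qed
    then show ?thesis using lower[OF i] by (meson antisym)
  qed
  moreover have "near_density \<mu> \<epsilon> i s \<le> (\<Sum>e\<in>E i. vol e * near_density \<mu> \<epsilon> (type_of e) (s + ln (vol e)))"
    (is "_ \<le> ?rhs") if "\<epsilon> < s"
    unfolding near_density_def[of _ _ i]
  proof (intro cSup_least ne)
    fix x assume "x \<in> ?D"
    then obtain k X where X: "x = mass ?f k X / vol X" "is_copy X" "type_of X = i" "ln (vol X) = s + ln \<mu>" by auto
    have rhs: "0 \<le> ?rhs"
      using rule_vol[OF i] type_of_less lower by (intro sum_nonneg mult_nonneg_nonneg) auto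
    have f0: "?f X = 0" using zero[OF X(4)] that by auto
    show "x \<le> ?rhs"
    proof (cases "vol X \<le> 1 \<or> k = 0")
      case True
      then show ?thesis using f0 rhs X by (auto simp: mass_small)
    next
      case False
      then obtain k' where k': "k = Suc k'" by (metis not0_implies_Suc)
      let ?g = "\<lambda>x j. x * near_density \<mu> \<epsilon> j (ln x - ln \<mu>)"
      have "mass ?f k X \<le> (\<Sum>Z\<in>subst_tile \<sigma> X. mass ?f k' Z)"
        unfolding k' using False X near_vol_bounds by (intro mass_Suc_le) auto
      also have "\<dots> \<le> (\<Sum>Z\<in>subst_tile \<sigma> X. ?g (vol Z) (type_of Z))"
        using subst_tile_facts(3)[OF X(2)] by (intro sum_mono near_density_upper)
      also have "\<dots> = (\<Sum>Y\<in>E i. ?g (vol X * vol Y) (type_of Y))"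
        using sum_subst_tile[OF X(2), of ?g] X(3) by simp
      also have "\<dots> = (\<Sum>Y\<in>E i. vol X * (vol Y * near_density \<mu> \<epsilon> (type_of Y) (s + ln (vol Y))))"
      proof (rule sum.cong[OF refl])
        fix Y assume "Y \<in> E i"
        then have "0 < vol Y" using rule_vol(1)[OF i] by blast
        then have "ln (vol X * vol Y) - ln \<mu> = s + ln (vol Y)"
          using copy_vol_pos[OF X(2)] X(4) by (simp add: ln_mult)
        then show "?g (vol X * vol Y) (type_of Y) = vol X * (vol Y * near_density \<mu> \<epsilon> (type_of Y) (s + ln (vol Y)))"
          by simp
      qed
      also have "\<dots> = vol X * ?rhs" by (simp add: sum_distrib_left)
      finally show ?thesis using copy_vol_pos[OF X(2)] X(1) by (simp add: divide_le_eq mult.commute)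
    qed
  qed
  ultimately show "0 \<le> near_density \<mu> \<epsilon> i s \<and> near_density \<mu> \<epsilon> i s \<le> 1 \<and>
       (s < - \<epsilon> \<longrightarrow> near_density \<mu> \<epsilon> i s = 0) \<and> (\<epsilon> < s \<longrightarrow> near_density \<mu> \<epsilon> i s \<le> ?rhs)"
    using lower[OF i] by blast
qed

text \<open>The threshold \<open>V\<close> comes from the level at which hitting bounds have become small. Since \<open>ln \<mu> \<le> 0\<close>, a
tile of volume at least \<open>V\<close> lies above that level for all \<open>\<mu>\<close> at once.\<close>

lemma near_mass_vanishes:
  assumes "irreducible_scheme \<sigma>" "incommensurable \<sigma>" "0 < \<eta>"
  obtains \<epsilon> V where "0 < \<epsilon>" "1 \<le> V"
    "\<forall>\<mu> k X. 0 < \<mu> \<longrightarrow> \<mu> \<le> 1 \<longrightarrow> is_copy X \<longrightarrow> V \<le> vol X \<longrightarrow> mass (near_vol \<mu> \<epsilon>) k X \<le> \<eta> * vol X"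
proof -
  obtain \<epsilon> S where eS: "0 < \<epsilon>" "\<forall>v i s. renewal.hitting_bound \<epsilon> v \<longrightarrow> i < n \<longrightarrow> S \<le> s \<longrightarrow> v i s \<le> \<eta>"
    using scheme_hitting_bound_vanishes[OF assms] by blast
  have "mass (near_vol \<mu> \<epsilon>) k X \<le> \<eta> * vol X"
    if h: "0 < \<mu>" "\<mu> \<le> 1" "is_copy X" "max 1 (exp S) \<le> vol X" for \<mu> k X
  proof -
    have "S \<le> ln (vol X)" using h(4) by (subst ln_ge_iff) (auto intro: copy_vol_pos h)
    moreover have "ln \<mu> \<le> 0" using h by simp
    ultimately have "S \<le> ln (vol X) - ln \<mu>" by linarith
    then have "near_density \<mu> \<epsilon> (type_of X) (ln (vol X) - ln \<mu>) \<le> \<eta>"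
      using eS near_density_hitting_bound[of \<mu> \<epsilon>] h(1,2) type_of_less[OF h(3)] less_imp_le by blast
    then have "vol X * near_density \<mu> \<epsilon> (type_of X) (ln (vol X) - ln \<mu>) \<le> vol X * \<eta>"
      by (intro mult_left_mono) auto
    then show ?thesis using near_density_upper[OF h(3), of \<mu> \<epsilon> k] by (simp add: mult.commute)
  qed
  then show ?thesis using eS(1) by (intro that[of \<epsilon> "max 1 (exp S)"]) auto
qed

lemma copy_diameter:
  obtains C where "0 < C" "\<forall>X x y. is_copy X \<longrightarrow> vol X \<le> B \<longrightarrow> x \<in> X \<longrightarrow> y \<in> X \<longrightarrow> dist x y \<le> C"
proof -
  have "bounded (\<Union>i<n. T i)" using prototile by (auto simp: is_tile_def)
  then obtain D where D: "\<And>x i. i < n \<Longrightarrow> x \<in> T i \<Longrightarrow> norm x \<le> D" by (auto simp: bounded_iff)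
  have D0: "0 \<le> D" using prototile(1)[OF types] D[OF types]
    by (metis (mono_tags, lifting) ex_in_conv is_tile_def less_irrefl measure_empty norm_ge_zero order_trans)
  define r where "r = max 1 B"
  have "dist x y \<le> r * (2 * D) + 1" if X: "is_copy X" "vol X \<le> B" "x \<in> X" "y \<in> X" for X x y
  proof -
    obtain i \<alpha> v where c: "i < n" "\<alpha> > 0" "X = copy i \<alpha> v" using X(1) by (rule is_copyE)
    obtain x' y' where xy: "x' \<in> T i" "x = \<alpha> *\<^sub>R x' + v" "y' \<in> T i" "y = \<alpha> *\<^sub>R y' + v"
      using X(3,4) unfolding c(3) copy_def similar_image by blast
    have "\<alpha> \<le> r"
    proof (cases "\<alpha> \<le> 1")
      case False
      then have "\<alpha> ^ 1 \<le> \<alpha> ^ DIM('a)" by (intro power_increasing) auto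
      then show ?thesis using X(2) c by (simp add: vol_copy r_def)
    qed (simp add: r_def)
    have "dist x y = \<alpha> * norm (x' - y')" using c(2) by (simp add: xy dist_norm flip: scaleR_diff_right)
    also have "\<dots> \<le> r * (2 * D)"
      using \<open>\<alpha> \<le> r\<close> c D[OF c(1) xy(1)] D[OF c(1) xy(3)] norm_triangle_ineq4[of x' y']
      by (intro mult_mono) (auto simp: r_def)
    finally show ?thesis by simp
  qed
  moreover have "0 < r * (2 * D) + 1" using D0 by (simp add: r_def add_nonneg_pos)
  ultimately show ?thesis by (intro that[of "r * (2 * D) + 1"]) auto
qed

definition near_vol_in :: "'a set \<Rightarrow> real \<Rightarrow> real \<Rightarrow> 'a set \<Rightarrow> real" where
  "near_vol_in R \<mu> \<epsilon> Y = (if Y \<inter> R = {} then 0 else near_vol \<mu> \<epsilon> Y)"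

lemma near_vol_in_bounds: "0 \<le> near_vol_in R \<mu> \<epsilon> Y" "near_vol_in R \<mu> \<epsilon> Y \<le> vol Y"
   "near_vol_in R \<mu> \<epsilon> Y \<le> near_vol \<mu> \<epsilon> Y"
  using near_vol_bounds[of \<mu> \<epsilon> Y] by (auto simp: near_vol_in_def)

text \<open>The same share, localized to a region \<open>R\<close>. Stop subdividing \<open>X\<close> as soon as the volume is at most
\<open>V / q\<close>; it is then still at least \<open>V\<close>, so the preceding estimate applies to the pieces. The pieces
have diameter at most \<open>C\<close>, hence those that meet \<open>R\<close> lie in the \<open>C\<close>-neighbourhood of \<open>R\<close>, and
their volumes add up.\<close>

lemma local_near_mass:
  assumes eta: "0 \<le> \<eta>" and V: "1 \<le> V"
    and small: "\<And>k X. is_copy X \<Longrightarrow> V \<le> vol X \<Longrightarrow> mass (near_vol \<mu> \<epsilon>) k X \<le> \<eta> * vol X"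
    and q: "0 < q" "\<forall>i<n. \<forall>Y\<in>E i. q \<le> vol Y"
    and C: "\<forall>X x y. is_copy X \<longrightarrow> vol X \<le> V / q \<longrightarrow> x \<in> X \<longrightarrow> y \<in> X \<longrightarrow> dist x y \<le> C"
    and X: "is_copy X" "V \<le> vol X"
  shows "mass (near_vol_in R \<mu> \<epsilon>) k X \<le> \<eta> * vol (X \<inter> thicken C R)"
  using X
proof (induction k arbitrary: X rule: less_induct)
  case (less k)
  let ?f = "near_vol_in R \<mu> \<epsilon>"
  show ?case
  proof (cases "vol X \<le> V / q")
    case True
    \<comment> \<open>The subdivision has reached a piece of bounded diameter.\<close>
    show ?thesis
    proof (cases "X \<inter> R = {}")
      case True
      then have "?f Y = 0" if "Y \<in> descendants \<sigma> k X" for Y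
        using descendants_subset[OF that less.prems(1)] by (auto simp: near_vol_in_def)
      then show ?thesis using eta by (simp add: mass_def)
    next
      case False
      then obtain y where y: "y \<in> X" "y \<in> R" by auto
      have "X \<subseteq> thicken C R"
      proof
        fix x assume x: "x \<in> X"
        have "infdist x R \<le> dist x y" using y(2) by (rule infdist_le)
        also have "\<dots> \<le> C" using C less.prems(1) True x y by blast
        finally show "x \<in> thicken C R" using y by (auto simp: thicken_def)
      qed
      then have "X \<inter> thicken C R = X" by blast
      moreover have "mass ?f k X \<le> mass (near_vol \<mu> \<epsilon>) k X"
        unfolding mass_def by (intro sum_mono near_vol_in_bounds)
      ultimately show ?thesis using small[OF less.prems, of k] by simp
    qed
  next
    case False
    have q1: "q \<le> 1"
    proof -
      obtain Y where "Y \<in> E 0" using rule_vol_sum[OF types] by fastforce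
      then show ?thesis using q(2) types rule_vol(2)[OF types] by fastforce
    qed
    have "V * q \<le> V * 1" using q1 V by (intro mult_left_mono) auto
    then have "V \<le> V / q" using q by (simp add: le_divide_eq)
    then have big: "1 < vol X" using False V by linarith
    show ?thesis
    proof (cases k)
      case 0
      then show ?thesis using big eta by (simp add: near_vol_in_def near_vol_def near_def)
    next
      case (Suc k')
      have "mass ?f k X \<le> (\<Sum>Z\<in>subst_tile \<sigma> X. mass ?f k' Z)"
        unfolding Suc using big less.prems near_vol_in_bounds by (intro mass_Suc_le) auto
      also have "\<dots> \<le> (\<Sum>Z\<in>subst_tile \<sigma> X. \<eta> * vol (Z \<inter> thicken C R))"
      proof (rule sum_mono)
        fix Z assume Z: "Z \<in> subst_tile \<sigma> X"
        obtain W where W: "W \<in> E (type_of X)" "type_of Z = type_of W" "vol Z = vol X * vol W"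
          by (rule child_vol[OF less.prems(1) Z])
        have "V < vol X * q" using False q by (simp add: field_simps)
        also have "\<dots> \<le> vol X * vol W"
          using q W type_of_less[OF less.prems(1)] by (intro mult_left_mono) auto
        finally have "V \<le> vol Z" using W by simp
        then show "mass ?f k' Z \<le> \<eta> * vol (Z \<inter> thicken C R)"
          using less.IH[of k' Z] Suc subst_tile_facts(3)[OF less.prems(1) Z] by simp
      qed
      also have "\<dots> = \<eta> * (\<Sum>Z\<in>subst_tile \<sigma> X. vol (Z \<inter> thicken C R))" by (simp add: sum_distrib_left)
      also have "\<dots> = \<eta> * vol (X \<inter> thicken C R)"
      proof -
        have "thicken C R \<in> sets lebesgue" by (intro sets_completionI_sets) (simp add: borel_closed closed_thicken)
        then show ?thesis
          using measure_tessellation_Int subst_tile_facts[OF less.prems(1)] by metis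
      qed
      finally show ?thesis .
    qed
  qed
qed

lemma generated_patch_tile:
  assumes "P \<in> generating_patches \<sigma>" "Y \<in> P"
  shows "is_copy Y" "vol Y \<le> 1"
    "0 < q \<Longrightarrow> q \<le> 1 \<Longrightarrow> \<forall>i<n. \<forall>Y\<in>E i. q \<le> vol Y \<Longrightarrow> q \<le> vol Y"
proof -
  obtain t i where P: "P = flow \<sigma> t i" "0 \<le> t" "i < n" using assms by (auto simp: generating_patches_def)
  obtain k where k: "flow \<sigma> t i = descendants \<sigma> k (copy i (exp t) 0)" "\<And>Y. Y \<in> flow \<sigma> t i \<Longrightarrow> vol Y \<le> 1"
    using flow_descendants[OF P(3)] by metis
  let ?X = "copy i (exp t) 0"
  have X: "is_copy ?X" "1 \<le> vol ?X" using P by (auto simp: is_copy_copy vol_copy)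
  have Y: "Y \<in> descendants \<sigma> k ?X" using assms P k by simp
  show "is_copy Y" using descendants_is_copy[OF Y X(1)] .
  show "vol Y \<le> 1" using assms P k by simp
  show "q \<le> vol Y" if "0 < q" "q \<le> 1" "\<forall>i<n. \<forall>Y\<in>E i. q \<le> vol Y"
    using that X by (intro descendants_vol_ge[OF _ Y X(1)]) auto
qed

text \<open>A tile counted here has volume at least \<open>\<mu> * exp (- 1)\<close> once \<open>\<epsilon> \<le> 1\<close>, which turns the
volume estimate into a count. The constant \<open>V\<close> covers the generated patches of total volume less than \<open>V\<close>.\<close>

proposition generated_patch_count:
  assumes "irreducible_scheme \<sigma>" "incommensurable \<sigma>" "0 < \<eta>"
  obtains \<epsilon> V C where "0 < \<epsilon>" "0 < C"
    "\<forall>\<mu> R P. 0 < \<mu> \<longrightarrow> \<mu> \<le> 1 \<longrightarrow> bounded R \<longrightarrow> P \<in> generating_patches \<sigma> \<longrightarrow>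
       finite P \<and> \<mu> * exp (- 1) * real (card {Y \<in> P. \<bar>ln (vol Y) - ln \<mu>\<bar> \<le> \<epsilon> \<and> Y \<inter> R \<noteq> {}})
         \<le> \<eta> * vol (thicken C R) + V"
proof -
  obtain \<epsilon>0 V where eV: "0 < \<epsilon>0" "1 \<le> V"
    "\<forall>\<mu> k X. 0 < \<mu> \<longrightarrow> \<mu> \<le> 1 \<longrightarrow> is_copy X \<longrightarrow> V \<le> vol X \<longrightarrow> mass (near_vol \<mu> \<epsilon>0) k X \<le> \<eta> * vol X"
    by (rule near_mass_vanishes[OF assms])
  obtain q Q where q: "0 < q" "Q < 1" "0 \<le> Q" "\<forall>i<n. \<forall>Y\<in>E i. q \<le> vol Y \<and> vol Y \<le> Q"
    by (rule rule_vol_bounds)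
  obtain C where C: "0 < C"
    "\<forall>X x y. is_copy X \<longrightarrow> vol X \<le> V / q \<longrightarrow> x \<in> X \<longrightarrow> y \<in> X \<longrightarrow> dist x y \<le> C"
    by (rule copy_diameter)
  have main: "finite P \<and> \<mu> * exp (- 1) * real (card {Y \<in> P. \<bar>ln (vol Y) - ln \<mu>\<bar> \<le> min \<epsilon>0 1 \<and> Y \<inter> R \<noteq> {}})
         \<le> \<eta> * vol (thicken C R) + V"
    if h: "0 < \<mu>" "\<mu> \<le> 1" "bounded R" "P \<in> generating_patches \<sigma>" for \<mu> R P
  proof -
    obtain t i where P: "P = flow \<sigma> t i" "0 \<le> t" "i < n" using h(4) by (auto simp: generating_patches_def)
    obtain k where k: "flow \<sigma> t i = descendants \<sigma> k (copy i (exp t) 0)" "\<And>Y. Y \<in> flow \<sigma> t i \<Longrightarrow> vol Y \<le> 1"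
      using flow_descendants[OF P(3)] by metis
    let ?X = "copy i (exp t) 0"
    have X: "is_copy ?X" using P by (simp add: is_copy_copy)
    have fin: "finite P" using finite_descendants[OF X] P k by simp
    let ?N = "{Y \<in> P. \<bar>ln (vol Y) - ln \<mu>\<bar> \<le> min \<epsilon>0 1 \<and> Y \<inter> R \<noteq> {}}"
    have "\<mu> * exp (- 1) * real (card ?N) = (\<Sum>Y\<in>?N. \<mu> * exp (- 1))" by simp
    also have "\<dots> \<le> (\<Sum>Y\<in>?N. near_vol_in R \<mu> \<epsilon>0 Y)"
    proof (rule sum_mono)
      fix Y assume Y: "Y \<in> ?N"
      have pos: "0 < vol Y" using generated_patch_tile[OF h(4)] Y copy_vol_pos by blast
      have "ln (\<mu> * exp (- 1)) \<le> ln (vol Y)" using Y h by (auto simp: ln_mult)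
      then have "\<mu> * exp (- 1) \<le> vol Y" using pos h by (subst (asm) ln_le_cancel_iff) auto
      moreover have "near \<mu> \<epsilon>0 Y" using Y generated_patch_tile(2)[OF h(4)] by (auto simp: near_def)
      ultimately show "\<mu> * exp (- 1) \<le> near_vol_in R \<mu> \<epsilon>0 Y" using Y by (auto simp: near_vol_in_def near_vol_def)
    qed
    also have "\<dots> \<le> mass (near_vol_in R \<mu> \<epsilon>0) k ?X"
      unfolding mass_def using k P near_vol_in_bounds(1) finite_descendants[OF X] by (intro sum_mono2) auto
    also have "\<dots> \<le> \<eta> * vol (thicken C R) + V"
    proof (cases "V \<le> vol ?X")
      case True
      have "mass (near_vol_in R \<mu> \<epsilon>0) k ?X \<le> \<eta> * vol (?X \<inter> thicken C R)"
        using eV q C h assms(3) X True by (intro local_near_mass[of \<eta> V \<mu> \<epsilon>0 q C]) auto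
      also have "\<dots> \<le> \<eta> * vol (thicken C R)"
        using assms(3) lmeasurable_thicken[OF h(3), of C] tile_lmeasurable[OF is_copy_is_tile[OF X]]
        by (intro mult_left_mono measure_mono_fmeasurable) (auto intro: fmeasurableD)
      finally show ?thesis using eV(2) by linarith
    next
      case False
      have "mass (near_vol_in R \<mu> \<epsilon>0) k ?X \<le> vol ?X"
        using near_vol_in_bounds X by (intro mass_le_vol) auto
      moreover have "0 \<le> \<eta> * vol (thicken C R)" using assms(3) by simp
      ultimately show ?thesis using False by linarith
    qed
    finally show ?thesis using fin by blast
  qed
  show ?thesis by (rule that[of "min \<epsilon>0 1" C V]) (use eV C main in auto)
qed

end

section \<open>Copies enclosed by a given boundary\<close>

context multiscale_scheme
begin

text \<open>A prototile has no lower-dimensional parts sticking out of the closure of its interior. If all points of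
prototiles are within \<open>d\<close> of the interior of their prototile, then the points of a subtile of scale
\<open>\<beta>\<close> are within \<open>\<beta> * d\<close> of the interior of the subtile, which is contained in the interior of the
prototile. The scales are bounded by some \<open>b < 1\<close>, so \<open>d\<close> may be replaced by \<open>b * d\<close>, and iterating
gives distance \<open>0\<close>.\<close>

lemma prototile_in_closure_interior:
  assumes "i < n" shows "T i \<subseteq> closure (interior (T i))"
proof -
  obtain q Q where Q: "0 < q" "Q < 1" "0 \<le> Q" "\<forall>i<n. \<forall>Y\<in>E i. q \<le> vol Y \<and> vol Y \<le> Q"
    by (rule rule_vol_bounds)
  define b where "b = root DIM('a) Q"
  have b: "0 \<le> b" "b < 1" using Q by (auto simp: b_def)
  obtain D where D: "0 < D" "\<forall>X x y. is_copy X \<longrightarrow> vol X \<le> 1 \<longrightarrow> x \<in> X \<longrightarrow> y \<in> X \<longrightarrow> dist x y \<le> D"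
    by (rule copy_diameter)
  have T_copy: "T i = copy i 1 0" for i by (simp add: copy_def)
  have key: "\<exists>a\<in>interior (T i). dist x a \<le> b ^ k * D" if "i < n" "x \<in> T i" for k i x
    using that
  proof (induction k arbitrary: i x)
    case 0
    have "0 \<in> interior (T i)" using origin 0 by (simp add: origin_positioned_def)
    moreover from this have "0 \<in> T i" using interior_subset by blast
    moreover have "is_copy (T i)" "vol (T i) \<le> 1" using 0 is_copy_copy[of i 1 0] prototile by (auto simp flip: T_copy)
    ultimately show ?case using D(2) 0 by auto
  next
    case (Suc k)
    obtain Y where Y: "Y \<in> E i" "x \<in> Y" using rule_tessellation[OF Suc.prems(1)] Suc.prems(2)
      by (auto simp: tessellation_def)
    obtain j \<beta> w where c: "j < n" "0 < \<beta>" "\<beta> < 1" "Y = copy j \<beta> w" "Y \<subseteq> T i"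
      by (rule rule_edge[OF Suc.prems(1) Y(1)])
    obtain x' where x': "x' \<in> T j" "x = \<beta> *\<^sub>R x' + w" using Y(2) by (auto simp: c(4) copy_def similar_image)
    obtain a where a: "a \<in> interior (T j)" "dist x' a \<le> b ^ k * D" using Suc.IH[OF c(1) x'(1)] by blast
    have "vol Y \<le> Q" using Q(4) Suc.prems(1) Y(1) by blast
    then have "\<beta> ^ DIM('a) \<le> Q" using vol_copy[OF c(1,2)] c(4) by simp
    then have "root DIM('a) (\<beta> ^ DIM('a)) \<le> b" unfolding b_def by simp
    then have "\<beta> \<le> b" using c(2) by (simp add: real_root_power_cancel)
    have "\<beta> *\<^sub>R a + w \<in> interior Y"
      unfolding c(4) copy_def interior_similar[OF c(2)] using a(1) by (auto simp: similar_image)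
    then have "\<beta> *\<^sub>R a + w \<in> interior (T i)" using interior_mono[OF c(5)] by blast
    moreover have "dist x (\<beta> *\<^sub>R a + w) = \<beta> * dist x' a"
      using c(2) by (simp add: x'(2) dist_norm flip: scaleR_diff_right)
    moreover have "\<beta> * dist x' a \<le> b * (b ^ k * D)" using \<open>\<beta> \<le> b\<close> a(2) b by (intro mult_mono) auto
    ultimately show ?case by (intro bexI[of _ "\<beta> *\<^sub>R a + w"]) (simp_all add: mult.assoc)
  qed
  show ?thesis
  proof
    fix x assume x: "x \<in> T i"
    show "x \<in> closure (interior (T i))"
      unfolding closure_approachable
    proof (intro allI impI)
      fix e :: real assume "0 < e"
      have "(\<lambda>k. b ^ k * D) \<longlonglongrightarrow> 0 * D" using b by (intro tendsto_intros LIMSEQ_power_zero) auto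
      then have "eventually (\<lambda>k. b ^ k * D < e) sequentially" using \<open>0 < e\<close> by (simp add: order_tendstoD)
      then obtain k where "b ^ k * D < e" using eventually_happens'[OF sequentially_bot] by blast
      then show "\<exists>y\<in>interior (T i). dist y x < e" using key[OF assms x, of k] by (metis dist_commute le_less_trans)
    qed
  qed
qed

lemma copy_in_closure_interior: "is_copy Y \<Longrightarrow> Y \<subseteq> closure (interior Y)"
proof -
  assume "is_copy Y"
  then obtain i \<alpha> v where c: "i < n" "\<alpha> > 0" "Y = copy i \<alpha> v" by (rule is_copyE)
  show ?thesis unfolding c(3) copy_def interior_similar[OF c(2)] closure_similar[OF c(2)]
    by (rule similar_mono[OF prototile_in_closure_interior[OF c(1)]])
qed

text \<open>So boundaries never cut through the tiles of their own patch, and the interior of each tile remains visible as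
a hole in the boundary set of the patch.\<close>

lemma frontier_disjoint_interior:
  assumes "is_copy Y" "interior X \<inter> interior Y = {}"
  shows "interior X \<inter> frontier Y = {}"
proof -
  have "interior X \<inter> closure (interior Y) = {}" using assms(2) open_interior by (simp add: open_Int_closure_eq_empty)
  moreover have "frontier Y \<subseteq> closure (interior Y)"
    using copy_in_closure_interior[OF assms(1)] closure_minimal[of Y "closure (interior Y)"] by (auto simp: frontier_def)
  ultimately show ?thesis by blast
qed

text \<open>The volumes of copies \<open>Z\<close> that fill holes of \<open>F\<close>: the boundary of \<open>Z\<close> is contained in \<open>F\<close>, which does
not enter \<open>Z\<close>.\<close>

definition filling_vols :: "real \<Rightarrow> 'a set \<Rightarrow> real set" where
  "filling_vols q F = {vol Z | Z. is_copy Z \<and> q \<le> vol Z \<and> vol Z \<le> 1 \<and> frontier Z \<subseteq> F \<and> interior Z \<inter> F = {}}"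

definition central_component :: "nat \<Rightarrow> 'a set" where
  "central_component j = connected_component_set (interior (T j)) 0"

lemma central_component:
  assumes "j < n"
  shows "0 \<in> central_component j" "central_component j \<subseteq> interior (T j)" "open (central_component j)" "connected (central_component j)" "central_component j \<in> lmeasurable" "0 < vol (central_component j)"
proof -
  have "0 \<in> interior (T j)" using origin assms by (simp add: origin_positioned_def)
  then show 0: "0 \<in> central_component j" by (simp add: central_component_def)
  show sub: "central_component j \<subseteq> interior (T j)" by (simp add: central_component_def connected_component_subset)
  show op: "open (central_component j)" by (simp add: central_component_def open_connected_component)
  show "connected (central_component j)" by (simp add: central_component_def)
  have "bounded (T j)" using prototile(1)[OF assms] by (simp add: is_tile_def)
  then have "bounded (central_component j)" using sub interior_subset by (meson bounded_subset)
  then show lm: "central_component j \<in> lmeasurable" using op by (simp add: lmeasurable_open)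
  have "\<not> negligible (central_component j)" using open_not_negligible[OF op] 0 by blast
  then show "0 < vol (central_component j)" using lm by (metis measure_nonneg negligible_iff_measure order_less_le)
qed

text \<open>The interior of \<open>Z\<close> is open and closed in the complement of \<open>F\<close>, so its connected components are
components of the complement of \<open>F\<close>.\<close>

lemma copy_component:
  assumes j: "j < n" "\<alpha> > 0" and Z: "frontier (copy j \<alpha> v) \<subseteq> F" "interior (copy j \<alpha> v) \<inter> F = {}"
  shows "translate v (rescale \<alpha> (central_component j)) \<in> components (- F)"
  unfolding in_components_maximal
proof (intro conjI allI impI)
  let ?K = "translate v (rescale \<alpha> (central_component j))" and ?Z = "copy j \<alpha> v"
  have vK: "v \<in> ?K" using central_component(1)[OF j(1)] j(2) by (simp add: mem_similar_iff)
  have KZ: "?K \<subseteq> interior ?Z"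
    unfolding copy_def interior_similar[OF j(2)] by (rule similar_mono[OF central_component(2)[OF j(1)]])
  show "?K \<noteq> {}" using vK by blast
  show "?K \<subseteq> - F" using KZ Z(2) by blast
  show "connected ?K" unfolding similar_image
    by (intro connected_continuous_image central_component(4)[OF j(1)] continuous_intros)
  fix d assume "d \<noteq> {} \<and> ?K \<subseteq> d \<and> d \<subseteq> - F \<and> connected d"
  then have d: "?K \<subseteq> d" "d \<subseteq> - F" "connected d" by auto
  have dfr: "d \<inter> frontier ?Z = {}" using d(2) Z(1) by blast
  have "d \<inter> ?Z \<noteq> {}" using vK d(1) KZ interior_subset[of ?Z] by blast
  then have "d \<subseteq> ?Z" using connected_Int_frontier[OF d(3), of ?Z] dfr by blast
  then have dZ: "d \<subseteq> interior ?Z" using dfr closure_subset[of ?Z] by (auto simp: frontier_def)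
  let ?d' = "(\<lambda>x. (1 / \<alpha>) *\<^sub>R (x - v)) ` d"
  have "connected ?d'" by (intro connected_continuous_image d(3) continuous_intros)
  moreover have "?d' \<subseteq> interior (T j)"
    using dZ unfolding copy_def interior_similar[OF j(2)] by (auto simp: mem_similar_iff[OF j(2)])
  moreover have "0 \<in> ?d'" using vK d(1) by (force simp: image_iff)
  ultimately have "?d' \<subseteq> central_component j" unfolding central_component_def by (intro connected_component_maximal)
  then have "d \<subseteq> ?K" by (auto simp: mem_similar_iff[OF j(2)])
  then show "d = ?K" using d(1) by blast
qed

text \<open>Following one fixed component of \<open>interior (T j)\<close>, the copy \<open>Z\<close> contributes a component of \<open>- F\<close> of
volume \<open>vol Z * vol (central_component j)\<close>. This is bounded below, and only finitely many components of
such volume fit into a bounded region. So the volume of a component and the type \<open>j\<close>, which take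
finitely many values, determine \<open>vol Z\<close>. Fixing one component is what provides the lower bound, as
\<open>interior (T j)\<close> may have components of arbitrarily small volume.\<close>

lemma finite_filling_vols:
  assumes "bounded F" "0 < q"
  shows "finite (filling_vols q F)"
proof -
  obtain B where B: "\<And>x. x \<in> F \<Longrightarrow> norm x \<le> B" using assms(1) by (auto simp: bounded_iff)
  obtain C where C: "0 < C" "\<forall>X x y. is_copy X \<longrightarrow> vol X \<le> 1 \<longrightarrow> x \<in> X \<longrightarrow> y \<in> X \<longrightarrow> dist x y \<le> C"
    by (rule copy_diameter)
  define \<gamma> where "\<gamma> = Min ((\<lambda>j. vol (central_component j)) ` {..<n})"
  have "\<gamma> \<in> (\<lambda>j. vol (central_component j)) ` {..<n}" unfolding \<gamma>_def using types by (intro Min_in) auto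
  then have \<gamma>: "0 < \<gamma>" using central_component(6) by auto
  have \<gamma>_le: "\<gamma> \<le> vol (central_component j)" if "j < n" for j using that by (auto simp: \<gamma>_def)
  let ?A = "cball 0 (B + C + 1) :: 'a set"
  let ?\<K> = "{K \<in> components (- F). K \<in> lmeasurable \<and> K \<subseteq> ?A \<and> q * \<gamma> \<le> vol K}"
  have fin: "finite ?\<K>"
  proof (rule finite_packing)
    show "?A \<in> lmeasurable" by simp
    show "0 < q * \<gamma>" using assms \<gamma> by simp
    show "K \<inter> L = {}" if "K \<in> ?\<K>" "L \<in> ?\<K>" "K \<noteq> L" for K L
      using that components_nonoverlap[of K "- F" L] by blast
  qed auto
  have "filling_vols q F \<subseteq> (\<lambda>(K, j). vol K / vol (central_component j)) ` (?\<K> \<times> {..<n})"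
  proof
    fix x assume "x \<in> filling_vols q F"
    then obtain Z where Z: "x = vol Z" "is_copy Z" "q \<le> vol Z" "vol Z \<le> 1" "frontier Z \<subseteq> F" "interior Z \<inter> F = {}"
      by (auto simp: filling_vols_def)
    obtain j \<alpha> v where c: "j < n" "\<alpha> > 0" "Z = copy j \<alpha> v" using Z(2) by (rule is_copyE)
    let ?K = "translate v (rescale \<alpha> (central_component j))"
    have comp: "?K \<in> components (- F)" using Z c by (intro copy_component) auto
    have KZ: "?K \<subseteq> Z"
      unfolding c(3) copy_def using central_component(2)[OF c(1)] interior_subset by (intro similar_mono) blast
    have volK: "vol ?K = vol Z * vol (central_component j)"
      using c by (simp add: measure_similar vol_copy)
    have bZ: "bounded Z" "Z \<noteq> {}" using is_copy_is_tile[OF Z(2)] by (auto simp: is_tile_def)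
    have "frontier Z \<noteq> {}" using bZ by (metis frontier_not_empty not_bounded_UNIV)
    then obtain f where f: "f \<in> frontier Z" by blast
    then obtain z0 where z0: "z0 \<in> Z" "dist z0 f < 1"
      unfolding frontier_def by (metis DiffD1 closure_approachable zero_less_one)
    have "Z \<subseteq> ?A"
    proof
      fix z assume "z \<in> Z"
      then have "dist z z0 \<le> C" using C Z z0 by blast
      moreover have "norm f \<le> B" using f Z B by blast
      moreover have "norm z \<le> dist z z0 + dist z0 f + norm f"
        using norm_triangle_sub[of z f] dist_triangle[of z f z0] by (simp add: dist_norm)
      ultimately show "z \<in> ?A" using z0 by simp
    qed
    moreover have "?K \<in> lmeasurable"
    proof -
      have "open ?K" using central_component(3)[OF c(1)] interior_similar[OF c(2), of v "central_component j"] interior_open[of "central_component j"]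
        by (metis open_interior)
      then show ?thesis using bounded_subset[OF bZ(1) KZ] by (simp add: lmeasurable_open)
    qed
    moreover have "q * \<gamma> \<le> vol ?K" unfolding volK using Z(3) \<gamma> \<gamma>_le[OF c(1)] assms(2) by (intro mult_mono) auto
    ultimately have "?K \<in> ?\<K>" using comp KZ by blast
    moreover have "x = vol ?K / vol (central_component j)" using central_component(6)[OF c(1)] by (simp add: volK Z(1))
    ultimately show "x \<in> (\<lambda>(K, j). vol K / vol (central_component j)) ` (?\<K> \<times> {..<n})"
      using c(1) by (intro image_eqI[of _ _ "(?K, j)"]) simp_all
  qed
  then show ?thesis using fin by (meson finite_SigmaI finite_imageI finite_lessThan finite_subset)
qed

lemma filling_vols_translate: "filling_vols q (translate g F) = filling_vols q F"
proof -
  have sub: "filling_vols q F \<subseteq> filling_vols q (translate g F)" for g F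
  proof
    fix x assume "x \<in> filling_vols q F"
    then obtain Z where Z: "x = vol Z" "is_copy Z" "q \<le> vol Z" "vol Z \<le> 1" "frontier Z \<subseteq> F" "interior Z \<inter> F = {}"
      by (auto simp: filling_vols_def)
    have "is_copy (translate g Z)" "vol (translate g Z) = vol Z" using translate_copy[OF Z(2)] .
    moreover have "frontier (translate g Z) \<subseteq> translate g F"
      using Z(5) frontier_similar[of 1 g Z] by (auto simp: rescale_def translate_def)
    moreover have "interior (translate g Z) \<inter> translate g F = {}"
      using Z(6) by (auto simp: translate_def interior_translation)
    ultimately show "x \<in> filling_vols q (translate g F)"
      using Z(1,3,4) unfolding filling_vols_def mem_Collect_eq by (intro exI[of _ "translate g Z"]) simp
  qed
  have "translate (- g) (translate g F) = F" by (simp add: translate_def image_image)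
  then show ?thesis using sub[of F g] sub[of "translate g F" "- g"] by auto
qed

end

section \<open>Limits of boundary sets\<close>

text \<open>The radii admitted in \<^const>\<open>set_metric\<close> form an upward closed set, so the infimum may be replaced by any
larger radius.\<close>

lemma set_metric_lessD:
  assumes "set_metric A B < r" "r \<le> 1"
  shows "0 < r" "A \<inter> ball 0 (1 / r) \<subseteq> thicken r B" "B \<inter> ball 0 (1 / r) \<subseteq> thicken r A"
proof -
  let ?S = "{r. r > 0 \<and> A \<inter> ball 0 (1 / r) \<subseteq> thicken r B \<and> B \<inter> ball 0 (1 / r) \<subseteq> thicken r A} \<union> {1}"
  have "bdd_below ?S" by (intro bdd_belowI[of _ 0]) auto
  then obtain s where s: "s \<in> ?S" "s < r"
    using assms(1) unfolding set_metric_def by (subst (asm) cInf_less_iff) auto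
  then have s': "s > 0" "A \<inter> ball 0 (1 / s) \<subseteq> thicken s B" "B \<inter> ball 0 (1 / s) \<subseteq> thicken s A"
    using assms(2) by auto
  then show "0 < r" using s(2) by linarith
  have "ball 0 (1 / r) \<subseteq> (ball 0 (1 / s) :: 'a set)" using s s' by (intro subset_ball) (auto simp: frac_le)
  moreover have "thicken s U \<subseteq> thicken r U" for U :: "'a set" using s(2) by (auto simp: thicken_def)
  ultimately show "A \<inter> ball 0 (1 / r) \<subseteq> thicken r B" "B \<inter> ball 0 (1 / r) \<subseteq> thicken r A" using s' by blast+
qed

lemma set_metric_limit_mem:
  fixes b :: "nat \<Rightarrow> 'a::euclidean_space set"
  assumes lim: "(\<lambda>k. set_metric (b k) B) \<longlonglongrightarrow> 0" and "closed B"
    and z: "\<And>k. z k \<in> b k" "z \<longlonglongrightarrow> x"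
  shows "x \<in> B"
proof -
  have bound: "B \<noteq> {} \<and> infdist x B \<le> r" if r: "0 < r" "r < 1" "norm x < 1 / r" for r
  proof -
    have "eventually (\<lambda>k. set_metric (b k) B < r) sequentially" using order_tendstoD(2)[OF lim r(1)] .
    moreover have "eventually (\<lambda>k. norm (z k) < 1 / r) sequentially"
      using order_tendstoD(2)[OF tendsto_norm[OF z(2)] r(3)] .
    ultimately have ev: "eventually (\<lambda>k. z k \<in> thicken r B) sequentially"
    proof eventually_elim
      case (elim k)
      then show ?case using set_metric_lessD(2)[of "b k" B r] r z(1)[of k] by (auto simp: subset_iff)
    qed
    then have "B \<noteq> {}" using eventually_happens'[OF sequentially_bot ev] by (auto simp: thicken_def)
    moreover have "infdist x B \<le> r"
    proof (rule tendsto_upperbound)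
      show "(\<lambda>k. infdist (z k) B) \<longlonglongrightarrow> infdist x B" by (intro tendsto_infdist z)
      show "eventually (\<lambda>k. infdist (z k) B \<le> r) sequentially" using ev by eventually_elim (simp add: thicken_def)
    qed simp
    ultimately show ?thesis by blast
  qed
  have ex: "\<exists>r. 0 < r \<and> r < 1 \<and> norm x < 1 / r \<and> r \<le> e" if "0 < e" for e :: real
  proof -
    have "norm x < 1 / (min e (1 / (norm x + 2)))"
    proof -
      have "norm x < norm x + 2" by simp
      also have "\<dots> = 1 / (1 / (norm x + 2))" by simp
      also have "\<dots> \<le> 1 / (min e (1 / (norm x + 2)))"
        using that by (intro divide_left_mono) (auto intro!: mult_pos_pos simp: add_nonneg_pos add_pos_nonneg)
      finally show ?thesis .
    qed
    moreover have "1 / (norm x + 2) < 1" by (simp add: add_nonneg_pos add_pos_nonneg)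
    ultimately show ?thesis using that
      by (intro exI[of _ "min e (1 / (norm x + 2))"]) (auto simp: min_less_iff_disj add_nonneg_pos add_pos_nonneg)
  qed
  have ne: "B \<noteq> {}" using ex[of 1] bound by auto
  have "infdist x B \<le> e" if "0 < e" for e using ex[OF that] bound by force
  then have "infdist x B \<le> 0" by (metis dense not_le)
  then have "infdist x B = 0" using infdist_nonneg[of x B] by linarith
  then show ?thesis using in_closed_iff_infdist_zero[OF assms(2) ne] by simp
qed

lemma set_metric_limit_approach:
  fixes b :: "nat \<Rightarrow> 'a::euclidean_space set"
  assumes lim: "(\<lambda>k. set_metric (b k) B) \<longlonglongrightarrow> 0" and "x \<in> B" "0 < e"
  shows "eventually (\<lambda>k. \<exists>y\<in>b k. dist x y < e) sequentially"
proof -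
  define r where "r = min (e / 2) (1 / (norm x + 2))"
  have r: "0 < r" "r < 1" "r < e" using assms(3) by (auto simp: r_def min_less_iff_disj add_nonneg_pos add_pos_nonneg)
  have "norm x < norm x + 2" by simp
  also have "\<dots> = 1 / (1 / (norm x + 2))" by simp
  also have "\<dots> \<le> 1 / r" using r(1) unfolding r_def
    by (intro divide_left_mono) (auto intro!: mult_pos_pos simp: add_nonneg_pos add_pos_nonneg)
  finally have x: "norm x < 1 / r" .
  have "eventually (\<lambda>k. set_metric (b k) B < r) sequentially" using order_tendstoD(2)[OF lim r(1)] .
  then show ?thesis
  proof eventually_elim
    case (elim k)
    then have "x \<in> thicken r (b k)" using set_metric_lessD(3)[of "b k" B r] r x assms(2) by auto
    then have "b k \<noteq> {}" "infdist x (b k) < e" using r(3) by (auto simp: thicken_def)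
    then show ?case by (auto simp: infdist_def cINF_less_iff)
  qed
qed

context multiscale_scheme
begin

text \<open>Compactness of the space of tiles: type, scale and the boundary point that \<open>y k\<close> comes from range over
a compact set, and they determine the position together with \<open>y k \<longlonglongrightarrow> p\<close>.\<close>

lemma copies_converge:
  fixes Y :: "nat \<Rightarrow> 'a set" and y :: "nat \<Rightarrow> 'a"
  assumes Y: "\<And>k. is_copy (Y k)" "\<And>k. q \<le> vol (Y k)" "\<And>k. vol (Y k) \<le> 1" and q: "0 < q" "q \<le> 1"
    and y: "\<And>k. y k \<in> frontier (Y k)" "y \<longlonglongrightarrow> p"
  obtains i \<alpha> v s a w where "i < n" "q \<le> \<alpha>" "\<alpha> \<le> 1" "p \<in> frontier (copy i \<alpha> v)" "strict_mono (s :: nat \<Rightarrow> nat)"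
    "\<And>k. Y (s k) = copy i (a k) (w k)" "\<And>k. q \<le> a k" "a \<longlonglongrightarrow> \<alpha>" "w \<longlonglongrightarrow> v"
proof -
  have "\<exists>i \<alpha> v. i < n \<and> \<alpha> > 0 \<and> Y k = copy i \<alpha> v" for k using Y(1)[of k] by (simp add: is_copy_iff)
  then obtain i a w where c: "\<And>k. i k < n" "\<And>k. a k > 0" "\<And>k. Y k = copy (i k) (a k) (w k)" by metis
  have ad: "vol (Y k) = a k ^ DIM('a)" for k using c vol_copy by simp
  have a1: "a k \<le> 1" for k
  proof (rule ccontr)
    assume "\<not> a k \<le> 1"
    then have "1 < a k ^ DIM('a)" by (intro one_less_power) auto
    then show False using Y(3)[of k] ad by simp
  qed
  have aq: "q \<le> a k" for k
  proof -
    have "a k ^ DIM('a) \<le> a k ^ 1" using a1[of k] c(2)[of k] by (intro power_decreasing) (auto simp: DIM_positive Suc_leI)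
    then show ?thesis using Y(2)[of k] ad by simp
  qed
  have "\<exists>f. f \<in> frontier (T (i k)) \<and> y k = a k *\<^sub>R f + w k" for k
  proof -
    have "y k \<in> translate (w k) (rescale (a k) (frontier (T (i k))))"
      using y(1)[of k] by (simp add: c(3) copy_def frontier_similar[OF c(2)])
    then show ?thesis unfolding similar_image by blast
  qed
  then obtain f where f: "\<And>k. f k \<in> frontier (T (i k))" "\<And>k. y k = a k *\<^sub>R f k + w k" by metis
  let ?F = "\<Union>i<n. frontier (T i)"
  have "compact (frontier (T i))" if "i < n" for i
    using prototile(1)[OF that] by (simp add: is_tile_def compact_frontier_bounded)
  then have "compact ?F" by (intro compact_UN) auto
  then have "compact ({0..real n} \<times> {q..1} \<times> ?F)" by (intro compact_Times compact_Icc)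
  moreover have "\<forall>k. (real (i k), a k, f k) \<in> {0..real n} \<times> {q..1} \<times> ?F"
  proof
    fix k
    have "f k \<in> ?F" using c(1) f(1) by blast
    then show "(real (i k), a k, f k) \<in> {0..real n} \<times> {q..1} \<times> ?F"
      using c(1)[of k] aq[of k] a1[of k] by simp
  qed
  ultimately obtain L s where L: "L \<in> {0..real n} \<times> {q..1} \<times> ?F" "strict_mono (s :: nat \<Rightarrow> nat)"
    "((\<lambda>k. (real (i k), a k, f k)) \<circ> s) \<longlonglongrightarrow> L"
    unfolding compact_def by meson
  obtain l \<alpha> g where Leq: "L = (l, \<alpha>, g)" by (cases L) auto
  have lims: "(\<lambda>k. real (i (s k))) \<longlonglongrightarrow> l" "(\<lambda>k. a (s k)) \<longlonglongrightarrow> \<alpha>" "(\<lambda>k. f (s k)) \<longlonglongrightarrow> g"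
    using tendsto_fst[OF L(3)] tendsto_fst[OF tendsto_snd[OF L(3)]] tendsto_snd[OF tendsto_snd[OF L(3)]]
    by (simp_all add: Leq o_def)
  \<comment> \<open>A convergent sequence of types is eventually constant.\<close>
  obtain N where N: "\<And>k. k \<ge> N \<Longrightarrow> dist (real (i (s k))) l < 1 / 2"
    using lims(1) unfolding lim_sequentially by (metis half_gt_zero zero_less_one)
  have const: "i (s k) = i (s N)" if "k \<ge> N" for k
  proof -
    have "\<bar>real (i (s k)) - real (i (s N))\<bar> < 1"
      using N[OF that] N[of N] unfolding dist_real_def by linarith
    then show ?thesis by linarith
  qed
  define t where "t k = s (k + N)" for k
  have t: "strict_mono t" using L(2) by (auto simp: t_def strict_mono_def)
  have it: "i (t k) = i (s N)" for k unfolding t_def by (rule const) simp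
  have tl: "(\<lambda>k. a (t k)) \<longlonglongrightarrow> \<alpha>" "(\<lambda>k. f (t k)) \<longlonglongrightarrow> g"
    unfolding t_def using LIMSEQ_ignore_initial_segment[OF lims(2), of N] LIMSEQ_ignore_initial_segment[OF lims(3), of N]
    by simp_all
  have "(\<lambda>k. y (t k) - a (t k) *\<^sub>R f (t k)) \<longlonglongrightarrow> p - \<alpha> *\<^sub>R g"
    using LIMSEQ_subseq_LIMSEQ[OF y(2) t] unfolding o_def by (intro tendsto_diff tendsto_scaleR tl)
  then have wl: "(\<lambda>k. w (t k)) \<longlonglongrightarrow> p - \<alpha> *\<^sub>R g" using f(2) by simp
  have "\<forall>k. f (t k) \<in> frontier (T (i (s N)))" using f(1) it by metis
  then have g: "g \<in> frontier (T (i (s N)))" using closed_sequentially[OF frontier_closed _ tl(2)] by blast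
  have al: "q \<le> \<alpha>" "\<alpha> \<le> 1" using L(1) Leq by auto
  have "\<alpha> > 0" using al q by linarith
  then have "p \<in> frontier (copy (i (s N)) \<alpha> (p - \<alpha> *\<^sub>R g))"
    unfolding copy_def frontier_similar[OF \<open>\<alpha> > 0\<close>] using g by (simp add: mem_similar_iff)
  moreover have "Y (t k) = copy (i (s N)) (a (t k)) (w (t k))" for k using c(3) it by metis
  ultimately show ?thesis using that[OF c(1) al _ t _ aq tl(1) wl] by blast
qed

text \<open>When boundary sets of patches converge to \<open>B\<close>, tiles with a boundary point near \<open>p\<close> accumulate at a tile
\<open>Z\<close>. Its boundary consists of limits of boundary points, so it lies in \<open>B\<close>. Conversely, a point of \<open>B\<close>
inside \<open>Z\<close> would be approached by boundary points of other tiles, which would eventually cut through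
the interior of a tile of their own patch.\<close>

lemma limit_tile:
  fixes R :: "nat \<Rightarrow> 'a set set"
  assumes R: "\<And>k Y. Y \<in> R k \<Longrightarrow> is_copy Y \<and> q \<le> vol Y \<and> vol Y \<le> 1"
    and disj: "\<And>k. pairwise (\<lambda>S T. interior S \<inter> interior T = {}) (R k)" and q: "0 < q" "q \<le> 1"
    and lim: "(\<lambda>k. set_metric (boundary_set (R k)) B) \<longlonglongrightarrow> 0" and "closed B"
    and Y: "\<And>k. Y k \<in> R k" and y: "\<And>k. y k \<in> frontier (Y k)" "y \<longlonglongrightarrow> p"
  obtains Z s where "is_copy Z" "q ^ DIM('a) \<le> vol Z" "vol Z \<le> 1" "p \<in> frontier Z" "frontier Z \<subseteq> B"
    "interior Z \<inter> B = {}" "strict_mono (s :: nat \<Rightarrow> nat)" "(\<lambda>k. vol (Y (s k))) \<longlonglongrightarrow> vol Z"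
proof -
  obtain i \<alpha> v s a w where c: "i < n" "q \<le> \<alpha>" "\<alpha> \<le> 1" "p \<in> frontier (copy i \<alpha> v)" "strict_mono (s :: nat \<Rightarrow> nat)"
    "\<And>k. Y (s k) = copy i (a k) (w k)" "\<And>k. q \<le> a k" "a \<longlonglongrightarrow> \<alpha>" "w \<longlonglongrightarrow> v"
  proof (rule copies_converge[of Y q y p])
    show "is_copy (Y k)" "q \<le> vol (Y k)" "vol (Y k) \<le> 1" for k using R Y by blast+
  qed (use q y in blast)+
  let ?Z = "copy i \<alpha> v"
  have al: "\<alpha> > 0" using c(2) q by linarith
  have ak: "a k > 0" for k using c(7)[of k] q by linarith
  have limS: "(\<lambda>k. set_metric (boundary_set (R (s k))) B) \<longlonglongrightarrow> 0"
    using LIMSEQ_subseq_LIMSEQ[OF lim c(5)] by (simp add: o_def)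
  have fr: "frontier ?Z \<subseteq> B"
  proof
    fix z assume "z \<in> frontier ?Z"
    then obtain f where f: "f \<in> frontier (T i)" "z = \<alpha> *\<^sub>R f + v"
      unfolding copy_def frontier_similar[OF al] by (auto simp: similar_image)
    let ?z = "\<lambda>k. a k *\<^sub>R f + w k"
    have "?z k \<in> frontier (Y (s k))" for k
      unfolding c(6) copy_def frontier_similar[OF ak] using f(1) by (auto simp: similar_image)
    then have "?z k \<in> boundary_set (R (s k))" for k using Y unfolding boundary_set_def by blast
    moreover have "?z \<longlonglongrightarrow> z" unfolding f(2) by (intro tendsto_intros c)
    ultimately show "z \<in> B" by (rule set_metric_limit_mem[OF limS \<open>closed B\<close>])
  qed
  have int: "interior ?Z \<inter> B = {}"
  proof (rule ccontr)
    assume "interior ?Z \<inter> B \<noteq> {}"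
    then obtain x where x: "x \<in> interior ?Z" "x \<in> B" by blast
    define u where "u = (1 / \<alpha>) *\<^sub>R (x - v)"
    have "u \<in> interior (T i)" using x(1) unfolding copy_def interior_similar[OF al] u_def
      by (simp add: mem_similar_iff[OF al])
    then obtain \<rho> where \<rho>: "0 < \<rho>" "ball u \<rho> \<subseteq> interior (T i)"
      using open_contains_ball open_interior by blast
    have "(\<lambda>k. (1 / a k) *\<^sub>R (x - w k)) \<longlonglongrightarrow> u" unfolding u_def using al by (intro tendsto_intros c) auto
    then have "eventually (\<lambda>k. dist ((1 / a k) *\<^sub>R (x - w k)) u < \<rho> / 2) sequentially"
      using \<rho>(1) by (intro tendstoD) auto
    moreover have "eventually (\<lambda>k. \<exists>y\<in>boundary_set (R (s k)). dist x y < \<rho> * q / 2) sequentially"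
      using \<rho> q by (intro set_metric_limit_approach[OF limS x(2)]) auto
    ultimately have "eventually (\<lambda>k. False) sequentially"
    proof eventually_elim
      case (elim k)
      then obtain y where y: "y \<in> boundary_set (R (s k))" "dist x y < \<rho> * q / 2" by blast
      have "dist ((1 / a k) *\<^sub>R (y - w k)) ((1 / a k) *\<^sub>R (x - w k)) = dist x y / a k"
        using ak[of k] by (simp add: dist_norm norm_minus_commute flip: scaleR_diff_right)
      \<comment> \<open>Scales are bounded below by \<open>q\<close>, so nearby points stay close after rescaling.\<close>
      also have "\<dots> \<le> dist x y / q" using c(7)[of k] q by (intro divide_left_mono) (auto intro: mult_pos_pos ak)
      also have "\<dots> < \<rho> / 2" using y(2) q by (simp add: field_simps)
      finally have "dist ((1 / a k) *\<^sub>R (y - w k)) u < \<rho>"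
        using elim(1) dist_triangle[of "(1 / a k) *\<^sub>R (y - w k)" u "(1 / a k) *\<^sub>R (x - w k)"] by linarith
      then have "(1 / a k) *\<^sub>R (y - w k) \<in> interior (T i)" using \<rho>(2) by (auto simp: dist_commute)
      then have yint: "y \<in> interior (Y (s k))"
        unfolding c(6) copy_def interior_similar[OF ak] by (simp add: mem_similar_iff[OF ak])
      obtain Y' where Y': "Y' \<in> R (s k)" "y \<in> frontier Y'" using y(1) by (auto simp: boundary_set_def)
      show False
      proof (cases "Y' = Y (s k)")
        case True
        then show False using Y'(2) yint by (simp add: frontier_def)
      next
        case False
        then have "interior (Y (s k)) \<inter> interior Y' = {}" using disj[of "s k"] Y Y'(1) by (auto simp: pairwise_def)
        then show False using frontier_disjoint_interior[of Y' "Y (s k)"] R[OF Y'(1)] Y'(2) yint by blast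
      qed
    qed
    then show False by simp
  qed
  have v: "vol ?Z = \<alpha> ^ DIM('a)" using c(1) al by (simp add: vol_copy)
  have "(\<lambda>k. a k ^ DIM('a)) \<longlonglongrightarrow> vol ?Z" unfolding v by (intro tendsto_intros c)
  then have vlim: "(\<lambda>k. vol (Y (s k))) \<longlonglongrightarrow> vol ?Z" using c(1) ak by (simp add: c(6) vol_copy)
  have vb: "q ^ DIM('a) \<le> vol ?Z" "vol ?Z \<le> 1"
    unfolding v using c(2,3) q by (auto intro: power_mono power_le_one)
  show ?thesis by (rule that[OF is_copy_copy[OF c(1) al] vb c(4) fr int c(5) vlim])
qed

text \<open>The hypothesis on \<open>F\<close> says that \<open>F\<close> is the part of \<open>B\<close> that a tile with a boundary point at \<open>p\<close> can
see. A failure along a subsequence contradicts the existence of a limit tile, whose volume is in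
\<open>filling_vols\<close>.\<close>

lemma matched_tile_eventually:
  fixes R :: "nat \<Rightarrow> 'a set set"
  assumes R: "\<And>k Y. Y \<in> R k \<Longrightarrow> is_copy Y \<and> q \<le> vol Y \<and> vol Y \<le> 1"
    and disj: "\<And>k. pairwise (\<lambda>S T. interior S \<inter> interior T = {}) (R k)" and q: "0 < q" "q \<le> 1"
    and lim: "(\<lambda>k. set_metric (boundary_set (R k)) B) \<longlonglongrightarrow> 0" and "closed B"
    and p: "p \<in> B" and F: "F \<subseteq> B" "B \<inter> cball p D \<subseteq> F"
    and D: "\<And>X x y. is_copy X \<Longrightarrow> vol X \<le> 1 \<Longrightarrow> x \<in> X \<Longrightarrow> y \<in> X \<Longrightarrow> dist x y \<le> D"
    and "0 < \<epsilon>"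
  shows "eventually (\<lambda>k. \<exists>Y\<in>R k. Y \<inter> ball p 1 \<noteq> {} \<and>
     (\<exists>\<mu>\<in>filling_vols (q ^ DIM('a)) F. \<bar>ln (vol Y) - ln \<mu>\<bar> \<le> \<epsilon>)) sequentially"
    (is "eventually ?P sequentially")
proof (rule ccontr)
  assume "\<not> eventually ?P sequentially"
  from not_eventually_sequentiallyD[OF this]
  obtain r0 :: "nat \<Rightarrow> nat" where r0: "strict_mono r0" "\<forall>k. \<not> ?P (r0 k)" by (elim exE conjE) (rule that)
  have lim0: "(\<lambda>k. set_metric (boundary_set (R (r0 k))) B) \<longlonglongrightarrow> 0"
    using LIMSEQ_subseq_LIMSEQ[OF lim r0(1)] by (simp add: o_def)
  have "eventually (\<lambda>k. \<exists>y\<in>boundary_set (R (r0 k)). dist p y < 1) sequentially"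
    by (rule set_metric_limit_approach[OF lim0 p]) simp
  then obtain N where N: "\<And>k. k \<ge> N \<Longrightarrow> boundary_set (R (r0 k)) \<noteq> {}"
    unfolding eventually_sequentially by blast
  define R' where "R' k = R (r0 (k + N))" for k
  have lim': "(\<lambda>k. set_metric (boundary_set (R' k)) B) \<longlonglongrightarrow> 0"
    unfolding R'_def using LIMSEQ_ignore_initial_segment[OF lim0] .
  have no: "\<not> (\<exists>Y\<in>R' k. Y \<inter> ball p 1 \<noteq> {} \<and> (\<exists>\<mu>\<in>filling_vols (q ^ DIM('a)) F. \<bar>ln (vol Y) - ln \<mu>\<bar> \<le> \<epsilon>))" for k
    unfolding R'_def by (rule r0(2)[THEN spec])
  have "\<exists>Y y. Y \<in> R' k \<and> y \<in> frontier Y \<and> dist p y < infdist p (boundary_set (R' k)) + 1 / real (Suc k)" for k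
  proof -
    have "boundary_set (R' k) \<noteq> {}" unfolding R'_def by (intro N) simp
    moreover from this have "\<exists>y\<in>boundary_set (R' k). dist p y < infdist p (boundary_set (R' k)) + 1 / real (Suc k)"
      by (subst cINF_less_iff[symmetric]) (auto simp: infdist_def)
    ultimately show ?thesis by (auto simp: boundary_set_def)
  qed
  then obtain Y y where Yy: "\<And>k. Y k \<in> R' k" "\<And>k. y k \<in> frontier (Y k)"
    "\<And>k. dist p (y k) < infdist p (boundary_set (R' k)) + 1 / real (Suc k)" by metis
  have close: "eventually (\<lambda>k. dist (y k) p < e) sequentially" if "0 < e" for e
  proof -
    have "eventually (\<lambda>k. \<exists>y\<in>boundary_set (R' k). dist p y < e / 2) sequentially"
      using that by (intro set_metric_limit_approach[OF lim' p]) simp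
    moreover have "eventually (\<lambda>k. 1 / real (Suc k) < e / 2) sequentially"
      using order_tendstoD(2)[OF LIMSEQ_inverse_real_of_nat, of "e / 2"] that by (simp add: inverse_eq_divide)
    ultimately show ?thesis
    proof eventually_elim
      case (elim k)
      then obtain z where "z \<in> boundary_set (R' k)" "dist p z < e / 2" by blast
      then have "infdist p (boundary_set (R' k)) < e / 2" by (meson infdist_le le_less_trans)
      then show ?case using Yy(3)[of k] elim(2) by (simp add: dist_commute)
    qed
  qed
  then have yp: "y \<longlonglongrightarrow> p" by (rule tendstoI)
  have R'R: "is_copy Y \<and> q \<le> vol Y \<and> vol Y \<le> 1" if "Y \<in> R' k" for Y k using that R unfolding R'_def by blast
  have disj': "pairwise (\<lambda>S T. interior S \<inter> interior T = {}) (R' k)" for k unfolding R'_def by (rule disj)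
  obtain Z s where Z: "is_copy Z" "q ^ DIM('a) \<le> vol Z" "vol Z \<le> 1" "p \<in> frontier Z" "frontier Z \<subseteq> B"
    "interior Z \<inter> B = {}" "strict_mono (s :: nat \<Rightarrow> nat)" "(\<lambda>k. vol (Y (s k))) \<longlonglongrightarrow> vol Z"
    by (rule limit_tile[OF R'R disj' q lim' \<open>closed B\<close> Yy(1,2) yp])
  have "frontier Z \<subseteq> cball p D"
  proof
    fix x assume x: "x \<in> frontier Z"
    have "dist x p \<le> D"
    proof (rule ccontr)
      assume "\<not> dist x p \<le> D"
      define e where "e = (dist x p - D) / 2"
      have e: "0 < e" "dist x p = D + 2 * e" using \<open>\<not> dist x p \<le> D\<close> by (simp_all add: e_def diff_divide_distrib)
      have "x \<in> closure Z" "p \<in> closure Z" using x Z(4) by (auto simp: frontier_def)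
      with e(1) obtain x' p' where "x' \<in> Z" "dist x' x < e" "p' \<in> Z" "dist p' p < e"
        unfolding closure_approachable by meson
      moreover have "dist x p \<le> dist x' x + dist x' p' + dist p' p"
        by (smt (verit) dist_commute dist_triangle)
      moreover have "dist x' p' \<le> D" by (rule D[OF Z(1,3)]) fact+
      ultimately show False using e(2) by linarith
    qed
    then show "x \<in> cball p D" by (simp add: dist_commute)
  qed
  then have "frontier Z \<subseteq> F" using Z(5) F(2) by blast
  then have mu: "vol Z \<in> filling_vols (q ^ DIM('a)) F"
    unfolding filling_vols_def using Z F(1) by blast
  have "0 < vol Z" using copy_vol_pos[OF Z(1)] .
  then have "(\<lambda>k. ln (vol (Y (s k)))) \<longlonglongrightarrow> ln (vol Z)" by (intro tendsto_ln Z(8)) simp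
  then have "eventually (\<lambda>k. dist (ln (vol (Y (s k)))) (ln (vol Z)) < \<epsilon>) sequentially"
    using \<open>0 < \<epsilon>\<close> by (rule tendstoD)
  moreover have "eventually (\<lambda>k. dist (y (s k)) p < 1 / 2) sequentially"
    using eventually_subseq[OF Z(7) close[of "1 / 2"]] by simp
  ultimately have "eventually (\<lambda>k. False) sequentially"
  proof eventually_elim
    case (elim k)
    have "y (s k) \<in> closure (Y (s k))" using Yy(2) by (simp add: frontier_def)
    then obtain z where z: "z \<in> Y (s k)" "dist z (y (s k)) < 1 / 2"
      unfolding closure_approachable by (metis half_gt_zero zero_less_one)
    have "dist p z < 1" using z(2) elim(2) dist_triangle[of p z "y (s k)"] by (simp add: dist_commute)
    then have "Y (s k) \<inter> ball p 1 \<noteq> {}" using z(1) by auto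
    moreover have "\<bar>ln (vol (Y (s k))) - ln (vol Z)\<bar> \<le> \<epsilon>" using elim(1) by (simp add: dist_real_def)
    ultimately show ?case using no[of "s k"] Yy(1)[of "s k"] mu by blast
  qed
  then show False by simp
qed

end

section \<open>Counting translates of a tile\<close>

lemma separated_subset:
  fixes G :: "'a::metric_space set"
  assumes "finite G" "0 < K"
  shows "\<exists>G'\<subseteq>G. (\<forall>g\<in>G'. \<forall>h\<in>G'. g \<noteq> h \<longrightarrow> K \<le> dist g h) \<and> (\<forall>g\<in>G. \<exists>h\<in>G'. dist g h < K)"
  using assms(1)
proof (induction G rule: finite_induct)
  case (insert x G)
  then obtain G' where G': "G' \<subseteq> G" "\<forall>g\<in>G'. \<forall>h\<in>G'. g \<noteq> h \<longrightarrow> K \<le> dist g h" "\<forall>g\<in>G. \<exists>h\<in>G'. dist g h < K" by blast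
  show ?case
  proof (cases "\<exists>h\<in>G'. dist x h < K")
    case True
    then show ?thesis using G' by (intro exI[of _ G']) auto
  next
    case False
    then show ?thesis using G' assms(2) by (intro exI[of _ "insert x G'"]) (auto simp: dist_commute not_less)
  qed
qed simp

lemma tile_interior_measure_pos:
  assumes "is_tile X"
  shows "interior X \<in> lmeasurable" "0 < measure lebesgue (interior X)"
proof -
  show lm: "interior X \<in> lmeasurable"
    using assms by (simp add: is_tile_def bounded_interior lmeasurable_interior)
  have "\<not> negligible (interior X)" using open_not_negligible tile_interior_nonempty[OF assms] by blast
  then show "0 < measure lebesgue (interior X)" using lm by (metis measure_nonneg negligible_iff_measure order_less_le)
qed

text \<open>Translates of \<open>X\<close> by different vectors are different tiles of the tiling, so their interiors are disjoint
and few of them fit near \<open>h\<close>.\<close>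

lemma translates_packing:
  fixes X :: "'a::euclidean_space set"
  assumes "is_tiling \<T>" and X: "is_tile X" "X \<subseteq> cball 0 r"
    and I: "finite I" "\<And>g. g \<in> I \<Longrightarrow> translate g X \<in> \<T>" "\<And>g. g \<in> I \<Longrightarrow> dist g h < K"
  shows "real (card I) \<le> measure lebesgue (cball 0 (K + r) :: 'a set) / measure lebesgue (interior X)"
proof -
  have m: "interior X \<in> lmeasurable" "0 < measure lebesgue (interior X)" using tile_interior_measure_pos[OF X(1)] .
  have "real (card I) * measure lebesgue (interior X) \<le> measure lebesgue (cball h (K + r))"
  proof (rule card_packing_le[where f = "\<lambda>g. (+) g ` interior X"])
    show "(+) g ` interior X \<in> lmeasurable" for g using m(1) by (rule measurable_translation)
    show "measure lebesgue (interior X) \<le> measure lebesgue ((+) g ` interior X)" for g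
      by (simp add: measure_translation)
    show "(+) g ` interior X \<subseteq> cball h (K + r)" if "g \<in> I" for g
    proof
      fix y assume "y \<in> (+) g ` interior X"
      then obtain x where x: "x \<in> X" "y = g + x" using interior_subset by blast
      have "norm x \<le> r" using x(1) X(2) by auto
      moreover have "dist h y \<le> dist g h + norm x"
        unfolding x(2) using dist_triangle[of h "g + x" g] by (simp add: dist_commute dist_norm)
      ultimately show "y \<in> cball h (K + r)" using I(3)[OF that] by simp
    qed
    show "(+) g ` interior X \<inter> (+) g' ` interior X = {}" if "g \<in> I" "g' \<in> I" "g \<noteq> g'" for g g'
    proof -
      have "translate g X \<noteq> translate g' X"
      proof
        assume eq: "translate g X = translate g' X"
        have "translate (g - g') X = translate (- g') (translate g X)"
          by (simp add: translate_def image_image add_diff_eq diff_add_eq)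
        also have "\<dots> = X" unfolding eq by (simp add: translate_def image_image)
        finally have "g - g' = 0" using X(1) by (intro translate_eq_self[of X]) (auto simp: is_tile_def)
        then show False using that by simp
      qed
      then have "interior (translate g X) \<inter> interior (translate g' X) = {}"
        using assms(1) I(2) that by (auto simp: is_tiling_def tessellation_def pairwise_def)
      then show ?thesis by (simp add: translate_def interior_translation)
    qed
  qed (use I(1) in auto)
  also have "measure lebesgue (cball h (K + r)) = measure lebesgue (cball 0 (K + r) :: 'a set)"
    using measure_translation[of h "cball 0 (K + r) :: 'a set"] by (simp add: cball_translation)
  finally show ?thesis using m(2) by (simp add: le_divide_eq)
qed

context multiscale_scheme
begin

text \<open>The tiles \<open>g + X\<close>, \<open>g \<in> G\<close>, form a sub-patch of the tiling, so its boundary set is a limit of boundary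
sets of generated patches. The translates are so far apart that a tile near \<open>g + p\<close> sees only the
boundary of \<open>g + X\<close>. Hence each \<open>g\<close> has its own tile in a generated patch, with a volume close to one
of finitely many values that depend on \<open>X\<close> only.\<close>

lemma selected_tiles:
  assumes \<T>: "\<T> \<in> tiling_space \<sigma>" and X: "is_tile X" "X \<subseteq> cball 0 r" "p \<in> frontier X"
    and D: "\<And>X x y. is_copy X \<Longrightarrow> vol X \<le> 1 \<Longrightarrow> x \<in> X \<Longrightarrow> y \<in> X \<Longrightarrow> dist x y \<le> D"
    and q: "0 < q" "q \<le> 1" "\<forall>i<n. \<forall>Y\<in>E i. q \<le> vol Y" and eps: "0 < \<epsilon>"
    and G: "finite G" "\<And>g. g \<in> G \<Longrightarrow> translate g X \<in> \<T>"
    and sep: "\<And>g h. g \<in> G \<Longrightarrow> h \<in> G \<Longrightarrow> g \<noteq> h \<Longrightarrow> 2 * r + D < dist g h"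
  obtains P w where "P \<in> generating_patches \<sigma>"
    "\<forall>g\<in>G. \<exists>Y\<in>P. translate w Y \<inter> ball (g + p) 1 \<noteq> {} \<and>
       (\<exists>\<mu>\<in>filling_vols (q ^ DIM('a)) (frontier X). \<bar>ln (vol Y) - ln \<mu>\<bar> \<le> \<epsilon>)"
proof (cases "G = {}")
  case True
  \<comment> \<open>The empty family is not a patch; any generated patch will do for it.\<close>
  have "flow \<sigma> 0 0 \<in> generating_patches \<sigma>" using types by (auto simp: generating_patches_def)
  then show ?thesis using that True by blast
next
  case False
  let ?Q = "(\<lambda>g. translate g X) ` G"
  let ?B = "boundary_set ?Q"
  have fr: "frontier (translate g X) = translate g (frontier X)" for g
    using frontier_similar[of 1 g X] by (simp add: rescale_def)
  have B: "?B = (\<Union>g\<in>G. translate g (frontier X))" by (simp add: boundary_set_def fr)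
  have "subpatch ?Q \<T>"
  proof -
    have "tessellation \<T> UNIV" using \<T> by (simp add: tiling_space_def is_tiling_def)
    then have "tessellation ?Q (\<Union>?Q)"
      using G(2) unfolding tessellation_def by (auto intro: pairwise_subset)
    moreover have "bounded (\<Union>?Q)"
      using G(1) X(1) by (auto simp: is_tile_def translate_def intro!: bounded_Union bounded_translation)
    ultimately show ?thesis using False G(2) by (auto simp: subpatch_def is_patch_def)
  qed
  then obtain S w where S: "\<forall>k::nat. \<exists>P\<in>generating_patches \<sigma>. subpatch (S k) P"
    and lim: "(\<lambda>k. set_metric (boundary_set (translate (w k) ` S k)) ?B) \<longlonglongrightarrow> 0"
    using \<T> unfolding tiling_space_def limit_of_generated_def by blast
  define R where "R k = translate (w k) ` S k" for k
  have Rc: "is_copy Y \<and> q \<le> vol Y \<and> vol Y \<le> 1" if Y: "Y \<in> R k" for k Y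
  proof -
    obtain Y0 where Y0: "Y0 \<in> S k" "Y = translate (w k) Y0" using Y by (auto simp: R_def)
    obtain P where P: "P \<in> generating_patches \<sigma>" "subpatch (S k) P" using S by blast
    have "Y0 \<in> P" using P(2) Y0(1) by (auto simp: subpatch_def)
    note t = generated_patch_tile[OF P(1) this]
    show ?thesis using t(1,2) t(3)[OF q] translate_copy[OF t(1)] by (simp add: Y0(2))
  qed
  have disj: "pairwise (\<lambda>S T. interior S \<inter> interior T = {}) (R k)" for k
  proof -
    have "tessellation (S k) (\<Union>(S k))" using S by (auto simp: subpatch_def is_patch_def)
    from tessellation_similar[OF this, of 1 "w k"] show ?thesis
      by (simp add: tessellation_def R_def rescale_def)
  qed
  have cl: "closed ?B" unfolding boundary_set_def using G(1) by (intro closed_UN) auto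
  have ev: "eventually (\<lambda>k. \<exists>Y\<in>R k. Y \<inter> ball (g + p) 1 \<noteq> {} \<and>
     (\<exists>\<mu>\<in>filling_vols (q ^ DIM('a)) (frontier X). \<bar>ln (vol Y) - ln \<mu>\<bar> \<le> \<epsilon>)) sequentially" if g: "g \<in> G" for g
  proof -
    have sub: "translate g (frontier X) \<subseteq> ?B" using g B by blast
    have gp: "g + p \<in> ?B" using sub X(3) by (auto simp: translate_def)
    have frX: "norm y \<le> r" if "y \<in> frontier X" for y
    proof -
      have "closure X \<subseteq> cball 0 r" using X(2) by (intro closure_minimal) auto
      then show ?thesis using that by (auto simp: frontier_def)
    qed
    have loc: "?B \<inter> cball (g + p) D \<subseteq> translate g (frontier X)"
    proof
      fix x assume x: "x \<in> ?B \<inter> cball (g + p) D"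
      then obtain h y where h: "h \<in> G" "y \<in> frontier X" "x = h + y" unfolding B by (auto simp: translate_def)
      have "dist g h \<le> norm (g + p - x) + norm y + norm p"
      proof -
        have "g - h = (g + p - x) + (y - p)" by (simp add: h(3))
        then have "norm (g - h) \<le> norm (g + p - x) + norm (y - p)" by (metis norm_triangle_ineq)
        then show ?thesis using norm_triangle_ineq4[of y p] by (simp add: dist_norm)
      qed
      also have "\<dots> \<le> D + r + r" using x frX[OF h(2)] frX[OF X(3)] by (auto simp: dist_norm)
      finally have "g = h" using sep[OF g h(1)] by fastforce
      then show "x \<in> translate g (frontier X)" using h by (auto simp: translate_def)
    qed
    have "eventually (\<lambda>k. \<exists>Y\<in>R k. Y \<inter> ball (g + p) 1 \<noteq> {} \<and>
     (\<exists>\<mu>\<in>filling_vols (q ^ DIM('a)) (translate g (frontier X)). \<bar>ln (vol Y) - ln \<mu>\<bar> \<le> \<epsilon>)) sequentially"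
      by (rule matched_tile_eventually[OF Rc disj q(1,2) _ cl gp sub loc D eps]) (use lim in \<open>auto simp: R_def\<close>)
    then show ?thesis by (simp only: filling_vols_translate)
  qed
  have "eventually (\<lambda>k. \<forall>g\<in>G. \<exists>Y\<in>R k. Y \<inter> ball (g + p) 1 \<noteq> {} \<and>
     (\<exists>\<mu>\<in>filling_vols (q ^ DIM('a)) (frontier X). \<bar>ln (vol Y) - ln \<mu>\<bar> \<le> \<epsilon>)) sequentially"
    using ev by (intro eventually_ball_finite G(1)) blast
  then obtain k where k: "\<forall>g\<in>G. \<exists>Y\<in>R k. Y \<inter> ball (g + p) 1 \<noteq> {} \<and>
     (\<exists>\<mu>\<in>filling_vols (q ^ DIM('a)) (frontier X). \<bar>ln (vol Y) - ln \<mu>\<bar> \<le> \<epsilon>)"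
    using eventually_happens'[OF sequentially_bot] by blast
  obtain P where P: "P \<in> generating_patches \<sigma>" "subpatch (S k) P" using S by blast
  show ?thesis
  proof (rule that[OF P(1)], intro ballI)
    fix g assume "g \<in> G"
    then obtain Y \<mu> where Y: "Y \<in> R k" "Y \<inter> ball (g + p) 1 \<noteq> {}"
      "\<mu> \<in> filling_vols (q ^ DIM('a)) (frontier X)" "\<bar>ln (vol Y) - ln \<mu>\<bar> \<le> \<epsilon>" using k by blast
    then obtain Y0 where Y0: "Y0 \<in> S k" "Y = translate (w k) Y0" by (auto simp: R_def)
    have "Y0 \<in> P" using P(2) Y0(1) by (auto simp: subpatch_def)
    moreover have "vol Y = vol Y0" by (simp add: Y0(2) translate_def measure_translation)
    ultimately show "\<exists>Y\<in>P. translate (w k) Y \<inter> ball (g + p) 1 \<noteq> {} \<and>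
       (\<exists>\<mu>\<in>filling_vols (q ^ DIM('a)) (frontier X). \<bar>ln (vol Y) - ln \<mu>\<bar> \<le> \<epsilon>)"
      using Y Y0(2) by metis
  qed
qed

text \<open>Thin the occurrences of \<open>X\<close> to a separated set, losing the factor \<open>M1\<close>, and match the
remaining ones injectively with tiles of a generated patch whose volumes are close to finitely many values; each
value contributes a share of at most \<open>\<eta>\<close>. The constant \<open>M\<close> is chosen before \<open>\<eta>\<close>, so that \<open>M * \<eta>\<close>
can be made small.\<close>

proposition translates_count_bound:
  assumes irr: "irreducible_scheme \<sigma>" and inc: "incommensurable \<sigma>"
    and \<T>: "\<T> \<in> tiling_space \<sigma>" and X: "X \<in> \<T>"
  obtains M where "0 \<le> M"
    "\<forall>\<eta>>0. \<exists>C V. \<forall>A. bounded A \<longrightarrow> real (card (occurrences {X} \<T> A)) \<le> M * (\<eta> * vol (thicken C A) + V)"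
proof -
  have til: "is_tiling \<T>" using \<T> by (simp add: tiling_space_def)
  have tX: "is_tile X" using til X by (auto simp: is_tiling_def tessellation_def)
  obtain r where "0 < r" "X \<subseteq> ball 0 r"
    using tX bounded_subset_ballD[of X 0] by (auto simp: is_tile_def)
  then have r: "0 < r" "X \<subseteq> cball 0 r" using ball_subset_cball by blast+
  have "frontier X \<noteq> {}" using tX by (metis frontier_not_empty not_bounded_UNIV is_tile_def less_irrefl measure_empty)
  then obtain p where p: "p \<in> frontier X" by blast
  obtain x0 where x0: "x0 \<in> X" "dist x0 p < 1"
    using p unfolding frontier_def by (metis DiffD1 closure_approachable zero_less_one)
  obtain q Q where qQ: "0 < q" "Q < 1" "0 \<le> Q" "\<forall>i<n. \<forall>Y\<in>E i. q \<le> vol Y \<and> vol Y \<le> Q"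
    by (rule rule_vol_bounds)
  have q: "0 < q" "q \<le> 1" "\<forall>i<n. \<forall>Y\<in>E i. q \<le> vol Y"
  proof -
    obtain Y where "Y \<in> E 0" using rule_vol_sum[OF types] by fastforce
    then have "q \<le> vol Y \<and> vol Y \<le> Q" using qQ(4) types by blast
    then show "q \<le> 1" using qQ(2) by linarith
  qed (use qQ in auto)
  obtain D where D0: "0 < D" and D: "\<forall>X x y. is_copy X \<longrightarrow> vol X \<le> 1 \<longrightarrow> x \<in> X \<longrightarrow> y \<in> X \<longrightarrow> dist x y \<le> D"
    by (rule copy_diameter)
  \<comment> \<open>Separation \<open>2 * r + D\<close> isolates the boundaries, and \<open>D + 2\<close> makes the matching injective.\<close>
  define K where "K = 2 * r + D + 3"
  let ?\<Lambda> = "filling_vols (q ^ DIM('a)) (frontier X)"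
  have "bounded (frontier X)" using tX by (simp add: is_tile_def compact_frontier_bounded compact_imp_bounded)
  then have fin: "finite ?\<Lambda>" using q by (intro finite_filling_vols) auto
  have \<Lambda>: "0 < \<mu> \<and> \<mu> \<le> 1" if "\<mu> \<in> ?\<Lambda>" for \<mu> using that copy_vol_pos by (auto simp: filling_vols_def)
  define M1 where "M1 = measure lebesgue (cball 0 (K + r) :: 'a set) / measure lebesgue (interior X)"
  define M2 where "M2 = (\<Sum>\<mu>\<in>?\<Lambda>. 1 / (\<mu> * exp (- 1)))"
  have M: "0 \<le> M1" "0 \<le> M2"
    unfolding M1_def M2_def by (auto intro!: sum_nonneg divide_nonneg_nonneg dest: \<Lambda>)
  have "\<exists>C V. \<forall>A. bounded A \<longrightarrow> real (card (occurrences {X} \<T> A)) \<le> M1 * M2 * (\<eta> * vol (thicken C A) + V)"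
    if eta: "0 < \<eta>" for \<eta>
  proof -
    obtain \<epsilon> V C where gen: "0 < \<epsilon>" "0 < C"
      "\<forall>\<mu> R P. 0 < \<mu> \<longrightarrow> \<mu> \<le> 1 \<longrightarrow> bounded R \<longrightarrow> P \<in> generating_patches \<sigma> \<longrightarrow>
       finite P \<and> \<mu> * exp (- 1) * real (card {Y \<in> P. \<bar>ln (vol Y) - ln \<mu>\<bar> \<le> \<epsilon> \<and> Y \<inter> R \<noteq> {}})
         \<le> \<eta> * vol (thicken C R) + V"
      by (rule generated_patch_count[OF irr inc eta])
    have "real (card (occurrences {X} \<T> A)) \<le> M1 * M2 * (\<eta> * vol (thicken (C + 3) A) + V)" if A: "bounded A" for A
    proof -
      let ?G = "occurrences {X} \<T> A"
      have G: "translate g X \<in> \<T>" "translate g X \<subseteq> A" if "g \<in> ?G" for g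
        using that by (auto simp: occurrences_def)
      have "subpatch {X} \<T>" using X tX by (auto simp: subpatch_def is_patch_def tessellation_def is_tile_def pairwise_def)
      then have finG: "finite ?G" by (intro finite_occurrences til A)
      have "0 < K" using r D0 by (simp add: K_def)
      from separated_subset[OF finG this]
      obtain G' where G': "G' \<subseteq> ?G" "\<forall>g\<in>G'. \<forall>h\<in>G'. g \<noteq> h \<longrightarrow> K \<le> dist g h" "\<forall>g\<in>?G. \<exists>h\<in>G'. dist g h < K"
        by (elim exE conjE) (rule that)
      have finG': "finite G'" using G'(1) finG finite_subset by blast
      have "real (card ?G) \<le> M1 * real (card G')"
      proof -
        have "card ?G \<le> card (\<Union>h\<in>G'. {g \<in> ?G. dist g h < K})"
          using finG finG' G'(3) by (intro card_mono finite_UN_I) auto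
        also have "\<dots> \<le> (\<Sum>h\<in>G'. card {g \<in> ?G. dist g h < K})" by (rule card_UN_le[OF finG'])
        finally have "real (card ?G) \<le> real (\<Sum>h\<in>G'. card {g \<in> ?G. dist g h < K})"
          by (rule of_nat_mono)
        also have "\<dots> = (\<Sum>h\<in>G'. real (card {g \<in> ?G. dist g h < K}))" by simp
        also have "\<dots> \<le> (\<Sum>h\<in>G'. M1)"
        proof (rule sum_mono)
          fix h
          show "real (card {g \<in> ?G. dist g h < K}) \<le> M1"
            unfolding M1_def by (rule translates_packing[OF til tX r(2), where h = h]) (use finG G in auto)
        qed
        finally show ?thesis by (simp add: mult.commute)
      qed
      moreover have "real (card G') \<le> M2 * (\<eta> * vol (thicken (C + 3) A) + V)"
      proof -
        obtain P w where P: "P \<in> generating_patches \<sigma>"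
          "\<forall>g\<in>G'. \<exists>Y\<in>P. translate w Y \<inter> ball (g + p) 1 \<noteq> {} \<and> (\<exists>\<mu>\<in>?\<Lambda>. \<bar>ln (vol Y) - ln \<mu>\<bar> \<le> \<epsilon>)"
        proof (rule selected_tiles[OF \<T> tX r(2) p _ q gen(1) finG'])
          show "translate g X \<in> \<T>" if "g \<in> G'" for g using that G'(1) G(1) by blast
          show "2 * r + D < dist g h" if "g \<in> G'" "h \<in> G'" "g \<noteq> h" for g h
            using G'(2) that unfolding K_def by fastforce
          show "dist x y \<le> D" if "is_copy X" "vol X \<le> 1" "x \<in> X" "y \<in> X" for X x y using D that by blast
        qed blast
        then obtain Y \<mu> where Y: "\<And>g. g \<in> G' \<Longrightarrow> Y g \<in> P" "\<And>g. g \<in> G' \<Longrightarrow> translate w (Y g) \<inter> ball (g + p) 1 \<noteq> {}"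
          "\<And>g. g \<in> G' \<Longrightarrow> \<mu> g \<in> ?\<Lambda>" "\<And>g. g \<in> G' \<Longrightarrow> \<bar>ln (vol (Y g)) - ln (\<mu> g)\<bar> \<le> \<epsilon>"
          by metis
        define R0 where "R0 = (\<Union>g\<in>G'. ball (g + p) 1)"
        define R where "R = translate (- w) R0"
        have bR: "bounded R" unfolding R_def R0_def translate_def using finG' by (intro bounded_translation) auto
        have inj: "inj_on Y G'"
        proof (rule inj_onI, rule ccontr)
          fix g h assume gh: "g \<in> G'" "h \<in> G'" "Y g = Y h" "g \<noteq> h"
          obtain a b where ab: "a \<in> Y g" "dist (g + p) (w + a) < 1" "b \<in> Y g" "dist (h + p) (w + b) < 1"
            using Y(2)[OF gh(1)] Y(2)[OF gh(2)] gh(3) by (auto simp: translate_def)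
          have "dist a b \<le> D" using D generated_patch_tile(1,2)[OF P(1) Y(1)[OF gh(1)]] ab by blast
          moreover have "dist g h = dist (g + p) (h + p)" by simp
          moreover have "dist (g + p) (h + p) \<le> dist (g + p) (w + a) + dist (w + a) (w + b) + dist (h + p) (w + b)"
            using dist_triangle[of "g + p" "h + p" "w + a"] dist_triangle[of "w + a" "h + p" "w + b"]
            by (simp add: dist_commute)
          moreover have "K \<le> dist g h" using G'(2) gh by blast
          ultimately show False using ab r(1) unfolding K_def by simp
        qed
        let ?N = "\<lambda>m. {Z \<in> P. \<bar>ln (vol Z) - ln m\<bar> \<le> \<epsilon> \<and> Z \<inter> R \<noteq> {}}"
        have finP: "finite P" using gen(3)[rule_format, of 1 "{}" P] P(1) by simp
        have YN: "Y ` G' \<subseteq> (\<Union>m\<in>?\<Lambda>. ?N m)"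
        proof (rule image_subsetI)
          fix g assume g: "g \<in> G'"
          obtain a where a: "a \<in> Y g" "w + a \<in> ball (g + p) 1" using Y(2)[OF g] by (auto simp: translate_def)
          have "w + a \<in> R0" using a(2) g unfolding R0_def by blast
          then have "- w + (w + a) \<in> R" unfolding R_def translate_def by (rule imageI)
          then have "a \<in> R" by simp
          then show "Y g \<in> (\<Union>m\<in>?\<Lambda>. ?N m)" using a(1) Y[OF g] by blast
        qed
        have "card G' = card (Y ` G')" using card_image[OF inj] by simp
        also have "\<dots> \<le> card (\<Union>m\<in>?\<Lambda>. ?N m)" using YN fin finP by (intro card_mono) auto
        also have "\<dots> \<le> (\<Sum>m\<in>?\<Lambda>. card (?N m))" by (rule card_UN_le[OF fin])
        finally have "real (card G') \<le> real (\<Sum>m\<in>?\<Lambda>. card (?N m))" by (rule of_nat_mono)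
        also have "\<dots> = (\<Sum>m\<in>?\<Lambda>. real (card (?N m)))" by simp
        also have "\<dots> \<le> (\<Sum>m\<in>?\<Lambda>. 1 / (m * exp (- 1)) * (\<eta> * vol (thicken C R) + V))"
        proof (rule sum_mono)
          fix m assume m: "m \<in> ?\<Lambda>"
          have "m * exp (- 1) * real (card (?N m)) \<le> \<eta> * vol (thicken C R) + V"
            using gen(3) \<Lambda>[OF m] bR P(1) by blast
          moreover have "0 < m * exp (- 1)" using \<Lambda>[OF m] by simp
          ultimately show "real (card (?N m)) \<le> 1 / (m * exp (- 1)) * (\<eta> * vol (thicken C R) + V)"
            by (simp add: field_simps)
        qed
        also have "\<dots> = M2 * (\<eta> * vol (thicken C R) + V)" by (simp add: M2_def sum_distrib_right)
        also have "\<dots> \<le> M2 * (\<eta> * vol (thicken (C + 3) A) + V)"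
        proof -
          have "thicken C R0 \<subseteq> thicken (C + 3) A"
          proof
            fix x assume "x \<in> thicken C R0"
            then obtain b where b: "b \<in> R0" "dist x b < C + 1" by (rule mem_thickenE[where s = "C + 1"]) auto
            then obtain g where g: "g \<in> G'" "dist (g + p) b < 1" by (auto simp: R0_def)
            have "g + x0 \<in> A" using G(2) G'(1) g(1) x0(1) by (auto simp: translate_def)
            moreover have "dist (g + p) (g + x0) < 1" using x0(2) by (simp add: dist_commute)
            moreover have "dist x (g + x0) \<le> dist x b + dist (g + p) b + dist (g + p) (g + x0)"
              using dist_triangle[of x "g + x0" b] dist_triangle[of b "g + x0" "g + p"] by (simp add: dist_commute)
            ultimately show "x \<in> thicken (C + 3) A" using b(2) g(2) by (intro mem_thickenI) auto
          qed
          moreover have "bounded R0" unfolding R0_def using finG' by auto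
          ultimately have "vol (thicken C R0) \<le> vol (thicken (C + 3) A)"
            by (intro measure_mono_fmeasurable lmeasurable_thicken A) (auto intro: fmeasurableD lmeasurable_thicken)
          moreover have "vol (thicken C R) = vol (thicken C R0)"
            unfolding R_def thicken_translate unfolding translate_def by (rule measure_translation)
          ultimately show ?thesis using eta M(2) by (intro mult_left_mono add_right_mono) auto
        qed
        finally show ?thesis .
      qed
      ultimately show ?thesis using M(1) mult_left_mono[of "real (card G')" _ M1] by (fastforce simp: mult.assoc)
    qed
    then show ?thesis by blast
  qed
  then show ?thesis using that[of "M1 * M2"] M by auto
qed

end

section \<open>Vanishing of patch frequencies\<close>

text \<open>The \<open>1\<close>-neighbourhood of the boundary contains a unit ball, so its volume can be negligible only if
the volume of \<open>A q\<close> is large.\<close>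

lemma van_hove_vol_at_top:
  fixes A :: "nat \<Rightarrow> 'a::euclidean_space set"
  assumes "van_hove A"
  shows "(\<lambda>q. 1 / measure lebesgue (A q)) \<longlonglongrightarrow> 0"
proof -
  define c where "c = measure lebesgue (cball 0 1 :: 'a set)"
  have c: "0 < c" by (simp add: c_def)
  have lim: "(\<lambda>q. measure lebesgue (thicken 1 (frontier (A q))) / measure lebesgue (A q) / c) \<longlonglongrightarrow> 0 / c"
    using assms c by (intro tendsto_divide) (auto simp: van_hove_def)
  show ?thesis
  proof (rule tendsto_sandwich[OF _ _ tendsto_const])
    show "(\<lambda>q. measure lebesgue (thicken 1 (frontier (A q))) / measure lebesgue (A q) / c) \<longlonglongrightarrow> 0" using lim by simp
    show "eventually (\<lambda>q. 1 / measure lebesgue (A q) \<le> measure lebesgue (thicken 1 (frontier (A q))) / measure lebesgue (A q) / c) sequentially"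
      unfolding eventually_sequentially
    proof (intro exI[of _ 1] allI impI)
      fix q :: nat assume "1 \<le> q"
      then have A: "bounded (A q)" "0 < measure lebesgue (A q)" using assms by (auto simp: van_hove_def)
      have "A q \<noteq> {}" using A(2) by auto
      moreover have "A q \<noteq> UNIV" using A(1) not_bounded_UNIV by metis
      ultimately obtain f where f: "f \<in> frontier (A q)" using frontier_not_empty by blast
      have "cball f 1 \<subseteq> thicken 1 (frontier (A q))"
        using f by (auto intro: mem_thickenI simp: dist_commute)
      moreover have "bounded (frontier (A q))" using A(1) by (simp add: compact_frontier_bounded compact_imp_bounded)
      ultimately have "measure lebesgue (cball f 1) \<le> measure lebesgue (thicken 1 (frontier (A q)))"
        by (intro measure_mono_fmeasurable lmeasurable_thicken) auto
      moreover have "measure lebesgue (cball f 1) = c"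
        unfolding c_def using measure_translation[of f "cball 0 1 :: 'a set"] by (simp add: cball_translation)
      ultimately show "1 / measure lebesgue (A q) \<le> measure lebesgue (thicken 1 (frontier (A q))) / measure lebesgue (A q) / c"
        using A(2) c by (simp add: field_simps)
    qed
  qed (auto intro!: always_eventually)
qed

theorem theorem9p7:
  fixes \<sigma> :: "(real ^ 'd) scheme"
    and \<T> P :: "(real ^ 'd) set set"
    and A :: "nat \<Rightarrow> (real ^ 'd) set"
  assumes "substitution_scheme \<sigma>"
    and "normalized \<sigma>"
    and "geometrically_distinct \<sigma>"
    and "origin_positioned \<sigma>"
    and "irreducible_scheme \<sigma>"
    and "incommensurable \<sigma>"
    and "\<T> \<in> tiling_space \<sigma>"
    and "subpatch P \<T>"
    and "van_hove A"
  shows "uniform_limit UNIV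
    (\<lambda>q h. real (patch_count P \<T> (translate h (A q))) / measure lebesgue (A q))
    (\<lambda>h. 0) sequentially"
proof -
  have "0 < num_types \<sigma>" using assms(6) by (auto simp: incommensurable_def)
  then interpret multiscale_scheme \<sigma> using assms by unfold_locales
  obtain X where XP: "X \<in> P" and X: "X \<in> \<T>" using assms(8) by (auto simp: subpatch_def is_patch_def)
  have til: "is_tiling \<T>" using assms(7) by (simp add: tiling_space_def)
  obtain M where M: "0 \<le> M"
    "\<forall>\<eta>>0. \<exists>C V. \<forall>A. bounded A \<longrightarrow> real (card (occurrences {X} \<T> A)) \<le> M * (\<eta> * vol (thicken C A) + V)"
    by (rule translates_count_bound[OF assms(5,6,7) X])
  show ?thesis
  proof (rule uniform_limitI)
    fix e :: real assume e: "0 < e"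
    define \<eta> where "\<eta> = e / (4 * (M + 1))"
    have eta: "0 < \<eta>" "M * \<eta> \<le> e / 4" using e M(1) by (auto simp: \<eta>_def field_simps)
    obtain C V where CV: "\<And>A. bounded A \<Longrightarrow> real (card (occurrences {X} \<T> A)) \<le> M * (\<eta> * vol (thicken C A) + V)"
      using M(2) eta(1) by blast
    \<comment> \<open>The maximum makes the radius positive, whatever the sign of \<open>C\<close>.\<close>
    define r where "r = max 1 (C + 1)"
    have lim1: "(\<lambda>q. vol (thicken r (frontier (A q))) / vol (A q)) \<longlonglongrightarrow> 0"
      using assms(9) by (auto simp: van_hove_def r_def)
    have lim2: "(\<lambda>q. M * \<bar>V\<bar> * (1 / vol (A q))) \<longlonglongrightarrow> M * \<bar>V\<bar> * 0"
      by (intro tendsto_intros van_hove_vol_at_top assms(9))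
    have "eventually (\<lambda>q. vol (thicken r (frontier (A q))) / vol (A q) < 1) sequentially"
      using order_tendstoD(2)[OF lim1] by simp
    moreover have "eventually (\<lambda>q. M * \<bar>V\<bar> * (1 / vol (A q)) < e / 4) sequentially"
      using order_tendstoD(2)[OF lim2, of "e / 4"] e by simp
    moreover have "eventually (\<lambda>q::nat. 1 \<le> q) sequentially" by (rule eventually_ge_at_top)
    ultimately show "\<forall>\<^sub>F q in sequentially. \<forall>h\<in>UNIV.
        dist (real (patch_count P \<T> (translate h (A q))) / vol (A q)) 0 < e"
    proof eventually_elim
      case (elim q)
      have A: "bounded (A q)" "A q \<in> sets lebesgue" "0 < vol (A q)"
        using assms(9) elim(3) by (auto simp: van_hove_def)
      show ?case
      proof
        fix h
        let ?A = "translate h (A q)"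
        have bA: "bounded ?A" using A(1) by (simp add: translate_def bounded_translation)
        have subX: "subpatch {X} \<T>"
          using X til by (auto simp: subpatch_def is_patch_def tessellation_def is_tiling_def is_tile_def pairwise_def)
        have "occurrences P \<T> ?A \<subseteq> occurrences {X} \<T> ?A"
        proof
          fix g assume "g \<in> occurrences P \<T> ?A"
          moreover have "translate g X \<subseteq> translate g (\<Union>P)" using XP by (auto simp: translate_def)
          ultimately show "g \<in> occurrences {X} \<T> ?A" using XP by (auto simp: occurrences_def)
        qed
        then have "patch_count P \<T> ?A \<le> card (occurrences {X} \<T> ?A)"
          unfolding patch_count_def by (intro card_mono finite_occurrences til subX bA)
        then have "real (patch_count P \<T> ?A) \<le> M * (\<eta> * vol (thicken C ?A) + V)"
          using CV[OF bA] by linarith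
        also have "\<dots> \<le> M * (\<eta> * (2 * vol (A q)) + \<bar>V\<bar>)"
        proof -
          have lm: "A q \<in> lmeasurable" "thicken r (frontier (A q)) \<in> lmeasurable"
            using A by (auto intro: bounded_set_imp_lmeasurable lmeasurable_thicken
                compact_imp_bounded compact_frontier_bounded)
          have "thicken C (A q) \<subseteq> A q \<union> thicken r (frontier (A q))"
            using thicken_subset_frontier[of C "A q"] by (force simp: thicken_def r_def)
          then have "vol (thicken C (A q)) \<le> vol (A q \<union> thicken r (frontier (A q)))"
            using lm A(1) by (intro measure_mono_fmeasurable) (auto intro: fmeasurableD lmeasurable_thicken)
          also have "\<dots> \<le> vol (A q) + vol (thicken r (frontier (A q)))"
            using lm by (intro measure_Un_le) (auto intro: fmeasurableD)
          also have "\<dots> \<le> 2 * vol (A q)" using elim(1) A(3) by (simp add: divide_less_eq)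
          finally have "vol (thicken C (A q)) \<le> 2 * vol (A q)" .
          moreover have "vol (thicken C ?A) = vol (thicken C (A q))"
            unfolding thicken_translate unfolding translate_def by (rule measure_translation)
          ultimately show ?thesis using M(1) eta(1) by (intro mult_left_mono add_mono) auto
        qed
        finally have "real (patch_count P \<T> ?A) / vol (A q) \<le> M * (\<eta> * (2 * vol (A q)) + \<bar>V\<bar>) / vol (A q)"
          using A(3) by (intro divide_right_mono) auto
        also have "\<dots> = 2 * (M * \<eta>) + M * \<bar>V\<bar> * (1 / vol (A q))" using A(3) by (simp add: field_simps)
        also have "\<dots> < 2 * (e / 4) + e / 4" using eta(2) elim(2) by linarith
        also have "\<dots> < e" using e by simp
        finally show "dist (real (patch_count P \<T> ?A) / vol (A q)) 0 < e" using A(3) by simp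
      qed
    qed
  qed
qed

end
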